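(* Let $(X,d,f)$ be a topological dynamical system (TDS), i.e. $(X,d)$ is a compact metric space and $f:X\to X$ is continuous. Assume $(X,f)$ is topologically transitive and has the pseudo-orbit tracing property. If $U$ is a nonempty open subset of $\mathscr M_{\rm inv}(X,f)$ (with the weak* topology), then \[ h^B_{\rm top}(\Delta_{sub}(U),f)=h^B_{\rm top}(\Delta_{cap}(U),f)=\sup_{\nu\in U}h_\nu(f). \]
   Context: $\mathscr M_{\rm inv}(X,f)$ is the set of $f$-invariant Borel probability measures on $X$ with the weak* topology; $h_\nu(f)$ is the measure-theoretic entropy. For $x\in X$ and $n\in\mathbb N$, $\mathscr E_n(x)=\frac1n\sum_{i=0}^{n-1}\delta_{f^ix}$, and $V(x)$ is the set of weak* limit points of the sequence $(\mathscr E_n(x))_n$. For $I\subset\mathscr M_{\rm inv}(X,f)$: $\Delta_{sub}(I)=\{x\in X: V(x)\subset I\}$ and $\Delta_{cap}(I)=\{x\in X: V(x)\cap I\neq\emptyset\}$. $(X,f)$ is topologically transitive if for all nonempty open $U,V\subset X$ there is $n\in\mathbb N$ with $f^n(U)\cap V\ne\emptyset$. A $\delta$-pseudo-orbit is a sequence $(x_i)_{i\ge0}$ with $d(f(x_i),x_{i+1})\le\delta$ for all $i$; $f$ has the pseudo-orbit tracing property if for every $\epsilon>0$ there is $\delta>0$ such that for every $\delta$-pseudo-orbit $(x_i)$ there is $x\in X$ with $d(f^ix,x_i)<\epsilon$ for all $i\ge0$. Bowen topological entropy: let $d_n(x,y)=\max_{0\le i\le n-1}d(f^ix,f^iy)$,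 $B_n(x,\epsilon)=\{y:d_n(x,y)<\epsilon\}$. For $Z\subset X$, $\epsilon>0$, $N\in\mathbb N$, let $\Gamma_N(Z,\epsilon)$ be the set of finite or countable covers of $Z$ by sets $B_n(x,\epsilon)$ with $n\ge N$; for $s\in\mathbb R$ set $m(Z,s,N,\epsilon)=\inf_{\mathcal C\in\Gamma_N(Z,\epsilon)}\sum_{B_n(x,\epsilon)\in\mathcal C}e^{-ns}$, $m(Z,s,\epsilon)=\lim_{N\to\infty}m(Z,s,N,\epsilon)$, $h_{\rm top}(Z,\epsilon)=\inf\{s:m(Z,s,\epsilon)=0\}$, and $h^B_{\rm top}(Z,f)=\lim_{\epsilon\to0}h_{\rm top}(Z,\epsilon)$. *)

theory Defs
  imports "HOL-Analysis.Analysis" "HOL-Probability.Probability"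
begin

definition tds :: "'a::metric_space set \<Rightarrow> ('a \<Rightarrow> 'a) \<Rightarrow> bool" where
  "tds X f \<longleftrightarrow> compact X \<and> continuous_on X f \<and> f ` X \<subseteq> X"

definition top_transitive :: "'a::metric_space set \<Rightarrow> ('a \<Rightarrow> 'a) \<Rightarrow> bool" where
  "top_transitive X f \<longleftrightarrow>
     (\<forall>U V. openin (top_of_set X) U \<and> U \<noteq> {} \<and> openin (top_of_set X) V \<and> V \<noteq> {}
        \<longrightarrow> (\<exists>n::nat. n \<ge> 1 \<and> (f ^^ n) ` U \<inter> V \<noteq> {}))"

definition pseudo_orbit :: "'a::metric_space set \<Rightarrow> ('a \<Rightarrow> 'a) \<Rightarrow> real \<Rightarrow> (nat \<Rightarrow> 'a) \<Rightarrow> bool" where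
  "pseudo_orbit X f \<delta> xs \<longleftrightarrow> (\<forall>i. xs i \<in> X) \<and> (\<forall>i. dist (f (xs i)) (xs (Suc i)) \<le> \<delta>)"

definition shadowing :: "'a::metric_space set \<Rightarrow> ('a \<Rightarrow> 'a) \<Rightarrow> bool" where
  "shadowing X f \<longleftrightarrow>
     (\<forall>\<epsilon>>0. \<exists>\<delta>>0. \<forall>xs. pseudo_orbit X f \<delta> xs \<longrightarrow>
        (\<exists>x\<in>X. \<forall>i. dist ((f ^^ i) x) (xs i) < \<epsilon>))"

definition borelX :: "'a::metric_space set \<Rightarrow> 'a measure" where
  "borelX X = restrict_space borel X"

definition probs :: "'a::metric_space set \<Rightarrow> 'a measure set" where
  "probs X = {\<mu>. sets \<mu> = sets (borelX X) \<and> prob_space \<mu>}"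

definition Minv :: "'a::metric_space set \<Rightarrow> ('a \<Rightarrow> 'a) \<Rightarrow> 'a measure set" where
  "Minv X f = {\<mu> \<in> probs X. \<forall>A \<in> sets \<mu>. measure \<mu> (f -` A \<inter> X) = measure \<mu> A}"

definition weak_star :: "'a::metric_space set \<Rightarrow> 'a measure topology" where
  "weak_star X = topology_generated_by
     {{\<mu> \<in> probs X. (integral\<^sup>L \<mu> g) \<in> W} | g W. continuous_on X g \<and> open (W :: real set)}"

definition weak_star_inv :: "'a::metric_space set \<Rightarrow> ('a \<Rightarrow> 'a) \<Rightarrow> 'a measure topology" where
  "weak_star_inv X f = subtopology (weak_star X) (Minv X f)"

definition empirical :: "'a::metric_space set \<Rightarrow> ('a \<Rightarrow> 'a) \<Rightarrow> nat \<Rightarrow> 'a \<Rightarrow> 'a measure" where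
  "empirical X f n x = measure_of X (sets (borelX X))
     (\<lambda>A. ennreal (real (card {i. i < n \<and> (f ^^ i) x \<in> A}) / real n))"

definition Vx :: "'a::metric_space set \<Rightarrow> ('a \<Rightarrow> 'a) \<Rightarrow> 'a \<Rightarrow> 'a measure set" where
  "Vx X f x = {\<nu> \<in> probs X. \<forall>W. openin (weak_star X) W \<and> \<nu> \<in> W \<longrightarrow>
       (\<forall>N. \<exists>n\<ge>N. empirical X f n x \<in> W)}"

definition Delta_sub :: "'a::metric_space set \<Rightarrow> ('a \<Rightarrow> 'a) \<Rightarrow> 'a measure set \<Rightarrow> 'a set" where
  "Delta_sub X f I = {x \<in> X. Vx X f x \<subseteq> I}"

definition Delta_cap :: "'a::metric_space set \<Rightarrow> ('a \<Rightarrow> 'a) \<Rightarrow> 'a measure set \<Rightarrow> 'a set" where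
  "Delta_cap X f I = {x \<in> X. Vx X f x \<inter> I \<noteq> {}}"

text \<open>A finite Borel partition of X is represented by a measurable labelling
  xi : X -> nat with finitely many values; its cells are the level sets in X.\<close>
definition finite_partitions :: "'a::metric_space set \<Rightarrow> ('a \<Rightarrow> nat) set" where
  "finite_partitions X = {\<xi>. \<xi> \<in> borelX X \<rightarrow>\<^sub>M count_space UNIV \<and> finite (\<xi> ` X)}"

text \<open>Shannon entropy H_mu of the partition given by labelling P (natural log, 0 log 0 = 0).\<close>
definition part_entropy :: "'a measure \<Rightarrow> 'a set \<Rightarrow> ('a \<Rightarrow> 'b) \<Rightarrow> real" where
  "part_entropy \<mu> X P = - (\<Sum>v \<in> P ` X.
      measure \<mu> {x \<in> X. P x = v} * ln (measure \<mu> {x \<in> X. P x = v}))"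

text \<open>Labelling of the join xi v f^{-1} xi v ... v f^{-(n-1)} xi.\<close>
definition join_part :: "('a \<Rightarrow> 'a) \<Rightarrow> ('a \<Rightarrow> nat) \<Rightarrow> nat \<Rightarrow> 'a \<Rightarrow> nat list" where
  "join_part f \<xi> n x = map (\<lambda>i. \<xi> ((f ^^ i) x)) [0..<n]"

definition ent_part :: "'a measure \<Rightarrow> 'a set \<Rightarrow> ('a \<Rightarrow> 'a) \<Rightarrow> ('a \<Rightarrow> nat) \<Rightarrow> real" where
  "ent_part \<mu> X f \<xi> = lim (\<lambda>n. part_entropy \<mu> X (join_part f \<xi> n) / real n)"

definition ms_entropy :: "'a::metric_space set \<Rightarrow> ('a \<Rightarrow> 'a) \<Rightarrow> 'a measure \<Rightarrow> ereal" where
  "ms_entropy X f \<mu> = (SUP \<xi> \<in> finite_partitions X. ereal (ent_part \<mu> X f \<xi>))"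

definition bowen_ball :: "'a::metric_space set \<Rightarrow> ('a \<Rightarrow> 'a) \<Rightarrow> 'a \<Rightarrow> nat \<Rightarrow> real \<Rightarrow> 'a set" where
  "bowen_ball X f x n \<epsilon> = {y \<in> X. \<forall>i<n. dist ((f ^^ i) x) ((f ^^ i) y) < \<epsilon>}"

text \<open>Gamma_N(Z,eps): finite or countable families of Bowen balls B_n(x,eps), n >= N, covering Z;
  a family is given by the countable set of its (centre, length) pairs.\<close>
definition bowen_covers :: "'a::metric_space set \<Rightarrow> ('a \<Rightarrow> 'a) \<Rightarrow> 'a set \<Rightarrow> real \<Rightarrow> nat \<Rightarrow> ('a \<times> nat) set set" where
  "bowen_covers X f Z \<epsilon> N = {C. countable C \<and> (\<forall>(x,n)\<in>C. x \<in> X \<and> n \<ge> N)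
        \<and> Z \<subseteq> (\<Union>(x,n)\<in>C. bowen_ball X f x n \<epsilon>)}"

definition bowen_mN :: "'a::metric_space set \<Rightarrow> ('a \<Rightarrow> 'a) \<Rightarrow> 'a set \<Rightarrow> real \<Rightarrow> nat \<Rightarrow> real \<Rightarrow> ennreal" where
  "bowen_mN X f Z s N \<epsilon> = (INF C \<in> bowen_covers X f Z \<epsilon> N.
       \<integral>\<^sup>+ p. ennreal (exp (- real (snd p) * s)) \<partial>count_space C)"

definition bowen_m :: "'a::metric_space set \<Rightarrow> ('a \<Rightarrow> 'a) \<Rightarrow> 'a set \<Rightarrow> real \<Rightarrow> real \<Rightarrow> ennreal" where
  "bowen_m X f Z s \<epsilon> = lim (\<lambda>N. bowen_mN X f Z s N \<epsilon>)"

definition bowen_h_eps :: "'a::metric_space set \<Rightarrow> ('a \<Rightarrow> 'a) \<Rightarrow> 'a set \<Rightarrow> real \<Rightarrow> ereal" where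
  "bowen_h_eps X f Z \<epsilon> = Inf {ereal s | s. bowen_m X f Z s \<epsilon> = 0}"

definition bowen_entropy :: "'a::metric_space set \<Rightarrow> ('a \<Rightarrow> 'a) \<Rightarrow> 'a set \<Rightarrow> ereal" where
  "bowen_entropy X f Z = Lim (at_right (0::real)) (\<lambda>\<epsilon>. bowen_h_eps X f Z \<epsilon>)"

end

theory Submission
  imports Defs
begin

text \<open>Upper bound: if \<open>\<nu> \<in> V(x)\<close> has entropy less than \<open>s\<close>, then for a partition into small cells there
  are a block length \<open>L\<close> and a rational subprobability vector \<open>Q\<close> on names of length \<open>L\<close> for which the
  average of \<open>- ln Q\<close> over the first \<open>n\<close> blocks of the orbit of \<open>x\<close> is below \<open>L * s\<close> for infinitely
  many \<open>n\<close>. As \<open>Q\<close> sums to at most 1, such orbits have at most about \<open>exp (n * s)\<close> names of length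
  \<open>n\<close>, and countably many choices of partition, \<open>L\<close> and \<open>Q\<close> suffice.

  Lower bound: draw \<open>N\<close> orbit segments of length \<open>L\<close> independently with law \<open>\<nu>\<close>. By the law of large
  numbers there are about \<open>exp (N * L * h)\<close> sequences of segments with distinct names whose averages
  are close to those of \<open>\<nu>\<close>; no ergodicity is needed. Transitivity joins consecutive segments by
  pieces of bounded length, shadowing realises all infinite concatenations, and the uniform product
  measure on the concatenations bounds the Bowen entropy from below.

  Nonemptiness of \<open>V(x)\<close>, needed for \<open>\<Delta>\<^sub>s\<^sub>u\<^sub>b(U) \<subseteq> \<Delta>\<^sub>c\<^sub>a\<^sub>p(U)\<close>, is reduced to Helly's selection theorem on
  the line by a ternary coding of \<open>X\<close>.\<close>

section \<open>Bowen entropy\<close>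

text \<open>Entropy need not depend semicontinuously on the measure and \<open>U\<close> is
  uncountable, so covers found for one measure at a time do not add up. The cost condition avoids
  this: it mentions the orbit and finitely many rational parameters, but no measure. Code costs are
  discontinuous in the point, however, while V(x) only controls averages of continuous functions;
  hence the partition radius is first chosen with null boundary spheres and then moved to a
  rational. For the lower bound, typical samples are counted by names, but Bowen balls see
  distances, and points with different names may be arbitrarily close. Names are therefore compared
  only inside a set of nearly full measure on which different cells have a positive gap, and the few
  labels at other times are frozen by a pigeonhole argument. The connecting pieces have different
  lengths, while the product measure argument wants words of one common length; freezing the cells
  of all segment end points as well makes the connectors, and with them the length, common.\<close>

lemma bowen_covers_mono_set: "Z \<subseteq> Z' \<Longrightarrow> bowen_covers X f Z' \<epsilon> N \<subseteq> bowen_covers X f Z \<epsilon> N"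
  unfolding bowen_covers_def by blast

lemma bowen_covers_antimono: "N \<le> N' \<Longrightarrow> bowen_covers X f Z \<epsilon> N' \<subseteq> bowen_covers X f Z \<epsilon> N"
  unfolding bowen_covers_def using order_trans[of N N'] by blast

lemma bowen_ball_mono: "\<epsilon> \<le> \<epsilon>' \<Longrightarrow> bowen_ball X f x n \<epsilon> \<subseteq> bowen_ball X f x n \<epsilon>'"
  unfolding bowen_ball_def by fastforce

lemma bowen_covers_mono_radius: "\<epsilon> \<le> \<epsilon>' \<Longrightarrow> bowen_covers X f Z \<epsilon> N \<subseteq> bowen_covers X f Z \<epsilon>' N"
proof
  fix C assume "\<epsilon> \<le> \<epsilon>'" and C: "C \<in> bowen_covers X f Z \<epsilon> N"
  hence "(\<Union>(x,n)\<in>C. bowen_ball X f x n \<epsilon>) \<subseteq> (\<Union>(x,n)\<in>C. bowen_ball X f x n \<epsilon>')"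
    using bowen_ball_mono[of \<epsilon> \<epsilon>' X f] by (intro UN_mono) auto
  thus "C \<in> bowen_covers X f Z \<epsilon>' N" using C unfolding bowen_covers_def by auto
qed

lemma incseq_bowen_mN: "incseq (\<lambda>N. bowen_mN X f Z s N \<epsilon>)"
  unfolding bowen_mN_def incseq_def by (intro allI impI INF_superset_mono bowen_covers_antimono) auto

text \<open>Raising \<open>N\<close> leaves fewer admissible covers, so the sequence increases and
  the \<open>lim\<close> of the definition is a genuine limit.\<close>

lemma bowen_m_SUP: "bowen_m X f Z s \<epsilon> = (SUP N. bowen_mN X f Z s N \<epsilon>)"
  unfolding bowen_m_def by (intro limI LIMSEQ_SUP incseq_bowen_mN)

lemma bowen_m_eq_0_iff: "bowen_m X f Z s \<epsilon> = 0 \<longleftrightarrow> (\<forall>N. bowen_mN X f Z s N \<epsilon> = 0)"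
proof
  show "\<forall>N. bowen_mN X f Z s N \<epsilon> = 0 \<Longrightarrow> bowen_m X f Z s \<epsilon> = 0"
    unfolding bowen_m_SUP by simp
  assume "bowen_m X f Z s \<epsilon> = 0"
  thus "\<forall>N. bowen_mN X f Z s N \<epsilon> = 0"
    using SUP_upper[OF UNIV_I, of "\<lambda>N. bowen_mN X f Z s N \<epsilon>"] unfolding bowen_m_SUP by simp
qed

lemma bowen_mN_antimono_exponent: "s \<le> s' \<Longrightarrow> bowen_mN X f Z s' N \<epsilon> \<le> bowen_mN X f Z s N \<epsilon>"
  unfolding bowen_mN_def
  by (intro INF_mono' nn_integral_mono) (simp add: ennreal_leI mult_left_mono)

lemma bowen_h_eps_mono_set: "Z \<subseteq> Z' \<Longrightarrow> bowen_h_eps X f Z \<epsilon> \<le> bowen_h_eps X f Z' \<epsilon>"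
proof -
  assume a: "Z \<subseteq> Z'"
  have le: "bowen_mN X f Z s N \<epsilon> \<le> bowen_mN X f Z' s N \<epsilon>" for s N
    unfolding bowen_mN_def by (intro INF_superset_mono bowen_covers_mono_set a) auto
  hence "bowen_mN X f Z s N \<epsilon> = 0" if "bowen_mN X f Z' s N \<epsilon> = 0" for s N
    using le[of s N] that by simp
  thus ?thesis
    unfolding bowen_h_eps_def bowen_m_eq_0_iff by (intro Inf_superset_mono) auto
qed

lemma bowen_h_eps_antimono: "\<epsilon> \<le> \<epsilon>' \<Longrightarrow> bowen_h_eps X f Z \<epsilon>' \<le> bowen_h_eps X f Z \<epsilon>"
proof -
  assume a: "\<epsilon> \<le> \<epsilon>'"
  have le: "bowen_mN X f Z s N \<epsilon>' \<le> bowen_mN X f Z s N \<epsilon>" for s N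
    unfolding bowen_mN_def by (intro INF_superset_mono bowen_covers_mono_radius a) auto
  hence "bowen_mN X f Z s N \<epsilon>' = 0" if "bowen_mN X f Z s N \<epsilon> = 0" for s N
    using le[of s N] that by simp
  thus ?thesis
    unfolding bowen_h_eps_def bowen_m_eq_0_iff by (intro Inf_superset_mono) auto
qed

text \<open>Shrinking the radius removes covers, so \<open>bowen_h_eps\<close> grows as \<epsilon>
  decreases to 0 and the one-sided limit is a supremum. A lower bound then needs a single radius,
  and an upper bound may be proved for each radius separately.\<close>

lemma bowen_entropy_SUP: "bowen_entropy X f Z = (SUP \<epsilon>\<in>{0<..}. bowen_h_eps X f Z \<epsilon>)"
proof -
  let ?h = "bowen_h_eps X f Z"
  let ?S = "SUP \<epsilon>\<in>{0<..}. ?h \<epsilon>"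
  have "(?h \<longlongrightarrow> ?S) (at_right 0)"
  proof (rule order_tendstoI)
    fix a assume "a < ?S"
    then obtain e where e: "0 < e" "a < ?h e" by (auto simp: less_SUP_iff)
    have "eventually (\<lambda>x. x \<in> {0<..<e}) (at_right 0)"
      using eventually_at_right_less[of 0] e(1) by (auto simp: eventually_at_right)
    thus "eventually (\<lambda>x. a < ?h x) (at_right 0)"
    proof eventually_elim
      case (elim x)
      hence "?h e \<le> ?h x" by (intro bowen_h_eps_antimono) simp
      thus ?case using e(2) by (rule order_less_le_trans[rotated])
    qed
  next
    fix a assume "?S < a"
    have "eventually (\<lambda>x. x \<in> {0::real<..}) (at_right 0)"
      by (simp add: eventually_at_right_less)
    thus "eventually (\<lambda>x. ?h x < a) (at_right 0)"
    proof eventually_elim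
      case (elim x)
      hence "?h x \<le> ?S" by (intro SUP_upper)
      thus ?case using \<open>?S < a\<close> by (rule order_le_less_trans)
    qed
  qed
  thus ?thesis unfolding bowen_entropy_def by (intro tendsto_Lim) auto
qed

lemma bowen_entropy_mono: "Z \<subseteq> Z' \<Longrightarrow> bowen_entropy X f Z \<le> bowen_entropy X f Z'"
  unfolding bowen_entropy_SUP by (intro SUP_mono) (use bowen_h_eps_mono_set in blast)

text \<open>The weights \<open>exp (- n * s)\<close> decrease in \<open>s\<close>, so vanishing at a
  smaller exponent would force vanishing at \<open>s\<close>; every exponent in the infimum is
  therefore at least \<open>s\<close>.\<close>

lemma bowen_h_eps_ge:
  assumes "bowen_m X f Z s \<epsilon> \<noteq> 0"
  shows "ereal s \<le> bowen_h_eps X f Z \<epsilon>"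
  unfolding bowen_h_eps_def
proof (rule Inf_greatest)
  fix y assume "y \<in> {ereal s |s. bowen_m X f Z s \<epsilon> = 0}"
  then obtain s' where s': "y = ereal s'" "\<And>N. bowen_mN X f Z s' N \<epsilon> = 0" 
    by (auto simp: bowen_m_eq_0_iff)
  have "s \<le> s'"
  proof (rule ccontr)
    assume "\<not> s \<le> s'"
    hence "bowen_mN X f Z s N \<epsilon> \<le> bowen_mN X f Z s' N \<epsilon>" for N by (intro bowen_mN_antimono_exponent) simp
    hence "\<forall>N. bowen_mN X f Z s N \<epsilon> = 0" using s'(2) by simp
    thus False using assms unfolding bowen_m_eq_0_iff by blast
  qed
  thus "ereal s \<le> y" using s' by simp
qed

lemma bowen_h_eps_le:
  assumes "\<And>s. t < s \<Longrightarrow> bowen_m X f Z s \<epsilon> = 0"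
  shows "bowen_h_eps X f Z \<epsilon> \<le> ereal t"
proof (rule ereal_le_epsilon2)
  fix e :: real assume "0 < e"
  hence "bowen_m X f Z (t + e) \<epsilon> = 0" using assms by simp
  thus "bowen_h_eps X f Z \<epsilon> \<le> ereal t + ereal e"
    unfolding bowen_h_eps_def by (intro Inf_lower) auto
qed

lemma bowen_mN_le:
  "C \<in> bowen_covers X f Z \<epsilon> N \<Longrightarrow>
    bowen_mN X f Z s N \<epsilon> \<le> (\<integral>\<^sup>+ p. ennreal (exp (- real (snd p) * s)) \<partial>count_space C)"
  unfolding bowen_mN_def by (rule INF_lower)

lemma nn_integral_count_space_UN_le:
  fixes C :: "nat \<Rightarrow> 'b set"
  shows "(\<integral>\<^sup>+ p. g p \<partial>count_space (\<Union>i. C i)) \<le> (\<Sum>i. \<integral>\<^sup>+ p. g p \<partial>count_space (C i))"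
proof -
  have "(\<integral>\<^sup>+ p. g p \<partial>count_space (\<Union>i. C i)) = (\<integral>\<^sup>+ p. g p * indicator (\<Union>i. C i) p \<partial>count_space UNIV)"
    by (simp add: nn_integral_count_space_indicator)
  also have "\<dots> \<le> (\<integral>\<^sup>+ p. (\<Sum>i. g p * indicator (C i) p) \<partial>count_space UNIV)"
  proof (intro nn_integral_mono)
    fix p
    show "g p * indicator (\<Union>i. C i) p \<le> (\<Sum>i. g p * indicator (C i) p)"
    proof (cases "p \<in> (\<Union>i. C i)")
      case True
      then obtain i where i: "p \<in> C i" by auto
      have "g p = (\<Sum>i\<in>{i}. g p * indicator (C i) p)" using i by simp
      also have "\<dots> \<le> (\<Sum>i. g p * indicator (C i) p)" by (rule sum_le_suminf) auto
      finally show ?thesis using True by simp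
    qed simp
  qed
  also have "\<dots> = (\<Sum>i. \<integral>\<^sup>+ p. g p * indicator (C i) p \<partial>count_space UNIV)"
    by (intro nn_integral_suminf) auto
  finally show ?thesis by (simp add: nn_integral_count_space_indicator)
qed

text \<open>Countable subadditivity as for any outer measure: the \<open>i\<close>-th set gets a
  cover exceeding its infimum by at most \<open>e * (1/2)^Suc i\<close>, and these excesses add up
  to \<open>e\<close>.\<close>

lemma bowen_mN_UN_le:
  fixes Z :: "nat \<Rightarrow> 'a::metric_space set"
  shows "bowen_mN X f (\<Union>i. Z i) s N \<epsilon> \<le> (\<Sum>i. bowen_mN X f (Z i) s N \<epsilon>)"
proof (rule ennreal_le_epsilon)
  fix e :: real assume fin: "(\<Sum>i. bowen_mN X f (Z i) s N \<epsilon>) < \<top>" and e: "0 < e"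
  let ?w = "\<lambda>p. ennreal (exp (- real (snd p) * s))"
  have "\<exists>C. C \<in> bowen_covers X f (Z i) \<epsilon> N \<and>
      (\<integral>\<^sup>+ p. ?w p \<partial>count_space C) \<le> bowen_mN X f (Z i) s N \<epsilon> + ennreal (e * (1/2)^Suc i)" for i
  proof -
    have "bowen_mN X f (Z i) s N \<epsilon> < \<top>"
      using ennreal_suminf_lessD[OF fin] .
    moreover have "0 < ennreal (e * (1/2)^Suc i)" using e by (intro ennreal_less_zero_iff[THEN iffD2]) simp
    ultimately have "bowen_mN X f (Z i) s N \<epsilon> + 0 < bowen_mN X f (Z i) s N \<epsilon> + ennreal (e * (1/2)^Suc i)"
      by (subst ennreal_add_left_cancel_less) (simp del: power_Suc)
    hence "bowen_mN X f (Z i) s N \<epsilon> < bowen_mN X f (Z i) s N \<epsilon> + ennreal (e * (1/2)^Suc i)"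
      by (simp del: power_Suc)
    thus ?thesis unfolding bowen_mN_def[of X f "Z i"] INF_less_iff using less_imp_le by blast
  qed
  then obtain C where C: "\<And>i. C i \<in> bowen_covers X f (Z i) \<epsilon> N"
     "\<And>i. (\<integral>\<^sup>+ p. ?w p \<partial>count_space (C i)) \<le> bowen_mN X f (Z i) s N \<epsilon> + ennreal (e * (1/2)^Suc i)"
    using choice[of "\<lambda>i C. C \<in> bowen_covers X f (Z i) \<epsilon> N \<and>
      (\<integral>\<^sup>+ p. ?w p \<partial>count_space C) \<le> bowen_mN X f (Z i) s N \<epsilon> + ennreal (e * (1/2)^Suc i)"] by blast
  have "(\<Union>i. C i) \<in> bowen_covers X f (\<Union>i. Z i) \<epsilon> N"
    unfolding bowen_covers_def
  proof (intro CollectI conjI subsetI)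
    show "countable (\<Union>i. C i)" using C(1) by (auto simp: bowen_covers_def)
    show "\<forall>(x, n)\<in>(\<Union>i. C i). x \<in> X \<and> N \<le> n" using C(1) unfolding bowen_covers_def by blast
    fix z assume "z \<in> (\<Union>i. Z i)"
    then obtain i where "z \<in> Z i" by blast
    hence "z \<in> (\<Union>(x,n)\<in>C i. bowen_ball X f x n \<epsilon>)" using C(1)[of i] unfolding bowen_covers_def by blast
    thus "z \<in> (\<Union>(x,n)\<in>(\<Union>i. C i). bowen_ball X f x n \<epsilon>)" by blast
  qed
  hence "bowen_mN X f (\<Union>i. Z i) s N \<epsilon> \<le> (\<integral>\<^sup>+ p. ?w p \<partial>count_space (\<Union>i. C i))"
    by (rule bowen_mN_le)
  also have "\<dots> \<le> (\<Sum>i. \<integral>\<^sup>+ p. ?w p \<partial>count_space (C i))" by (rule nn_integral_count_space_UN_le)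
  also have "\<dots> \<le> (\<Sum>i. bowen_mN X f (Z i) s N \<epsilon> + ennreal (e * (1/2)^Suc i))"
    by (intro suminf_le C(2)) auto
  also have "\<dots> = (\<Sum>i. bowen_mN X f (Z i) s N \<epsilon>) + (\<Sum>i. ennreal (e * (1/2)^Suc i))"
    by (intro suminf_add[symmetric]) auto
  also have "(\<Sum>i. ennreal (e * (1/2)^Suc i)) = ennreal e"
  proof -
    have "(\<lambda>i. e * (1/2)^Suc i) sums (e * 1)" by (intro sums_mult power_half_series)
    thus ?thesis using e by (subst suminf_ennreal_eq) (auto simp del: power_Suc)
  qed
  finally show "bowen_mN X f (\<Union>i. Z i) s N \<epsilon> \<le> (\<Sum>i. bowen_mN X f (Z i) s N \<epsilon>) + ennreal e" .
qed

text \<open>Null sets for a fixed exponent and radius are closed under countable unions; the upper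
  bound applies this to the countable set of codes.\<close>

lemma bowen_m_countable_UN_eq_0:
  fixes Z :: "'i \<Rightarrow> 'a::metric_space set"
  assumes "countable I" "\<And>i. i \<in> I \<Longrightarrow> bowen_m X f (Z i) s \<epsilon> = 0"
  shows "bowen_m X f (\<Union>i\<in>I. Z i) s \<epsilon> = 0"
proof (cases "I = {}")
  case True
  have "{} \<in> bowen_covers X f {} \<epsilon> N" for N by (auto simp: bowen_covers_def)
  from bowen_mN_le[OF this] show ?thesis unfolding bowen_m_eq_0_iff True
    by (simp add: nn_integral_count_space_finite)
next
  case False
  then obtain g :: "nat \<Rightarrow> 'i" where g: "I = range g" 
    using assms(1) by (metis range_from_nat_into)
  have "bowen_mN X f (\<Union>n. Z (g n)) s N \<epsilon> \<le> (\<Sum>n. bowen_mN X f (Z (g n)) s N \<epsilon>)" for N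
    by (rule bowen_mN_UN_le)
  moreover have "bowen_mN X f (Z (g n)) s N \<epsilon> = 0" for n N
    using assms(2)[of "g n"] g unfolding bowen_m_eq_0_iff by blast
  ultimately have "bowen_mN X f (\<Union>n. Z (g n)) s N \<epsilon> = 0" for N by simp
  thus ?thesis unfolding g bowen_m_eq_0_iff by (simp add: image_image)
qed

section \<open>Invariant and empirical measures\<close>

lemma space_borelX [simp]: "space (borelX X) = X"
  by (simp add: borelX_def space_restrict_space)

lemma probs_iff: "\<mu> \<in> probs X \<longleftrightarrow> sets \<mu> = sets (borelX X) \<and> prob_space \<mu>"
  by (simp add: probs_def)

lemma space_probs: "\<mu> \<in> probs X \<Longrightarrow> space \<mu> = X"
  unfolding probs_iff using sets_eq_imp_space_eq[of \<mu> "borelX X"] by simp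

lemma sets_borelX_closed: "closedin (top_of_set X) K \<Longrightarrow> K \<in> sets (borelX X)"
proof -
  assume "closedin (top_of_set X) K"
  then obtain T where "closed T" "K = X \<inter> T" unfolding closedin_closed by blast
  thus ?thesis unfolding borelX_def sets_restrict_space by (intro image_eqI[of _ _ T]) auto
qed

lemma sets_borelX_open: "openin (top_of_set X) K \<Longrightarrow> K \<in> sets (borelX X)"
proof -
  assume "openin (top_of_set X) K"
  then obtain T where "open T" "K = X \<inter> T" unfolding openin_open by blast
  thus ?thesis unfolding borelX_def sets_restrict_space by (intro image_eqI[of _ _ T]) auto
qed

lemma borelX_measurable_continuous:
  "continuous_on X g \<Longrightarrow> (g :: _ \<Rightarrow> 'b::topological_space) \<in> borel_measurable (borelX X)"
  unfolding borelX_def by (rule borel_measurable_continuous_on_restrict)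

lemma probs_measurable_continuous:
  "\<mu> \<in> probs X \<Longrightarrow> continuous_on X g \<Longrightarrow> (g :: _ \<Rightarrow> 'b::topological_space) \<in> borel_measurable \<mu>"
  using borelX_measurable_continuous[of X g] measurable_cong_sets[of \<mu> "borelX X" borel borel]
  unfolding probs_iff by blast

lemma compact_continuous_bounded:
  fixes g :: "'a::metric_space \<Rightarrow> real"
  assumes "compact X" "continuous_on X g"
  obtains B where "B > 0" "\<And>x. x \<in> X \<Longrightarrow> \<bar>g x\<bar> \<le> B"
proof -
  have "bounded (g ` X)" by (intro compact_imp_bounded compact_continuous_image assms)
  then obtain B where "B > 0" "\<forall>y\<in>g ` X. norm y \<le> B" unfolding bounded_pos by blast
  thus ?thesis using that by auto
qed

lemma probs_integrable_bounded:
  fixes g :: "'a::metric_space \<Rightarrow> real"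
  assumes "\<mu> \<in> probs X" "g \<in> borel_measurable (borelX X)" "\<And>x. x \<in> X \<Longrightarrow> \<bar>g x\<bar> \<le> B"
  shows "integrable \<mu> g"
proof -
  interpret prob_space \<mu> using assms(1) by (simp add: probs_iff)
  have "g \<in> borel_measurable \<mu>"
    using assms(1,2) measurable_cong_sets[of \<mu> "borelX X" borel borel] unfolding probs_iff by blast
  thus ?thesis using assms(3) space_probs[OF assms(1)]
    by (intro integrable_const_bound[of _ B]) auto
qed

lemma probs_integrable:
  fixes g :: "'a::metric_space \<Rightarrow> real"
  assumes "compact X" "\<mu> \<in> probs X" "continuous_on X g"
  shows "integrable \<mu> g"
proof -
  obtain B where "\<And>x. x \<in> X \<Longrightarrow> \<bar>g x\<bar> \<le> B" using compact_continuous_bounded[OF assms(1,3)] by blast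
  thus ?thesis using probs_integrable_bounded[OF assms(2) borelX_measurable_continuous[OF assms(3)]] by blast
qed

lemma topspace_weak_star [simp]: "topspace (weak_star X) = probs X"
proof -
  have "probs X = {\<mu> \<in> probs X. (integral\<^sup>L \<mu> (\<lambda>x. 0)) \<in> (UNIV::real set)}" by auto
  moreover have "\<dots> \<in> {{\<mu> \<in> probs X. (integral\<^sup>L \<mu> g) \<in> W} | g W. continuous_on X g \<and> open (W :: real set)}"
    by (intro CollectI exI[of _ "\<lambda>x. 0"] exI[of _ "UNIV"]) auto
  ultimately show ?thesis unfolding weak_star_def topology_generated_by_topspace by blast
qed

lemma openin_weak_star_integral:
  assumes "continuous_on X g" "open (W::real set)"
  shows "openin (weak_star X) {\<mu> \<in> probs X. (integral\<^sup>L \<mu> g) \<in> W}"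
  unfolding weak_star_def using assms by (intro topology_generated_by_Basis) blast

text \<open>The topology is generated by a subbasis, so finitely many test functions with one common
  tolerance have to be extracted by induction on the generation of \<open>S\<close>. Membership of
  \<nu> stays a premise inside the induction, since the members of a union need not all contain
  \<nu>.\<close>

lemma weak_star_nbhd:
  assumes "openin (weak_star X) S" "\<nu> \<in> S"
  obtains G \<eta> where "finite G" "\<And>g. g \<in> G \<Longrightarrow> continuous_on X g" "\<eta> > (0::real)"
    "\<And>\<mu>. \<mu> \<in> probs X \<Longrightarrow> (\<And>g. g \<in> G \<Longrightarrow> \<bar>integral\<^sup>L \<mu> g - integral\<^sup>L \<nu> g\<bar> < \<eta>) \<Longrightarrow> \<mu> \<in> S"
proof -
  let ?P = "\<lambda>S. \<exists>G \<eta>. finite G \<and> (\<forall>g\<in>G. continuous_on X g) \<and> \<eta> > (0::real) \<and>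
    (\<forall>\<mu>\<in>probs X. (\<forall>g\<in>G. \<bar>integral\<^sup>L \<mu> g - integral\<^sup>L \<nu> g\<bar> < \<eta>) \<longrightarrow> \<mu> \<in> S)"
  have "generate_topology_on {{\<mu> \<in> probs X. (integral\<^sup>L \<mu> g) \<in> W} | g W. continuous_on X g \<and> open (W :: real set)} S"
    using assms(1) unfolding weak_star_def openin_topology_generated_by_iff .
  hence "\<nu> \<in> S \<longrightarrow> ?P S"
  proof induction
    case Empty
    then show ?case by simp
  next
    case (Int a b)
    show ?case
    proof
      assume "\<nu> \<in> a \<inter> b"
      hence Pa: "?P a" and Pb: "?P b" using Int.IH by (blast, blast)
      from Pa obtain G1 e1 where
        1: "finite G1" "\<forall>g\<in>G1. continuous_on X g" "e1 > (0::real)"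
          "\<forall>\<mu>\<in>probs X. (\<forall>g\<in>G1. \<bar>integral\<^sup>L \<mu> g - integral\<^sup>L \<nu> g\<bar> < e1) \<longrightarrow> \<mu> \<in> a" by blast
      from Pb obtain G2 e2 where
        2: "finite G2" "\<forall>g\<in>G2. continuous_on X g" "e2 > (0::real)"
          "\<forall>\<mu>\<in>probs X. (\<forall>g\<in>G2. \<bar>integral\<^sup>L \<mu> g - integral\<^sup>L \<nu> g\<bar> < e2) \<longrightarrow> \<mu> \<in> b" by blast
      show "?P (a \<inter> b)"
      proof (intro exI conjI)
        show "finite (G1 \<union> G2)" "\<forall>g\<in>G1 \<union> G2. continuous_on X g" "min e1 e2 > 0" using 1 2 by auto
        show "\<forall>\<mu>\<in>probs X. (\<forall>g\<in>G1 \<union> G2. \<bar>integral\<^sup>L \<mu> g - integral\<^sup>L \<nu> g\<bar> < min e1 e2) \<longrightarrow> \<mu> \<in> a \<inter> b"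
          using 1(4) 2(4) by simp
      qed
    qed
  next
    case (UN K)
    show ?case
    proof
      assume "\<nu> \<in> \<Union> K"
      then obtain k where k: "k \<in> K" "\<nu> \<in> k" by blast
      have "?P k" using UN.IH[OF k(1)] k(2) by (rule mp)
      then obtain G e where
        G: "finite G" "\<forall>g\<in>G. continuous_on X g" "e > (0::real)"
          "\<forall>\<mu>\<in>probs X. (\<forall>g\<in>G. \<bar>integral\<^sup>L \<mu> g - integral\<^sup>L \<nu> g\<bar> < e) \<longrightarrow> \<mu> \<in> k" by blast
      show "?P (\<Union> K)"
        by (intro exI conjI, rule G(1), rule G(2), rule G(3)) (use G(4) k(1) in blast)
    qed
  next
    case (Basis s)
    show ?case
    proof
      assume "\<nu> \<in> s"
      from Basis obtain g W where s: "s = {\<mu> \<in> probs X. (integral\<^sup>L \<mu> g) \<in> W}" "continuous_on X g" "open (W::real set)"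
        by blast
      hence "integral\<^sup>L \<nu> g \<in> W" using \<open>\<nu> \<in> s\<close> by blast
      then obtain e where e: "e > 0" "\<forall>y. dist y (integral\<^sup>L \<nu> g) < e \<longrightarrow> y \<in> W"
        using s(3) unfolding open_dist by blast
      show "?P s"
      proof (intro exI conjI)
        show "finite {g}" "\<forall>g\<in>{g}. continuous_on X g" "e > 0" using e s by auto
        show "\<forall>\<mu>\<in>probs X. (\<forall>g\<in>{g}. \<bar>integral\<^sup>L \<mu> g - integral\<^sup>L \<nu> g\<bar> < e) \<longrightarrow> \<mu> \<in> s"
          unfolding s(1) using e(2) by (simp add: dist_real_def)
      qed
    qed
  qed
  then obtain G e where
    G: "finite G" "\<forall>g\<in>G. continuous_on X g" "e > (0::real)"
      "\<forall>\<mu>\<in>probs X. (\<forall>g\<in>G. \<bar>integral\<^sup>L \<mu> g - integral\<^sup>L \<nu> g\<bar> < e) \<longrightarrow> \<mu> \<in> S" using assms(2) by blast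
  show ?thesis by (rule that[of G e]) (use G in simp_all)
qed

text \<open>The functions \<open>max 0 (1 - m * infdist x K)\<close> decrease to the indicator of the closed set \<open>K\<close>.\<close>

lemma measure_closed_eq:
  fixes \<mu> \<nu> :: "'a::metric_space measure"
  assumes "compact X" "\<mu> \<in> probs X" "\<nu> \<in> probs X" "closedin (top_of_set X) K" "K \<noteq> {}"
    and eq: "\<And>g :: 'a \<Rightarrow> real. continuous_on X g \<Longrightarrow> integral\<^sup>L \<mu> g = integral\<^sup>L \<nu> g"
  shows "measure \<mu> K = measure \<nu> K"
proof -
  define g where "g m x = max 0 (1 - real m * infdist x K)" for m :: nat and x
  have clK: "closed K"
    using assms(1,4) by (metis closedin_closed_eq compact_imp_closed)
  have cont: "continuous_on X (g m)" for m
    unfolding g_def by (intro continuous_intros)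
  have lim: "(\<lambda>m. g m x) \<longlonglongrightarrow> indicator K x" for x
  proof (cases "x \<in> K")
    case True
    thus ?thesis by (simp add: g_def)
  next
    case False
    hence pos: "infdist x K > 0" using clK assms(5) by (simp add: infdist_pos_not_in_closed)
    obtain M where M: "real M * infdist x K \<ge> 1"
      using ex_less_of_nat_mult[OF pos] less_imp_le by blast
    have "g m x = 0" if "m \<ge> M" for m
    proof -
      have "real M * infdist x K \<le> real m * infdist x K"
        using that pos by (intro mult_right_mono) auto
      thus ?thesis using M by (simp add: g_def)
    qed
    hence "eventually (\<lambda>m. g m x = 0) sequentially" by (auto simp: eventually_sequentially)
    thus ?thesis using False by (simp add: tendsto_eventually)
  qed
  have "(\<lambda>m. integral\<^sup>L \<rho> (g m)) \<longlonglongrightarrow> measure \<rho> K" if \<rho>: "\<rho> \<in> probs X" for \<rho>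
  proof -
    interpret prob_space \<rho> using \<rho> by (simp add: probs_iff)
    have K: "K \<in> sets \<rho>" using \<rho> sets_borelX_closed[OF assms(4)] by (simp add: probs_iff)
    have "(\<lambda>m. integral\<^sup>L \<rho> (g m)) \<longlonglongrightarrow> integral\<^sup>L \<rho> (indicator K)"
    proof (rule integral_dominated_convergence[where w = "\<lambda>_. 1"])
      show "AE x in \<rho>. (\<lambda>i. g i x) \<longlonglongrightarrow> indicator K x" using lim by simp
      show "AE x in \<rho>. norm (g i x) \<le> 1" for i
        by (intro AE_I2) (auto simp: g_def infdist_nonneg)
      show "g i \<in> borel_measurable \<rho>" for i
        by (rule probs_measurable_continuous[OF \<rho> cont])
    qed (use K in auto)
    also have "integral\<^sup>L \<rho> (indicator K) = measure \<rho> K"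
      using K by (simp add: Int_absorb2 sets.sets_into_space)
    finally show ?thesis .
  qed
  from LIMSEQ_unique[OF this[OF assms(2)]] this[OF assms(3)] eq[OF cont] show ?thesis by simp
qed

lemma sets_borelX_closed_generated:
  assumes "closed X"
  shows "sets (borelX X) = sigma_sets X {K. closedin (top_of_set X) K}"
proof -
  have "sets (borelX X) = (\<inter>) X ` sigma_sets UNIV (Collect closed)"
    unfolding borelX_def sets_restrict_space borel_eq_closed by simp
  also have "\<dots> = sigma_sets X ((\<inter>) X ` Collect closed)"
    using assms by (intro sigma_sets_Int) auto
  also have "(\<inter>) X ` Collect closed = {K. closedin (top_of_set X) K}"
    unfolding closedin_closed by blast
  finally show ?thesis .
qed

text \<open>The relatively closed sets are an intersection-stable generator, and by
  \<open>measure_closed_eq\<close> integrals of continuous functions determine the measure on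
  them.\<close>

lemma probs_eqI:
  fixes \<mu> \<nu> :: "'a::metric_space measure"
  assumes "compact X" "\<mu> \<in> probs X" "\<nu> \<in> probs X"
    and eq: "\<And>g :: 'a \<Rightarrow> real. continuous_on X g \<Longrightarrow> integral\<^sup>L \<mu> g = integral\<^sup>L \<nu> g"
  shows "\<mu> = \<nu>"
proof (rule measure_eqI_generator_eq[where E = "{K. closedin (top_of_set X) K}" and A = "\<lambda>_. X" and \<Omega> = X])
  interpret M: prob_space \<mu> using assms(2) by (simp add: probs_iff)
  interpret N: prob_space \<nu> using assms(3) by (simp add: probs_iff)
  show "Int_stable {K. closedin (top_of_set X) K}" by (auto simp: Int_stable_def)
  show "{K. closedin (top_of_set X) K} \<subseteq> Pow X" using closedin_imp_subset by blast
  show "sets \<mu> = sigma_sets X {K. closedin (top_of_set X) K}" "sets \<nu> = sigma_sets X {K. closedin (top_of_set X) K}"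
    using assms(2,3) sets_borelX_closed_generated[OF compact_imp_closed[OF assms(1)]] by (simp_all add: probs_iff)
  show "range (\<lambda>_. X) \<subseteq> {K. closedin (top_of_set X) K}" by simp
  show "emeasure \<mu> K = emeasure \<nu> K" if "K \<in> {K. closedin (top_of_set X) K}" for K
    using measure_closed_eq[OF assms(1-3) _ _ eq] that
    by (cases "K = {}") (auto simp: M.emeasure_eq_measure N.emeasure_eq_measure)
  show "emeasure \<mu> X \<noteq> \<infinity>" by simp
qed simp

section \<open>Empirical measures, time averages and their limit points\<close>

locale compact_system =
  fixes X :: "'a::metric_space set" and f :: "'a \<Rightarrow> 'a"
  assumes compact_X: "compact X" and continuous_f: "continuous_on X f" and f_in: "\<And>x. x \<in> X \<Longrightarrow> f x \<in> X"
begin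

lemma funpow_in: "x \<in> X \<Longrightarrow> (f ^^ i) x \<in> X"
  by (induction i) (auto simp: f_in)

lemma continuous_funpow: "continuous_on X (f ^^ i)"
proof (induction i)
  case (Suc i)
  have "continuous_on X (f \<circ> (f ^^ i))"
    by (intro continuous_on_compose Suc continuous_on_subset[OF continuous_f]) (auto simp: funpow_in)
  thus ?case by simp
qed simp

lemma continuous_comp_funpow:
  assumes "continuous_on X g"
  shows "continuous_on X (\<lambda>x. g ((f ^^ i) x))"
  by (rule continuous_on_compose2[OF assms continuous_funpow]) (auto simp: funpow_in)

lemma measurable_funpow [measurable]: "(f ^^ i) \<in> borelX X \<rightarrow>\<^sub>M borelX X"
proof -
  have "(f ^^ i) \<in> borelX X \<rightarrow>\<^sub>M borel" by (intro borelX_measurable_continuous continuous_funpow)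
  thus ?thesis unfolding borelX_def
    by (intro measurable_restrict_space2) (auto simp: space_restrict_space funpow_in)
qed

lemma measurable_f [measurable]: "f \<in> borelX X \<rightarrow>\<^sub>M borelX X"
  using measurable_funpow[of 1] by simp

text \<open>\<open>measure_of\<close> gives the intended values only if the counting function is
  countably additive; the push-forward of the uniform measure on the times \<open>{..<n}\<close>
  shows this and turns integrals into time averages. For \<open>n = 0\<close> the formula
  degenerates to the zero measure.\<close>

lemma empirical_eq:
  assumes "x \<in> X" "n > 0"
  shows "empirical X f n x = distr (uniform_count_measure {..<n}) (borelX X) (\<lambda>i. (f ^^ i) x)"
proof -
  let ?D = "distr (uniform_count_measure {..<n}) (borelX X) (\<lambda>i. (f ^^ i) x)"
  have m: "(\<lambda>i. (f ^^ i) x) \<in> uniform_count_measure {..<n} \<rightarrow>\<^sub>M borelX X"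
    by (auto simp: measurable_def space_uniform_count_measure sets_uniform_count_measure funpow_in assms)
  have "measure_of X (sets (borelX X)) (\<lambda>A. ennreal (real (card {i. i < n \<and> (f ^^ i) x \<in> A}) / real n))
      = measure_of X (sets (borelX X)) (emeasure ?D)"
  proof (rule measure_of_eq)
    show "sets (borelX X) \<subseteq> Pow X" using sets.space_closed[of "borelX X"] by simp
    fix a assume "a \<in> sigma_sets X (sets (borelX X))"
    hence a: "a \<in> sets (borelX X)" using sets.sigma_sets_eq[of "borelX X"] by simp
    have "emeasure ?D a = emeasure (uniform_count_measure {..<n})
        ((\<lambda>i. (f ^^ i) x) -` a \<inter> space (uniform_count_measure {..<n}))"
      using a m by (rule emeasure_distr[rotated])
    also have "(\<lambda>i. (f ^^ i) x) -` a \<inter> space (uniform_count_measure {..<n}) = {i. i < n \<and> (f ^^ i) x \<in> a}"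
      unfolding space_uniform_count_measure by auto
    also have "emeasure (uniform_count_measure {..<n}) \<dots> = ennreal (real (card {i. i < n \<and> (f ^^ i) x \<in> a}) / real n)"
      by (subst emeasure_uniform_count_measure) auto
    finally show "ennreal (real (card {i. i < n \<and> (f ^^ i) x \<in> a}) / real n) = emeasure ?D a" ..
  qed
  also have "\<dots> = ?D" using measure_of_of_measure[of ?D] by simp
  finally show ?thesis unfolding empirical_def .
qed

lemma empirical_in_probs:
  assumes "x \<in> X" "n > 0"
  shows "empirical X f n x \<in> probs X"
proof -
  have m: "(\<lambda>i. (f ^^ i) x) \<in> uniform_count_measure {..<n} \<rightarrow>\<^sub>M borelX X"
    by (auto simp: measurable_def space_uniform_count_measure sets_uniform_count_measure funpow_in assms)
  interpret prob_space "uniform_count_measure {..<n}"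
    using assms(2) by (intro prob_space_uniform_count_measure) auto
  show ?thesis using prob_space_distr[OF m] unfolding empirical_eq[OF assms] probs_iff by simp
qed

lemma integral_empirical:
  fixes g :: "'a \<Rightarrow> real"
  assumes "x \<in> X" "n > 0" "g \<in> borel_measurable (borelX X)"
  shows "integral\<^sup>L (empirical X f n x) g = (\<Sum>i<n. g ((f ^^ i) x)) / n"
proof -
  have m: "(\<lambda>i. (f ^^ i) x) \<in> uniform_count_measure {..<n} \<rightarrow>\<^sub>M borelX X"
    by (auto simp: measurable_def space_uniform_count_measure sets_uniform_count_measure funpow_in assms)
  have "integral\<^sup>L (empirical X f n x) g = (\<integral>i. g ((f ^^ i) x) \<partial>uniform_count_measure {..<n})"
    unfolding empirical_eq[OF assms(1,2)] by (rule integral_distr[OF m assms(3)])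
  also have "\<dots> = (\<Sum>i<n. g ((f ^^ i) x)) / n" by (subst integral_uniform_count_measure) auto
  finally show ?thesis .
qed

lemma Vx_approx:
  fixes \<eta> :: real and G :: "('a \<Rightarrow> real) set"
  assumes "\<nu> \<in> Vx X f x" "x \<in> X" "finite G" "\<And>g. g \<in> G \<Longrightarrow> continuous_on X g" "\<eta> > 0"
  obtains n where "n \<ge> N" "n > 0" "\<And>g. g \<in> G \<Longrightarrow> \<bar>(\<Sum>i<n. g ((f ^^ i) x)) / n - integral\<^sup>L \<nu> g\<bar> < \<eta>"
proof -
  have \<nu>: "\<nu> \<in> probs X" using assms(1) unfolding Vx_def by blast
  let ?B = "\<lambda>g. {\<mu> \<in> probs X. integral\<^sup>L \<mu> g \<in> ball (integral\<^sup>L \<nu> g) \<eta>}"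
  define S where "S = topspace (weak_star X) \<inter> \<Inter> (?B ` G)"
  have "openin (weak_star X) S"
    unfolding S_def
  proof (rule openin_Int_Inter)
    show "finite (?B ` G)" using assms(3) by simp
    fix T assume "T \<in> ?B ` G"
    then obtain g where "g \<in> G" "T = ?B g" by blast
    thus "openin (weak_star X) T" using openin_weak_star_integral[OF assms(4) open_ball] by simp
  qed (rule openin_topspace)
  moreover have "\<nu> \<in> S" using \<nu> assms(5) by (auto simp: S_def)
  ultimately have "\<forall>N. \<exists>n\<ge>N. empirical X f n x \<in> S" using assms(1) unfolding Vx_def by blast
  \<comment> \<open>Asking for \<open>Suc N\<close> instead of \<open>N\<close> keeps
    \<open>n\<close> positive, so that the empirical measure is a probability.\<close>
  then obtain n where n: "n \<ge> Suc N" "empirical X f n x \<in> S" by blast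
  show ?thesis
  proof (rule that)
    show "n \<ge> N" "n > 0" using n by auto
    fix g assume g: "g \<in> G"
    hence "dist (integral\<^sup>L \<nu> g) (integral\<^sup>L (empirical X f n x) g) < \<eta>" using n(2) by (auto simp: S_def)
    also have "integral\<^sup>L (empirical X f n x) g = (\<Sum>i<n. g ((f ^^ i) x)) / n"
      using n assms(2) assms(4)[OF g] by (intro integral_empirical borelX_measurable_continuous) auto
    finally show "\<bar>(\<Sum>i<n. g ((f ^^ i) x)) / n - integral\<^sup>L \<nu> g\<bar> < \<eta>" by (simp add: dist_real_def abs_minus_commute)
  qed
qed

text \<open>Some \<open>n \<ge> N\<close> brings the time average within any \<open>e\<close> of the
  integral, and at this \<open>n\<close> the eventual bound already holds. This is how estimates
  along an orbit reach all its limit points at once.\<close>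

lemma Vx_average_bound:
  fixes g :: "'a \<Rightarrow> real"
  assumes "\<nu> \<in> Vx X f x" "x \<in> X" "continuous_on X g"
    and "\<And>n. n \<ge> N \<Longrightarrow> \<bar>(\<Sum>i<n. g ((f ^^ i) x)) / n - c\<bar> \<le> b"
  shows "\<bar>integral\<^sup>L \<nu> g - c\<bar> \<le> b"
proof (rule field_le_epsilon)
  fix e :: real assume "e > 0"
  obtain n where "n \<ge> N" "\<And>h. h \<in> {g} \<Longrightarrow> \<bar>(\<Sum>i<n. h ((f ^^ i) x)) / n - integral\<^sup>L \<nu> h\<bar> < e"
    by (rule Vx_approx[OF assms(1,2) _ _ \<open>e > 0\<close>, of "{g}" N]) (use assms(3) in auto)
  from this(1) this(2)[of g] show "\<bar>integral\<^sup>L \<nu> g - c\<bar> \<le> b + e" using assms(4)[of n] by auto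
qed

lemma integral_invariant:
  fixes g :: "'a \<Rightarrow> real"
  assumes "\<nu> \<in> Minv X f" "g \<in> borel_measurable (borelX X)"
  shows "integral\<^sup>L \<nu> (\<lambda>x. g ((f ^^ i) x)) = integral\<^sup>L \<nu> g"
proof -
  have \<nu>: "\<nu> \<in> probs X" and inv: "\<forall>A \<in> sets \<nu>. measure \<nu> (f -` A \<inter> X) = measure \<nu> A"
    using assms(1) by (auto simp: Minv_def)
  interpret prob_space \<nu> using \<nu> by (simp add: probs_iff)
  have s: "sets \<nu> = sets (borelX X)" using \<nu> by (simp add: probs_iff)
  have f: "f \<in> \<nu> \<rightarrow>\<^sub>M borelX X" using measurable_f measurable_cong_sets[OF s refl] by blast
  have "distr \<nu> (borelX X) f = \<nu>"
  proof (rule measure_eqI)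
    fix A assume "A \<in> sets (distr \<nu> (borelX X) f)"
    hence "A \<in> sets \<nu>" using s by simp
    thus "emeasure (distr \<nu> (borelX X) f) A = emeasure \<nu> A"
      using inv f s by (subst emeasure_distr) (auto simp: emeasure_eq_measure space_probs[OF \<nu>])
  qed (simp add: s)
  hence step: "integral\<^sup>L \<nu> (\<lambda>x. h (f x)) = integral\<^sup>L \<nu> h" if "h \<in> borel_measurable (borelX X)" for h :: "'a \<Rightarrow> real"
    using integral_distr[OF f that] by simp
  show ?thesis
  proof (induction i)
    case (Suc i)
    have "(\<lambda>x. g ((f ^^ i) x)) \<in> borel_measurable (borelX X)" using assms(2) by measurable
    from step[OF this] Suc show ?case by (simp add: funpow_swap1)
  qed simp
qed

text \<open>The Krylov-Bogolyubov argument: the sum of \<open>g \<circ> f - g\<close> along an orbit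
  telescopes to a quantity bounded by \<open>2 * B\<close>, so its averages vanish in the limit, and
  continuous functions determine the measure.\<close>

lemma Vx_subset_Minv:
  assumes "x \<in> X"
  shows "Vx X f x \<subseteq> Minv X f"
proof
  fix \<nu> assume \<nu>V: "\<nu> \<in> Vx X f x"
  hence \<nu>: "\<nu> \<in> probs X" unfolding Vx_def by blast
  interpret prob_space \<nu> using \<nu> by (simp add: probs_iff)
  have s: "sets \<nu> = sets (borelX X)" using \<nu> by (simp add: probs_iff)
  have f: "f \<in> \<nu> \<rightarrow>\<^sub>M borelX X" using measurable_f measurable_cong_sets[OF s refl] by blast
  have "distr \<nu> (borelX X) f = \<nu>"
  proof (rule probs_eqI[OF compact_X _ \<nu>])
    show "distr \<nu> (borelX X) f \<in> probs X" using prob_space_distr[OF f] by (simp add: probs_iff)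
    fix g :: "'a \<Rightarrow> real" assume g: "continuous_on X g"
    have gf: "continuous_on X (\<lambda>x. g (f x))" using continuous_comp_funpow[OF g, of 1] by simp
    obtain B where B: "B > 0" "\<And>x. x \<in> X \<Longrightarrow> \<bar>g x\<bar> \<le> B" using compact_continuous_bounded[OF compact_X g] by blast
    have small: "\<bar>integral\<^sup>L \<nu> (\<lambda>x. g (f x) - g x) - 0\<bar> \<le> e" if e: "e > 0" for e
    proof -
      obtain N where N: "real N * e > 2 * B" using ex_less_of_nat_mult[OF e] by blast
      show ?thesis
      proof (rule Vx_average_bound[OF \<nu>V assms])
        show "continuous_on X (\<lambda>x. g (f x) - g x)" using g gf by (intro continuous_intros)
        fix n assume n: "n \<ge> N"
        have "(\<Sum>i<n. g (f ((f ^^ i) x)) - g ((f ^^ i) x)) = (\<Sum>i<n. g ((f ^^ Suc i) x) - g ((f ^^ i) x))"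
          by simp
        also have "\<dots> = g ((f ^^ n) x) - g x" by (subst sum_lessThan_telescope) simp
        finally have "\<bar>\<Sum>i<n. g (f ((f ^^ i) x)) - g ((f ^^ i) x)\<bar> \<le> 2 * B"
          using B(2)[OF assms] B(2)[OF funpow_in[OF assms, of n]] by linarith
        also have "2 * B \<le> real n * e"
          using N n e mult_right_mono[of "real N" "real n" e] by linarith
        finally show "\<bar>(\<Sum>i<n. g (f ((f ^^ i) x)) - g ((f ^^ i) x)) / real n - 0\<bar> \<le> e"
          using e by (cases "n = 0") (auto simp: field_simps)
      qed
    qed
    have "\<bar>integral\<^sup>L \<nu> (\<lambda>x. g (f x) - g x)\<bar> \<le> 0" by (rule field_le_epsilon) (use small in simp)
    hence "integral\<^sup>L \<nu> (\<lambda>x. g (f x) - g x) = 0" by simp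
    hence "integral\<^sup>L \<nu> (\<lambda>x. g (f x)) = integral\<^sup>L \<nu> g"
      using probs_integrable[OF compact_X \<nu> g] probs_integrable[OF compact_X \<nu> gf] by simp
    thus "integral\<^sup>L (distr \<nu> (borelX X) f) g = integral\<^sup>L \<nu> g"
      using integral_distr[OF f borelX_measurable_continuous[OF g]] by simp
  qed
  hence "measure \<nu> (f -` A \<inter> X) = measure \<nu> A" if "A \<in> sets \<nu>" for A
    using measure_distr[OF f, of A] that s space_probs[OF \<nu>] by simp
  thus "\<nu> \<in> Minv X f" using \<nu> by (simp add: Minv_def)
qed

end

section \<open>Existence of limit measures\<close>

text \<open>As in the Cantor set only the digits 0 and 2 occur: at the first differing place
  \<open>j\<close> the values differ by \<open>2 * (1/3) ^ Suc j\<close>, and all later digits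
  together make up for at most half of this.\<close>

lemma base3_bit_separation:
  fixes b c :: "nat \<Rightarrow> bool"
  defines "\<theta> \<equiv> (\<lambda>b. \<Sum>m. (if b m then 2 else 0) * (1/3::real) ^ Suc m)"
  assumes "\<bar>\<theta> b - \<theta> c\<bar> < (1/3) ^ Suc M" "k \<le> M"
  shows "b k = c k"
proof (rule ccontr)
  let ?u = "\<lambda>b m. (if b m then 2 else 0) * (1/3::real) ^ Suc m"
  have geo: "summable (\<lambda>m. 2 * (1/3::real) ^ Suc m)"
    by (intro summable_mult) (simp add: summable_geometric)
  have sm: "summable (?u b)" for b
    by (rule summable_comparison_test'[OF geo, of 0]) simp
  assume "b k \<noteq> c k"
  define j where "j = (LEAST k. b k \<noteq> c k)"
  have j: "b j \<noteq> c j" "\<And>i. i < j \<Longrightarrow> b i = c i" "j \<le> k"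
    using LeastI[of "\<lambda>k. b k \<noteq> c k", OF \<open>b k \<noteq> c k\<close>] not_less_Least[of _ "\<lambda>k. b k \<noteq> c k"]
      Least_le[of "\<lambda>k. b k \<noteq> c k", OF \<open>b k \<noteq> c k\<close>] unfolding j_def by blast+
  let ?d = "\<lambda>m. ?u b m - ?u c m"
  have sd: "summable ?d" by (intro summable_diff sm)
  have "\<theta> b - \<theta> c = (\<Sum>m. ?d m)" unfolding \<theta>_def by (rule suminf_diff[OF sm sm])
  also have "\<dots> = (\<Sum>m. ?d (m + Suc j)) + (\<Sum>m<Suc j. ?d m)" by (rule suminf_split_initial_segment[OF sd])
  also have "(\<Sum>m<Suc j. ?d m) = ?d j" using j(2) by simp
  finally have eq: "\<theta> b - \<theta> c = (\<Sum>m. ?d (m + Suc j)) + ?d j" .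
  have g2: "(\<lambda>m. 2 * (1/3::real) ^ Suc (m + Suc j)) sums (1/3) ^ Suc j"
  proof -
    have "(\<lambda>m. (1/3::real) ^ m) sums (1 / (1 - 1/3))" by (rule geometric_sums) simp
    from sums_mult[OF this, of "2 * (1/3) ^ Suc (Suc j)"] show ?thesis
      by (simp add: power_add field_simps)
  qed
  have le: "\<bar>?d (m + Suc j)\<bar> \<le> 2 * (1/3) ^ Suc (m + Suc j)" for m by simp
  have sa: "summable (\<lambda>m. \<bar>?d (m + Suc j)\<bar>)"
    by (rule summable_comparison_test'[OF sums_summable[OF g2], of 0]) (use le in simp)
  have "\<bar>\<Sum>m. ?d (m + Suc j)\<bar> \<le> (\<Sum>m. \<bar>?d (m + Suc j)\<bar>)" by (rule summable_rabs[OF sa])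
  also have "\<dots> \<le> (\<Sum>m. 2 * (1/3::real) ^ Suc (m + Suc j))"
    by (rule suminf_le[OF le sa sums_summable[OF g2]])
  also have "\<dots> = (1/3) ^ Suc j" using sums_unique[OF g2] ..
  finally have "\<bar>\<Sum>m. ?d (m + Suc j)\<bar> \<le> (1/3) ^ Suc j" .
  moreover have "\<bar>?d j\<bar> = 2 * (1/3) ^ Suc j" using j(1) by auto
  ultimately have "(1/3) ^ Suc j \<le> \<bar>\<theta> b - \<theta> c\<bar>" unfolding eq by linarith
  moreover have "(1/3::real) ^ Suc M \<le> (1/3) ^ Suc j" using j(3) assms(3) by (intro power_decreasing) auto
  ultimately show False using assms(2) by linarith
qed

lemma base3_bit_bounds:
  fixes b :: "nat \<Rightarrow> bool"
  shows "(\<Sum>m. (if b m then 2 else 0) * (1/3::real) ^ Suc m) \<in> {0..1}"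
proof -
  let ?u = "\<lambda>m. (if b m then 2 else 0) * (1/3::real) ^ Suc m"
  have g: "(\<lambda>m. 2 * (1/3::real) ^ Suc m) sums 1"
  proof -
    have "(\<lambda>m. (1/3::real) ^ m) sums (1 / (1 - 1/3))" by (rule geometric_sums) simp
    from sums_mult[OF this, of "2/3"] show ?thesis by simp
  qed
  have sm: "summable ?u"
    by (rule summable_comparison_test'[OF sums_summable[OF g], of 0]) simp
  have "suminf ?u \<le> (\<Sum>m. 2 * (1/3::real) ^ Suc m)" by (intro suminf_le sm sums_summable[OF g]) auto
  also have "\<dots> = 1" using sums_unique[OF g] ..
  finally have "suminf ?u \<le> 1" .
  moreover have "0 \<le> suminf ?u" by (intro suminf_nonneg sm) auto
  ultimately show ?thesis by simp
qed

text \<open>The ternary digits record membership in the balls of a countable family of finite nets, so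
  that the inverse of the coding is uniformly continuous (the coding itself is not continuous).\<close>

lemma compact_ternary_coding:
  fixes X :: "'a::metric_space set"
  assumes "compact X"
  obtains \<theta> :: "'a \<Rightarrow> real" where "\<And>x. \<theta> x \<in> {0..1}"
    "\<And>e. e > 0 \<Longrightarrow> \<exists>d>0. \<forall>x\<in>X. \<forall>y\<in>X. \<bar>\<theta> x - \<theta> y\<bar> < d \<longrightarrow> dist x y < e"
proof (cases "X = {}")
  case True
  thus ?thesis by (intro that[of "\<lambda>_. 0"]) (auto intro: exI[of _ 1])
next
  case False
  have "\<exists>C. finite C \<and> C \<subseteq> X \<and> X \<subseteq> (\<Union>c\<in>C. ball c (1 / real (Suc n)))" for n
  proof -
    have "X \<subseteq> (\<Union>c\<in>X. ball c (1 / real (Suc n)))" by auto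
    then obtain C where "C \<subseteq> X" "finite C" "X \<subseteq> (\<Union>c\<in>C. ball c (1 / real (Suc n)))"
      by (rule compactE_image[OF assms, of X "\<lambda>c. ball c (1 / real (Suc n))", rotated]) auto
    thus ?thesis by blast
  qed
  then obtain C where C: "\<And>n. finite (C n)" "\<And>n. X \<subseteq> (\<Union>c\<in>C n. ball c (1 / real (Suc n)))" by metis
  let ?D = "SIGMA n:UNIV. C n"
  have cD: "countable ?D" using C(1) by (intro countable_SIGMA) (auto intro: countable_finite)
  have "C 0 \<noteq> {}" using C(2)[of 0] False by auto
  hence neD: "?D \<noteq> {}" by auto
  define b where "b = from_nat_into ?D"
  have rb: "range b = ?D" unfolding b_def by (rule range_from_nat_into[OF neD cD])
  define bit where "bit x m \<longleftrightarrow> x \<in> ball (snd (b m)) (1 / real (Suc (fst (b m))))" for x m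
  define \<theta> where "\<theta> x = (\<Sum>m. (if bit x m then 2 else 0) * (1/3::real) ^ Suc m)" for x
  show ?thesis
  proof (rule that[of \<theta>])
    show "\<theta> x \<in> {0..1}" for x unfolding \<theta>_def by (rule base3_bit_bounds)
    fix e :: real assume e: "e > 0"
    then obtain n where n: "2 / e < real (Suc n)" using reals_Archimedean2[of "2/e"] by (metis less_trans lessI of_nat_less_iff)
    have "finite ({n} \<times> C n)" "{n} \<times> C n \<subseteq> range b" using C(1) rb by auto
    then obtain I where I: "finite I" "{n} \<times> C n = b ` I" by (meson finite_subset_image subset_UNIV)
    \<comment> \<open>Each ball of the \<open>n\<close>-th net is recorded at some place up to
      \<open>M\<close>, so agreement of the digits up to \<open>M\<close> settles membership in all
      of them.\<close>
    define M where "M = Max (insert 0 I)"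
    show "\<exists>d>0. \<forall>x\<in>X. \<forall>y\<in>X. \<bar>\<theta> x - \<theta> y\<bar> < d \<longrightarrow> dist x y < e"
    proof (intro exI[of _ "(1/3) ^ Suc M"] conjI ballI impI)
      fix x y assume xy: "x \<in> X" "y \<in> X" "\<bar>\<theta> x - \<theta> y\<bar> < (1/3) ^ Suc M"
      obtain c where c: "c \<in> C n" "x \<in> ball c (1 / real (Suc n))" using C(2) xy(1) by blast
      have "(n, c) \<in> b ` I" using c(1) by (simp flip: I(2))
      then obtain i where i: "i \<in> I" "b i = (n, c)" by (rule imageE) simp
      have "i \<le> M" unfolding M_def using I(1) i(1) by simp
      hence "bit x i = bit y i"
        by (rule base3_bit_separation[OF xy(3)[unfolded \<theta>_def]])
      hence "y \<in> ball c (1 / real (Suc n))" using c i(2) by (simp add: bit_def)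
      hence "dist x c < 1 / real (Suc n)" "dist y c < 1 / real (Suc n)"
        using c(2) unfolding mem_ball by (simp_all add: dist_commute)
      hence "dist x y < 1 / real (Suc n) + 1 / real (Suc n)" by (rule dist_triangle_less_add)
      also have "\<dots> < e" using n e by (simp add: field_simps)
      finally show "dist x y < e" .
    qed simp
  qed
qed

text \<open>The decoding is uniformly continuous on the coded points, so it extends continuously to
  their closure; compactness keeps the extended values inside \<open>X\<close>. The closure is the
  right domain because limits of coded laws live there.\<close>

lemma compact_ternary_decoding:
  fixes X :: "'a::metric_space set"
  assumes "compact X" "X \<noteq> {}"
  obtains \<theta> :: "'a \<Rightarrow> real" and P :: "real \<Rightarrow> 'a" where
    "\<And>x. \<theta> x \<in> {0..1}" "continuous_on (closure (\<theta> ` X)) P" "P ` closure (\<theta> ` X) \<subseteq> X" "\<And>x. x \<in> X \<Longrightarrow> P (\<theta> x) = x"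
proof -
  obtain \<theta> :: "'a \<Rightarrow> real" where \<theta>: "\<And>x. \<theta> x \<in> {0..1}"
    and uc: "\<And>e. e > 0 \<Longrightarrow> \<exists>d>0. \<forall>x\<in>X. \<forall>y\<in>X. \<bar>\<theta> x - \<theta> y\<bar> < d \<longrightarrow> dist x y < e"
    using compact_ternary_coding[OF assms(1)] by blast
  \<comment> \<open>\<open>Q y z\<close> says that points of \<open>X\<close> with code near
    \<open>y\<close> are near \<open>z\<close>, that is, \<open>z\<close> is the value at
    \<open>y\<close> of the extended decoding.\<close>
  define Q where "Q y z \<longleftrightarrow> z \<in> X \<and> (\<forall>e>0. \<exists>d>0. \<forall>x\<in>X. \<bar>\<theta> x - y\<bar> < d \<longrightarrow> dist x z < e)" for y z
  have ex: "\<exists>z. Q y z" if y: "y \<in> closure (\<theta> ` X)" for y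
  proof -
    obtain v where v: "\<And>n. v n \<in> \<theta> ` X" "v \<longlonglongrightarrow> y" using y unfolding closure_sequential by blast
    define u where "u n = (SOME z. z \<in> X \<and> v n = \<theta> z)" for n
    have "u n \<in> X \<and> v n = \<theta> (u n)" for n
      unfolding u_def by (rule someI_ex) (use v(1)[of n] in blast)
    hence u: "\<And>n. u n \<in> X" "\<And>n. v n = \<theta> (u n)" by blast+
    obtain z r where z: "z \<in> X" "strict_mono (r :: nat \<Rightarrow> nat)" "(u \<circ> r) \<longlonglongrightarrow> z"
      using assms(1) u(1) unfolding compact_def by meson
    have vr: "(v \<circ> r) \<longlonglongrightarrow> y" using LIMSEQ_subseq_LIMSEQ[OF v(2) z(2)] .
    have "Q y z" unfolding Q_def
    proof (intro conjI allI impI z(1))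
      fix e :: real assume e: "e > 0"
      then obtain d where d: "d > 0" "\<And>x y. x \<in> X \<Longrightarrow> y \<in> X \<Longrightarrow> \<bar>\<theta> x - \<theta> y\<bar> < d \<Longrightarrow> dist x y < e / 2"
        using uc[of "e/2"] by auto
      have "eventually (\<lambda>n. dist ((v \<circ> r) n) y < d / 2) sequentially" by (rule tendstoD[OF vr]) (use d(1) in simp)
      moreover have "eventually (\<lambda>n. dist ((u \<circ> r) n) z < e / 2) sequentially" by (rule tendstoD[OF z(3)]) (use e in simp)
      ultimately have "eventually (\<lambda>n. dist ((v \<circ> r) n) y < d / 2 \<and> dist ((u \<circ> r) n) z < e / 2) sequentially"
        by (rule eventually_conj)
      then obtain n where n: "dist (v (r n)) y < d / 2" "dist (u (r n)) z < e / 2"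
        by (auto simp: eventually_sequentially)
      show "\<exists>d>0. \<forall>x\<in>X. \<bar>\<theta> x - y\<bar> < d \<longrightarrow> dist x z < e"
      proof (intro exI[of _ "d/2"] conjI ballI impI)
        fix x assume x: "x \<in> X" "\<bar>\<theta> x - y\<bar> < d / 2"
        have "\<bar>\<theta> x - \<theta> (u (r n))\<bar> < d" using x(2) n(1) unfolding u(2) dist_real_def by linarith
        hence "dist x (u (r n)) < e / 2" using d(2) x(1) u(1) by blast
        thus "dist x z < e" using n(2) by (metis dist_commute dist_triangle_half_l)
      qed (use d in simp)
    qed
    thus ?thesis by blast
  qed
  define P where "P y = (SOME z. Q y z)" for y
  have P: "Q y (P y)" if "y \<in> closure (\<theta> ` X)" for y
    unfolding P_def using ex[OF that] by (rule someI_ex)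
  show ?thesis
  proof (rule that[of \<theta> P])
    show "P ` closure (\<theta> ` X) \<subseteq> X" using P unfolding Q_def by blast
    show "P (\<theta> x) = x" if x: "x \<in> X" for x
    proof (rule ccontr)
      assume "P (\<theta> x) \<noteq> x"
      hence pos: "dist x (P (\<theta> x)) > 0" by simp
      have "\<theta> x \<in> closure (\<theta> ` X)" using x by (intro subsetD[OF closure_subset] imageI)
      from P[OF this] pos obtain d where "d > 0" "\<forall>z\<in>X. \<bar>\<theta> z - \<theta> x\<bar> < d \<longrightarrow> dist z (P (\<theta> x)) < dist x (P (\<theta> x))"
        unfolding Q_def by blast
      thus False using x by auto
    qed
    show "continuous_on (closure (\<theta> ` X)) P"
      unfolding continuous_on_iff
    proof (intro ballI allI impI)
      fix y e assume y: "y \<in> closure (\<theta> ` X)" and e: "(e::real) > 0"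
      hence "0 < e / 2" by simp
      with P[OF y] obtain d where d: "d > 0" "\<forall>x\<in>X. \<bar>\<theta> x - y\<bar> < d \<longrightarrow> dist x (P y) < e / 2"
        unfolding Q_def by blast
      show "\<exists>d>0. \<forall>y'\<in>closure (\<theta> ` X). dist y' y < d \<longrightarrow> dist (P y') (P y) < e"
      proof (intro exI[of _ "d/2"] conjI ballI impI)
        fix y' assume y': "y' \<in> closure (\<theta> ` X)" "dist y' y < d / 2"
        from P[OF y'(1)] \<open>0 < e / 2\<close> obtain d' where d': "d' > 0" "\<forall>x\<in>X. \<bar>\<theta> x - y'\<bar> < d' \<longrightarrow> dist x (P y') < e / 2"
          unfolding Q_def by blast
        have "0 < min (d/2) d'" using d d' by simp
        then obtain x where x: "x \<in> X" "dist (\<theta> x) y' < min (d/2) d'"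
          using y'(1) unfolding closure_approachable by blast
        have "dist x (P y') < e / 2" using d'(2) x by (simp add: dist_real_def)
        moreover have "\<bar>\<theta> x - y\<bar> < d" using x(2) y'(2) unfolding dist_real_def by linarith
        hence "dist x (P y) < e / 2" using d(2) x(1) by blast
        ultimately show "dist (P y') (P y) < e" by (rule dist_triangle_half_r)
      qed (use d in simp)
    qed
  qed (rule \<theta>)
qed

context compact_system
begin

text \<open>The coded orbit gives laws on the unit interval, which have a weakly convergent
  subsequence; the limit law sits on the closure of the coded space and is carried back to
  \<open>X\<close> by the decoding \<open>P\<close>. As the coding is not continuous, convergence is
  tested on extensions of \<open>g \<circ> P\<close> only.\<close>

lemma Vx_nonempty:
  assumes x: "x \<in> X"
  shows "Vx X f x \<noteq> {}"
proof -
  obtain \<theta> :: "'a \<Rightarrow> real" and P :: "real \<Rightarrow> 'a" where \<theta>: "\<And>x. \<theta> x \<in> {0..1}"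
    and contP: "continuous_on (closure (\<theta> ` X)) P" and PX: "P ` closure (\<theta> ` X) \<subseteq> X"
    and P\<theta>: "\<And>x. x \<in> X \<Longrightarrow> P (\<theta> x) = x"
    using compact_ternary_decoding[OF compact_X] x by (metis empty_iff)
  define K where "K = closure (\<theta> ` X)"
  have K: "closed K" "K \<noteq> {}" unfolding K_def using x by auto
  have \<theta>K: "\<theta> y \<in> K" if "y \<in> X" for y using that unfolding K_def by (intro subsetD[OF closure_subset] imageI)
  \<comment> \<open>The law of \<open>n + 1\<close> coded orbit points, so that no sample is
    empty.\<close>
  define \<mu> where "\<mu> n = distr (uniform_count_measure {..<Suc n}) borel (\<lambda>i. \<theta> ((f ^^ i) x))" for n
  have meas: "(\<lambda>i. \<theta> ((f ^^ i) x)) \<in> uniform_count_measure {..<Suc n} \<rightarrow>\<^sub>M borel" for n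
    by (auto simp: measurable_def space_uniform_count_measure sets_uniform_count_measure)
  have rd: "real_distribution (\<mu> n)" for n
  proof -
    interpret prob_space "uniform_count_measure {..<Suc n}"
      by (intro prob_space_uniform_count_measure) auto
    show ?thesis unfolding \<mu>_def using prob_space_distr[OF meas] by (simp add: real_distribution_def real_distribution_axioms_def)
  qed
  have int\<mu>: "integral\<^sup>L (\<mu> n) h = (\<Sum>i<Suc n. h (\<theta> ((f ^^ i) x))) / Suc n" if "h \<in> borel_measurable borel" for h :: "real \<Rightarrow> real" and n
    unfolding \<mu>_def by (subst integral_distr[OF meas that], subst integral_uniform_count_measure) auto
  have "tight \<mu>"
    unfolding tight_def
  proof (intro conjI allI impI rd)
    fix \<epsilon> :: real assume "\<epsilon> > 0"
    \<comment> \<open>Tightness asks for half-open intervals; this one contains the unit interval,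
      where all codes lie.\<close>
    have "measure (\<mu> n) {-1<..1} = 1" for n
    proof -
      interpret real_distribution "\<mu> n" by (rule rd)
      have "(\<lambda>i. \<theta> ((f ^^ i) x)) -` {-1<..1} \<inter> space (uniform_count_measure {..<Suc n}) = {..<Suc n}"
      proof -
        have "\<theta> y \<in> {-1<..1}" for y using \<theta>[of y] by auto
        thus ?thesis unfolding space_uniform_count_measure by auto
      qed
      hence "measure (\<mu> n) {-1<..1} = measure (uniform_count_measure {..<Suc n}) {..<Suc n}"
        unfolding \<mu>_def by (subst measure_distr[OF meas]) auto
      thus ?thesis by (simp add: measure_uniform_count_measure)
    qed
    thus "\<exists>a b. a < b \<and> (\<forall>n. 1 - \<epsilon> < measure (\<mu> n) {a<..b})"
      using \<open>\<epsilon> > 0\<close> by (intro exI[of _ "-1"] exI[of _ 1]) auto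
  qed
  from tight_imp_convergent_subsubsequence[OF this strict_mono_id]
  obtain r M where r: "strict_mono (r :: nat \<Rightarrow> nat)" "real_distribution M" "weak_conv_m (\<lambda>n. \<mu> (r n)) M"
    unfolding comp_def id_apply by blast
  interpret M: real_distribution M by (rule r(2))
  have wc: "(\<lambda>n. integral\<^sup>L (\<mu> (r n)) h) \<longlonglongrightarrow> integral\<^sup>L M h"
    if "continuous_on UNIV h" "\<And>y. norm (h y) \<le> B" for h :: "real \<Rightarrow> real" and B
  proof (rule weak_conv_imp_integral_bdd_continuous_conv)
    show "isCont h y" for y using that(1) by (simp add: continuous_on_eq_continuous_at)
    show "weak_conv_m (\<lambda>n. \<mu> (r n)) M" by (rule r(3))
  qed (use that(2) rd r(2) in blast)+
  have AEK: "AE y in M. y \<in> K"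
  proof -
    \<comment> \<open>Bounded, continuous and zero exactly on the closed set \<open>K\<close>: its
      integrals vanish along the sequence, hence also for the limit law.\<close>
    define k where "k y = min 1 (infdist y K)" for y
    have ck: "continuous_on UNIV k" unfolding k_def by (intro continuous_intros)
    have km: "k \<in> borel_measurable borel" using ck by (rule borel_measurable_continuous_onI)
    have kb: "0 \<le> k y" "k y \<le> 1" for y by (simp_all add: k_def infdist_nonneg)
    have "integral\<^sup>L (\<mu> n) k = 0" for n
      unfolding int\<mu>[OF km] using \<theta>K funpow_in[OF x] by (simp add: k_def)
    with wc[OF ck, of 1] kb have "integral\<^sup>L M k = 0"
      by (simp add: LIMSEQ_const_iff)
    moreover have "integrable M k" using km kb by (intro M.integrable_const_bound[of _ 1]) auto
    ultimately have "AE y in M. k y = 0" using kb(1) by (subst (asm) integral_nonneg_eq_0_iff_AE) auto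
    thus ?thesis
    proof eventually_elim
      case (elim y)
      hence "infdist y K = 0" by (simp add: k_def min_def split: if_splits)
      thus ?case using K by (simp add: in_closed_iff_infdist_zero)
    qed
  qed
  \<comment> \<open>Off \<open>K\<close>, a null set for \<open>M\<close>, the decoding is filled up
    with the constant \<open>x\<close>, which lies in \<open>X\<close>.\<close>
  define p where "p y = (if y \<in> K then P y else x)" for y
  have "p \<in> borel_measurable borel" unfolding p_def
    using K contP by (intro borel_measurable_continuous_on_if) (auto simp: K_def)
  hence "p \<in> borel \<rightarrow>\<^sub>M borelX X" unfolding borelX_def using PX x
    by (intro measurable_restrict_space2) (auto simp: p_def K_def image_subset_iff)
  hence pm: "p \<in> M \<rightarrow>\<^sub>M borelX X" by simp
  define \<nu> where "\<nu> = distr M (borelX X) p"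
  have \<nu>: "\<nu> \<in> probs X" unfolding \<nu>_def probs_iff using M.prob_space_distr[OF pm] by simp
  have conv: "(\<lambda>n. (\<Sum>i<Suc (r n). g ((f ^^ i) x)) / Suc (r n)) \<longlonglongrightarrow> integral\<^sup>L \<nu> g"
    if g: "continuous_on X g" for g :: "'a \<Rightarrow> real"
  proof -
    obtain B where B: "B > 0" "\<And>x. x \<in> X \<Longrightarrow> \<bar>g x\<bar> \<le> B" using compact_continuous_bounded[OF compact_X g] by blast
    have "continuous_on K (\<lambda>y. g (P y))" using contP PX unfolding K_def by (intro continuous_on_compose2[OF g]) auto
    \<comment> \<open>Weak convergence tests bounded continuous functions on the whole line, so
      \<open>g \<circ> P\<close> is extended from \<open>K\<close> with the same bound.\<close>
    then obtain h where h: "continuous_on UNIV h" "\<And>y. y \<in> K \<Longrightarrow> h y = g (P y)" "\<And>y. norm (h y) \<le> B"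
      by (rule Tietze[of K _ UNIV B]) (use K B PX in \<open>auto simp: K_def\<close>)
    have hm: "h \<in> borel_measurable borel" using h(1) by (rule borel_measurable_continuous_onI)
    have "integral\<^sup>L \<nu> g = integral\<^sup>L M (\<lambda>y. g (p y))"
      unfolding \<nu>_def by (rule integral_distr[OF pm borelX_measurable_continuous[OF g]])
    also have "\<dots> = integral\<^sup>L M h"
    proof (rule integral_cong_AE)
      show "(\<lambda>y. g (p y)) \<in> borel_measurable M"
        using measurable_compose[OF pm borelX_measurable_continuous[OF g]] .
      show "AE y in M. g (p y) = h y" using AEK by eventually_elim (use h(2) in \<open>simp add: p_def\<close>)
    qed (use hm in simp)
    finally have "integral\<^sup>L \<nu> g = integral\<^sup>L M h" .
    moreover have "integral\<^sup>L (\<mu> n) h = (\<Sum>i<Suc n. g ((f ^^ i) x)) / Suc n" for n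
      unfolding int\<mu>[OF hm] using h(2)[OF \<theta>K] P\<theta> funpow_in[OF x] by simp
    ultimately show ?thesis using wc[OF h(1,3)] by simp
  qed
  have "\<nu> \<in> Vx X f x" unfolding Vx_def
  proof (intro CollectI conjI \<nu> allI impI)
    fix W N assume W: "openin (weak_star X) W \<and> \<nu> \<in> W"
    obtain G \<eta> where G: "finite G" "\<And>g. g \<in> G \<Longrightarrow> continuous_on X g" "\<eta> > (0::real)"
      "\<And>\<mu>. \<mu> \<in> probs X \<Longrightarrow> (\<And>g. g \<in> G \<Longrightarrow> \<bar>integral\<^sup>L \<mu> g - integral\<^sup>L \<nu> g\<bar> < \<eta>) \<Longrightarrow> \<mu> \<in> W"
      using weak_star_nbhd[of X W \<nu>] W by blast
    have "eventually (\<lambda>n. \<forall>g\<in>G. dist ((\<Sum>i<Suc (r n). g ((f ^^ i) x)) / Suc (r n)) (integral\<^sup>L \<nu> g) < \<eta>) sequentially"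
      using G(1) by (rule eventually_ball_finite) (use conv G(2,3) in \<open>auto intro: tendstoD\<close>)
    then obtain n0 where n0: "\<And>n g. n \<ge> n0 \<Longrightarrow> g \<in> G \<Longrightarrow> dist ((\<Sum>i<Suc (r n). g ((f ^^ i) x)) / Suc (r n)) (integral\<^sup>L \<nu> g) < \<eta>"
      unfolding eventually_sequentially by blast
    define n where "n = max n0 N"
    have "Suc (r n) \<ge> N" using seq_suble[OF r(1), of n] by (simp add: n_def)
    moreover have "empirical X f (Suc (r n)) x \<in> W"
    proof (rule G(4))
      show "empirical X f (Suc (r n)) x \<in> probs X" using x by (intro empirical_in_probs) auto
      fix g assume g: "g \<in> G"
      show "\<bar>integral\<^sup>L (empirical X f (Suc (r n)) x) g - integral\<^sup>L \<nu> g\<bar> < \<eta>"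
        using n0[of n g] g integral_empirical[OF x, of "Suc (r n)" g] borelX_measurable_continuous[OF G(2)[OF g]]
        by (simp add: n_def dist_real_def)
    qed
    ultimately show "\<exists>n\<ge>N. empirical X f n x \<in> W" by blast
  qed
  thus ?thesis by blast
qed

lemma Delta_sub_subset_Delta_cap: "Delta_sub X f U \<subseteq> Delta_cap X f U"
  using Vx_nonempty unfolding Delta_sub_def Delta_cap_def by blast

end

section \<open>Entropy of finite partitions\<close>

text \<open>Sum \<open>ln t \<le> t - 1\<close> at \<open>t = q v / p v\<close>, weighted by
  \<open>p v\<close>. The last assumption excludes terms with \<open>p v > 0\<close> and
  \<open>q v = 0\<close>, for which the convention \<open>ln 0 = 0\<close> would feign a cost of
  0.\<close>

lemma gibbs_inequality:
  fixes p q :: "'b \<Rightarrow> real"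
  assumes "finite A" "\<And>v. v \<in> A \<Longrightarrow> 0 \<le> p v" "\<And>v. v \<in> A \<Longrightarrow> 0 \<le> q v" "(\<Sum>v\<in>A. q v) \<le> (\<Sum>v\<in>A. p v)"
    and "\<And>v. v \<in> A \<Longrightarrow> p v > 0 \<Longrightarrow> q v > 0"
  shows "- (\<Sum>v\<in>A. p v * ln (p v)) \<le> - (\<Sum>v\<in>A. p v * ln (q v))"
proof -
  have "p v * ln (q v) - p v * ln (p v) \<le> q v - p v" if v: "v \<in> A" for v
  proof (cases "p v = 0")
    case True
    thus ?thesis using assms(3)[OF v] by simp
  next
    case False
    hence p: "p v > 0" using assms(2)[OF v] by simp
    hence q: "q v > 0" using assms(5)[OF v] by simp
    have "p v * ln (q v / p v) \<le> p v * (q v / p v - 1)"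
      using p q by (intro mult_left_mono ln_le_minus_one) auto
    also have "\<dots> = q v - p v" using p by (simp add: right_diff_distrib)
    finally show ?thesis using p q by (simp add: ln_div right_diff_distrib)
  qed
  hence "(\<Sum>v\<in>A. p v * ln (q v) - p v * ln (p v)) \<le> (\<Sum>v\<in>A. q v - p v)" by (rule sum_mono)
  thus ?thesis using assms(4) by (simp add: sum_subtractf)
qed

lemma integral_finite_valued:
  fixes \<phi> :: "'b \<Rightarrow> real"
  assumes \<mu>: "\<mu> \<in> probs X" and fin: "finite (P ` X)" and meas: "\<And>v. {x \<in> X. P x = v} \<in> sets (borelX X)"
  shows "(\<integral>x. \<phi> (P x) \<partial>\<mu>) = (\<Sum>v\<in>P ` X. measure \<mu> {x \<in> X. P x = v} * \<phi> v)"
    and "(\<lambda>x. \<phi> (P x)) \<in> borel_measurable (borelX X)"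
proof -
  interpret prob_space \<mu> using \<mu> by (simp add: probs_iff)
  have m: "{x \<in> X. P x = v} \<in> sets \<mu>" for v using \<mu> meas by (simp add: probs_iff)
  have eq: "\<phi> (P x) = (\<Sum>v\<in>P ` X. indicator {x \<in> X. P x = v} x * \<phi> v)" if "x \<in> X" for x
  proof -
    have "(\<Sum>v\<in>P ` X. indicator {x \<in> X. P x = v} x * \<phi> v) = (\<Sum>v\<in>P ` X. if v = P x then \<phi> v else 0)"
      using that by (intro sum.cong) auto
    also have "\<dots> = \<phi> (P x)" using fin that by simp
    finally show ?thesis ..
  qed
  have "(\<integral>x. \<phi> (P x) \<partial>\<mu>) = (\<integral>x. (\<Sum>v\<in>P ` X. indicator {x \<in> X. P x = v} x * \<phi> v) \<partial>\<mu>)"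
    using eq space_probs[OF \<mu>] by (intro Bochner_Integration.integral_cong) auto
  also have "\<dots> = (\<Sum>v\<in>P ` X. (\<integral>x. indicator {x \<in> X. P x = v} x * \<phi> v \<partial>\<mu>))"
    using m by (intro Bochner_Integration.integral_sum integrable_mult_left integrable_real_indicator)
      (auto simp: emeasure_eq_measure)
  also have "\<dots> = (\<Sum>v\<in>P ` X. measure \<mu> {x \<in> X. P x = v} * \<phi> v)"
    using m sets.sets_into_space[OF m] by (intro sum.cong refl) (simp add: Int_absorb2)
  finally show "(\<integral>x. \<phi> (P x) \<partial>\<mu>) = (\<Sum>v\<in>P ` X. measure \<mu> {x \<in> X. P x = v} * \<phi> v)" .
  have "(\<lambda>x. (\<Sum>v\<in>P ` X. indicator {x \<in> X. P x = v} x * \<phi> v)) \<in> borel_measurable (borelX X)"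
    using meas by measurable
  thus "(\<lambda>x. \<phi> (P x)) \<in> borel_measurable (borelX X)"
    by (subst measurable_cong[where g = "\<lambda>x. (\<Sum>v\<in>P ` X. indicator {x \<in> X. P x = v} x * \<phi> v)"]) (use eq in auto)
qed

lemma sum_measure_level_sets:
  assumes "\<mu> \<in> probs X" "finite (P ` X)" "\<And>v. {x \<in> X. P x = v} \<in> sets (borelX X)"
  shows "(\<Sum>v\<in>P ` X. measure \<mu> {x \<in> X. P x = v}) = 1"
proof -
  interpret prob_space \<mu> using assms(1) by (simp add: probs_iff)
  show ?thesis using integral_finite_valued(1)[OF assms, of "\<lambda>_. 1"] prob_space by simp
qed

text \<open>Entropy is the mean of the information function; in this form the law of large numbers
  applies to it.\<close>

lemma part_entropy_integral:
  assumes "\<mu> \<in> probs X" "finite (P ` X)" "\<And>v. {x \<in> X. P x = v} \<in> sets (borelX X)"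
  shows "part_entropy \<mu> X P = (\<integral>x. - ln (measure \<mu> {y \<in> X. P y = P x}) \<partial>\<mu>)"
  using integral_finite_valued(1)[OF assms, of "\<lambda>v. - ln (measure \<mu> {y \<in> X. P y = v})"]
  by (simp add: part_entropy_def sum_negf)

lemma part_entropy_nonneg:
  assumes "\<mu> \<in> probs X"
  shows "0 \<le> part_entropy \<mu> X P"
proof -
  interpret prob_space \<mu> using assms by (simp add: probs_iff)
  have "measure \<mu> {x \<in> X. P x = v} * ln (measure \<mu> {x \<in> X. P x = v}) \<le> 0" for v
    by (cases "measure \<mu> {x \<in> X. P x = v} = 0")
       (auto intro!: mult_nonneg_nonpos simp: ln_le_zero_iff measure_le_1 zero_less_measure_iff)
  thus ?thesis unfolding part_entropy_def by (simp add: sum_nonpos)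
qed

text \<open>Gibbs' inequality for the cell masses against the product weights
  \<open>ma (a v) * mb (b v)\<close>; injectivity of the pair of factor names makes these weights
  add up to at most 1.\<close>

lemma part_entropy_join_le:
  assumes \<mu>: "\<mu> \<in> probs X" and fin: "finite (P ` X)" and meas: "\<And>v. {x \<in> X. P x = v} \<in> sets (borelX X)"
    and ab: "inj_on (\<lambda>v. (a v, b v)) (P ` X)"
    and mab: "\<And>v. {x \<in> X. a (P x) = v} \<in> sets (borelX X)" "\<And>v. {x \<in> X. b (P x) = v} \<in> sets (borelX X)"
  shows "part_entropy \<mu> X P \<le> part_entropy \<mu> X (\<lambda>x. a (P x)) + part_entropy \<mu> X (\<lambda>x. b (P x))"
proof -
  interpret prob_space \<mu> using \<mu> by (simp add: probs_iff)
  define ma where "ma v = measure \<mu> {x \<in> X. a (P x) = v}" for v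
  define mb where "mb v = measure \<mu> {x \<in> X. b (P x) = v}" for v
  define p where "p v = measure \<mu> {x \<in> X. P x = v}" for v
  have finab: "finite ((\<lambda>x. a (P x)) ` X)" "finite ((\<lambda>x. b (P x)) ` X)"
    using finite_imageI[OF fin, of a] finite_imageI[OF fin, of b] by (simp_all add: image_image)
  have sets\<mu>: "sets \<mu> = sets (borelX X)" using \<mu> by (simp add: probs_iff)
  have pa: "p v \<le> ma (a v)" for v unfolding p_def ma_def using mab sets\<mu> by (intro finite_measure_mono) auto
  have pb: "p v \<le> mb (b v)" for v unfolding p_def mb_def using mab sets\<mu> by (intro finite_measure_mono) auto
  have "(\<Sum>v\<in>P ` X. ma (a v) * mb (b v)) = (\<Sum>(u,w)\<in>(\<lambda>v. (a v, b v)) ` P ` X. ma u * mb w)"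
    by (subst sum.reindex[OF ab]) simp
  also have "\<dots> \<le> (\<Sum>(u,w)\<in>((\<lambda>x. a (P x)) ` X) \<times> ((\<lambda>x. b (P x)) ` X). ma u * mb w)"
    using finab by (intro sum_mono2) (auto simp: ma_def mb_def)
  also have "\<dots> = (\<Sum>u\<in>(\<lambda>x. a (P x)) ` X. ma u) * (\<Sum>w\<in>(\<lambda>x. b (P x)) ` X. mb w)"
    by (simp add: sum_product sum.cartesian_product)
  also have "(\<Sum>u\<in>(\<lambda>x. a (P x)) ` X. ma u) = 1"
    unfolding ma_def by (rule sum_measure_level_sets[OF \<mu> finab(1) mab(1)])
  also have "(\<Sum>w\<in>(\<lambda>x. b (P x)) ` X. mb w) = 1"
    unfolding mb_def by (rule sum_measure_level_sets[OF \<mu> finab(2) mab(2)])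
  finally have q1: "(\<Sum>v\<in>P ` X. ma (a v) * mb (b v)) \<le> 1" by simp
  have "part_entropy \<mu> X P = - (\<Sum>v\<in>P ` X. p v * ln (p v))" by (simp add: part_entropy_def p_def)
  also have "\<dots> \<le> - (\<Sum>v\<in>P ` X. p v * ln (ma (a v) * mb (b v)))"
  proof (rule gibbs_inequality[OF fin])
    show "(\<Sum>v\<in>P ` X. ma (a v) * mb (b v)) \<le> (\<Sum>v\<in>P ` X. p v)"
      using q1 sum_measure_level_sets[OF \<mu> fin meas] by (simp add: p_def)
    show "0 < p v \<Longrightarrow> 0 < ma (a v) * mb (b v)" for v using pa[of v] pb[of v] by auto
  qed (auto simp: p_def ma_def mb_def)
  also have "\<dots> = - (\<Sum>v\<in>P ` X. p v * ln (ma (a v))) - (\<Sum>v\<in>P ` X. p v * ln (mb (b v)))"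
  proof -
    have "p v * ln (ma (a v) * mb (b v)) = p v * ln (ma (a v)) + p v * ln (mb (b v))" for v
    proof (cases "p v = 0")
      case False
      hence "p v > 0" by (simp add: p_def zero_less_measure_iff)
      hence "ma (a v) > 0" "mb (b v) > 0" using pa[of v] pb[of v] by auto
      thus ?thesis by (simp add: ln_mult algebra_simps)
    qed simp
    thus ?thesis by (simp add: sum.distrib)
  qed
  also have "(\<Sum>v\<in>P ` X. p v * ln (ma (a v))) = (\<integral>x. ln (ma (a (P x))) \<partial>\<mu>)"
    unfolding p_def by (rule integral_finite_valued(1)[OF \<mu> fin meas, of "\<lambda>v. ln (ma (a v))", symmetric])
  also have "(\<Sum>v\<in>P ` X. p v * ln (mb (b v))) = (\<integral>x. ln (mb (b (P x))) \<partial>\<mu>)"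
    unfolding p_def by (rule integral_finite_valued(1)[OF \<mu> fin meas, of "\<lambda>v. ln (mb (b v))", symmetric])
  finally show ?thesis
    unfolding part_entropy_integral[OF \<mu> finab(1) mab(1)] part_entropy_integral[OF \<mu> finab(2) mab(2)]
    by (simp add: ma_def mb_def)
qed

text \<open>Fekete's lemma: \<open>n\<close> is compared with multiples of an \<open>m\<close> whose
  ratio is close to the infimum \<open>l\<close>.\<close>

lemma subadditive_convergent:
  fixes a :: "nat \<Rightarrow> real"
  assumes sub: "\<And>m n. a (m + n) \<le> a m + a n" and nonneg: "\<And>n. 0 \<le> a n"
  shows "convergent (\<lambda>n. a n / n)"
proof -
  define l where "l = (INF n\<in>{1..}. a n / real n)"
  have bb: "bdd_below ((\<lambda>n. a n / real n) ` {1..})" by (rule bdd_belowI[of _ 0]) (auto simp: nonneg)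
  have lower: "l \<le> a n / n" if "n \<ge> 1" for n unfolding l_def using that by (intro cINF_lower bb) auto
  have mult: "a (q * m) \<le> real q * a m + a 0" for q m
  proof (induction q)
    case 0
    show ?case by simp
  next
    case (Suc q)
    have "a (Suc q * m) \<le> a m + a (q * m)" using sub[of m "q * m"] by simp
    thus ?case using Suc by (simp add: algebra_simps)
  qed
  have "(\<lambda>n. a n / n) \<longlonglongrightarrow> l"
  proof (rule LIMSEQ_I)
    fix e :: real assume e: "e > 0"
    have "l < l + e / 2" using e by simp
    then obtain m where m: "m \<ge> 1" "a m / m < l + e / 2"
      unfolding l_def by (subst (asm) cINF_less_iff[OF _ bb]) auto
    \<comment> \<open>\<open>C\<close> absorbs both the remainder \<open>a (n mod m)\<close> and the
      term \<open>a 0\<close> coming from \<open>mult\<close>, as \<open>a 0\<close> may be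
      positive.\<close>
    define C where "C = a 0 + (\<Sum>r<m. a r)"
    have C: "a 0 + a r \<le> C" if "r < m" for r
      unfolding C_def using that nonneg by (intro add_left_mono member_le_sum) auto
    obtain N where N: "real N * (e / 2) > C" using ex_less_of_nat_mult[of "e/2" C] e by auto
    show "\<exists>no. \<forall>n\<ge>no. norm (a n / n - l) < e"
    proof (intro exI[of _ "Suc N"] allI impI)
      fix n assume n: "n \<ge> Suc N"
      have "a n \<le> a (n div m * m) + a (n mod m)" using sub[of "n div m * m" "n mod m"] by simp
      also have "\<dots> \<le> real (n div m) * a m + C" using mult[of "n div m" m] C[of "n mod m"] m(1) by simp
      also have "real (n div m) * a m \<le> real n * (a m / m)"
      proof -
        have "real (n div m) \<le> real n / real m" using m(1)
          by (simp add: pos_le_divide_eq flip: of_nat_mult)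
        thus ?thesis using mult_right_mono[OF _ nonneg[of m], of "real (n div m)" "real n / real m"] by simp
      qed
      also have "real n * (a m / m) \<le> real n * (l + e / 2)" using m(2) by (intro mult_left_mono) auto
      also have "C < real n * (e / 2)"
        using N n e mult_right_mono[of "real N" "real n" "e/2"] by linarith
      finally have "a n < real n * (l + e)" by (simp add: algebra_simps)
      hence "a n / n < l + e" using n by (simp add: field_simps)
      thus "norm (a n / n - l) < e" using lower[of n] n by (simp add: abs_less_iff)
    qed
  qed
  thus ?thesis by (rule convergentI)
qed

section \<open>Names of orbits and the entropy of a partition under the map\<close>

lemma length_join_part [simp]: "length (join_part f \<xi> n x) = n"
  by (simp add: join_part_def)

lemma join_part_eq_iff: "join_part f \<xi> n x = join_part f \<xi> n y \<longleftrightarrow> (\<forall>i<n. \<xi> ((f ^^ i) x) = \<xi> ((f ^^ i) y))"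
  by (auto simp: join_part_def)

lemma join_part_add: "join_part f \<xi> (m + n) x = join_part f \<xi> m x @ join_part f \<xi> n ((f ^^ m) x)"
proof -
  have "[0..<m + n] = [0..<m] @ map (\<lambda>i. i + m) [0..<n]"
    by (simp add: upt_add_eq_append[of 0 m n] map_add_upt add.commute)
  thus ?thesis by (simp add: join_part_def funpow_add add.commute)
qed

context compact_system
begin

lemma join_part_measurable:
  assumes "\<xi> \<in> finite_partitions X"
  shows "{x \<in> X. join_part f \<xi> n x = v} \<in> sets (borelX X)"
proof (cases "length v = n")
  case True
  have [measurable]: "\<xi> \<in> borelX X \<rightarrow>\<^sub>M count_space UNIV" using assms by (simp add: finite_partitions_def)
  have "{x \<in> X. join_part f \<xi> n x = v} = {x \<in> space (borelX X). \<forall>i<n. \<xi> ((f ^^ i) x) = v ! i}"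
    using True by (auto simp: join_part_def list_eq_iff_nth_eq)
  also have "\<dots> \<in> sets (borelX X)" by measurable
  finally show ?thesis .
next
  case False
  hence e: "{x \<in> X. join_part f \<xi> n x = v} = {}" by auto
  show ?thesis unfolding e by simp
qed

lemma finite_join_part:
  assumes "\<xi> \<in> finite_partitions X"
  shows "finite (join_part f \<xi> n ` X)"
proof (rule finite_subset)
  show "join_part f \<xi> n ` X \<subseteq> {v. set v \<subseteq> \<xi> ` X \<and> length v = n}"
    by (auto simp: join_part_def funpow_in)
  show "finite {v. set v \<subseteq> \<xi> ` X \<and> length v = n}"
    using assms by (intro finite_lists_length_eq) (simp add: finite_partitions_def)
qed

lemma measure_invariant:
  assumes \<nu>: "\<nu> \<in> Minv X f" and A: "A \<in> sets (borelX X)"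
  shows "measure \<nu> ((f ^^ i) -` A \<inter> X) = measure \<nu> A"
proof -
  have p: "\<nu> \<in> probs X" using \<nu> by (simp add: Minv_def)
  have s: "sets \<nu> = sets (borelX X)" using p by (simp add: probs_iff)
  have "integral\<^sup>L \<nu> (\<lambda>x. indicator A ((f ^^ i) x) :: real) = integral\<^sup>L \<nu> (indicator A)"
    using A by (intro integral_invariant[OF \<nu>]) simp
  also have "\<dots> = measure \<nu> A" using A s sets.sets_into_space[of A \<nu>] by (simp add: Int_absorb2)
  also have "integral\<^sup>L \<nu> (\<lambda>x. indicator A ((f ^^ i) x) :: real) = integral\<^sup>L \<nu> (indicator ((f ^^ i) -` A \<inter> X))"
    using space_probs[OF p] by (intro Bochner_Integration.integral_cong) (auto simp: indicator_def)
  also have "\<dots> = measure \<nu> ((f ^^ i) -` A \<inter> X)"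
    using space_probs[OF p] by simp
  finally show ?thesis .
qed

text \<open>Cells of the shifted name are preimages of cells and so have the same mass. The two sums
  may run over different index sets when \<open>f\<close> is not onto; a name that the shift misses
  has mass 0 by invariance.\<close>

lemma part_entropy_shift:
  assumes \<nu>: "\<nu> \<in> Minv X f" and \<xi>: "\<xi> \<in> finite_partitions X"
  shows "part_entropy \<nu> X (\<lambda>x. join_part f \<xi> n ((f ^^ m) x)) = part_entropy \<nu> X (join_part f \<xi> n)"
proof -
  let ?J = "join_part f \<xi> n"
  have p: "\<nu> \<in> probs X" using \<nu> by (simp add: Minv_def)
  interpret prob_space \<nu> using p by (simp add: probs_iff)
  have eq: "measure \<nu> {x \<in> X. ?J ((f ^^ m) x) = v} = measure \<nu> {x \<in> X. ?J x = v}" for v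
  proof -
    have "{x \<in> X. ?J ((f ^^ m) x) = v} = (f ^^ m) -` {x \<in> X. ?J x = v} \<inter> X" by (auto simp: funpow_in)
    thus ?thesis using measure_invariant[OF \<nu> join_part_measurable[OF \<xi>]] by simp
  qed
  have "(\<Sum>v\<in>(\<lambda>x. ?J ((f ^^ m) x)) ` X. measure \<nu> {x \<in> X. ?J x = v} * ln (measure \<nu> {x \<in> X. ?J x = v}))
     = (\<Sum>v\<in>?J ` X. measure \<nu> {x \<in> X. ?J x = v} * ln (measure \<nu> {x \<in> X. ?J x = v}))"
  proof (rule sum.mono_neutral_left)
    show "finite (?J ` X)" by (rule finite_join_part[OF \<xi>])
    show "(\<lambda>x. ?J ((f ^^ m) x)) ` X \<subseteq> ?J ` X" by (auto simp: funpow_in)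
    show "\<forall>v\<in>?J ` X - (\<lambda>x. ?J ((f ^^ m) x)) ` X. measure \<nu> {x \<in> X. ?J x = v} * ln (measure \<nu> {x \<in> X. ?J x = v}) = 0"
    proof
      fix v assume "v \<in> ?J ` X - (\<lambda>x. ?J ((f ^^ m) x)) ` X"
      hence e: "{x \<in> X. ?J ((f ^^ m) x) = v} = {}" by blast
      have "measure \<nu> {x \<in> X. ?J x = v} = 0" unfolding eq[of v, symmetric] e by simp
      thus "measure \<nu> {x \<in> X. ?J x = v} * ln (measure \<nu> {x \<in> X. ?J x = v}) = 0" by simp
    qed
  qed
  thus ?thesis unfolding part_entropy_def eq by simp
qed

text \<open>A name of length \<open>m + n\<close> is the pair of its first \<open>m\<close> and its
  last \<open>n\<close> letters, and the latter form a shifted name, of the same entropy as the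
  unshifted one.\<close>

lemma part_entropy_subadditive:
  assumes \<nu>: "\<nu> \<in> Minv X f" and \<xi>: "\<xi> \<in> finite_partitions X"
  shows "part_entropy \<nu> X (join_part f \<xi> (m + n)) \<le> part_entropy \<nu> X (join_part f \<xi> m) + part_entropy \<nu> X (join_part f \<xi> n)"
proof -
  have p: "\<nu> \<in> probs X" using \<nu> by (simp add: Minv_def)
  have t: "take m (join_part f \<xi> (m + n) x) = join_part f \<xi> m x"
    and d: "drop m (join_part f \<xi> (m + n) x) = join_part f \<xi> n ((f ^^ m) x)" for x
    by (simp_all add: join_part_add)
  have "part_entropy \<nu> X (join_part f \<xi> (m + n)) \<le>
     part_entropy \<nu> X (\<lambda>x. take m (join_part f \<xi> (m + n) x)) + part_entropy \<nu> X (\<lambda>x. drop m (join_part f \<xi> (m + n) x))"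
  proof (rule part_entropy_join_le[OF p finite_join_part[OF \<xi>] join_part_measurable[OF \<xi>]])
    show "inj_on (\<lambda>v. (take m v, drop m v)) (join_part f \<xi> (m + n) ` X)"
      by (rule inj_onI) (metis append_take_drop_id prod.inject)
    show "{x \<in> X. take m (join_part f \<xi> (m + n) x) = v} \<in> sets (borelX X)" for v
      unfolding t by (rule join_part_measurable[OF \<xi>])
    show "{x \<in> X. drop m (join_part f \<xi> (m + n) x) = v} \<in> sets (borelX X)" for v
    proof -
      have "{x \<in> X. join_part f \<xi> n ((f ^^ m) x) = v} = (f ^^ m) -` {x \<in> X. join_part f \<xi> n x = v} \<inter> space (borelX X)"
        by (auto simp: funpow_in)
      thus ?thesis unfolding d using measurable_sets[OF measurable_funpow join_part_measurable[OF \<xi>]] by simp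
    qed
  qed
  thus ?thesis unfolding t d part_entropy_shift[OF \<nu> \<xi>] .
qed

lemma ent_part_LIMSEQ:
  assumes \<nu>: "\<nu> \<in> Minv X f" and \<xi>: "\<xi> \<in> finite_partitions X"
  shows "(\<lambda>n. part_entropy \<nu> X (join_part f \<xi> n) / real n) \<longlonglongrightarrow> ent_part \<nu> X f \<xi>"
proof -
  have p: "\<nu> \<in> probs X" using \<nu> by (simp add: Minv_def)
  have "convergent (\<lambda>n. part_entropy \<nu> X (join_part f \<xi> n) / real n)"
    by (intro subadditive_convergent part_entropy_subadditive[OF \<nu> \<xi>] part_entropy_nonneg[OF p])
  thus ?thesis unfolding ent_part_def convergent_LIMSEQ_iff .
qed

lemma ent_part_nonneg:
  assumes "\<nu> \<in> Minv X f" "\<xi> \<in> finite_partitions X"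
  shows "0 \<le> ent_part \<nu> X f \<xi>"
proof (rule LIMSEQ_le_const[OF ent_part_LIMSEQ[OF assms]])
  have "\<nu> \<in> probs X" using assms by (simp add: Minv_def)
  thus "\<exists>N. \<forall>n\<ge>N. 0 \<le> part_entropy \<nu> X (join_part f \<xi> n) / real n" by (auto simp: part_entropy_nonneg)
qed

lemma ms_entropy_nonneg:
  assumes "\<nu> \<in> Minv X f"
  shows "0 \<le> ms_entropy X f \<nu>"
proof -
  have c: "(\<lambda>_. 0) \<in> finite_partitions X" by (auto simp: finite_partitions_def intro: finite_subset[of _ "{0}"])
  hence "ereal (ent_part \<nu> X f (\<lambda>_. 0)) \<le> ms_entropy X f \<nu>" unfolding ms_entropy_def by (rule SUP_upper)
  moreover have "0 \<le> ereal (ent_part \<nu> X f (\<lambda>_. 0))" using ent_part_nonneg[OF assms c] by simp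
  ultimately show ?thesis by (rule order_trans[rotated])
qed

end

section \<open>The upper bound\<close>

definition words :: "nat \<Rightarrow> nat \<Rightarrow> nat list set" where
  "words K L = {v. set v \<subseteq> {..<K} \<and> length v = L}"

lemma finite_words: "finite (words K L)"
  unfolding words_def by (intro finite_lists_length_eq) simp

text \<open>Kraft-type counting: the products of weights add up to a power of the sum of
  \<open>Q\<close>, hence to at most 1, so at most \<open>1 / c\<close> of them reach
  \<open>c\<close>.\<close>

lemma card_word_tuples_le:
  fixes Q :: "'b \<Rightarrow> real"
  assumes "finite A" "\<And>v. v \<in> A \<Longrightarrow> Q v \<ge> 0" "(\<Sum>v\<in>A. Q v) \<le> 1" "c > 0"
  shows "real (card {b \<in> PiE {..<m::nat} (\<lambda>_. A). c \<le> (\<Prod>l<m. Q (b l))}) \<le> 1 / c"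
proof -
  let ?P = "PiE {..<m} (\<lambda>_. A)"
  let ?B = "{b \<in> ?P. c \<le> (\<Prod>l<m. Q (b l))}"
  have fin: "finite ?P" using assms(1) by (intro finite_PiE) auto
  have nn: "0 \<le> (\<Prod>l<m. Q (b l))" if "b \<in> ?P" for b
    using that assms(2) by (intro prod_nonneg) (auto simp: PiE_iff)
  have "real (card ?B) * c = (\<Sum>b\<in>?B. c)" by simp
  also have "\<dots> \<le> (\<Sum>b\<in>?B. \<Prod>l<m. Q (b l))" by (intro sum_mono) simp
  also have "\<dots> \<le> (\<Sum>b\<in>?P. \<Prod>l<m. Q (b l))" using fin nn by (intro sum_mono2) auto
  also have "\<dots> = (\<Prod>l<m. \<Sum>v\<in>A. Q v)" using assms(1) by (intro prod_sum_PiE[symmetric]) auto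
  also have "\<dots> \<le> 1" using assms(2,3) by (simp add: power_le_one sum_nonneg)
  finally show ?thesis using assms(4) by (simp add: field_simps)
qed

text \<open>Averaging over the residues of the starting position modulo \<open>L\<close> passes from overlapping to
  consecutive blocks of length \<open>L\<close>.\<close>

lemma exists_good_offset:
  fixes g :: "nat \<Rightarrow> real"
  assumes "L > 0" "\<And>i. g i \<ge> 0" "(\<Sum>i<n. g i) < real L * c"
  shows "\<exists>j<L. (\<Sum>l<n div L. g (j + l * L)) < c"
proof (rule ccontr)
  assume "\<not> ?thesis"
  hence "\<And>j. j < L \<Longrightarrow> c \<le> (\<Sum>l<n div L. g (j + l * L))" by (meson not_less)
  hence "(\<Sum>j<L. c) \<le> (\<Sum>j<L. \<Sum>l<n div L. g (j + l * L))" by (intro sum_mono) simp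
  also have "\<dots> = (\<Sum>l<n div L. \<Sum>j<L. g (j + l * L))" by (rule sum.swap)
  also have "\<dots> = (\<Sum>l<n div L. sum g {l * L..<l * L + L})"
  proof (rule sum.cong)
    fix l show "(\<Sum>j<L. g (j + l * L)) = sum g {l * L..<l * L + L}"
      using sum.shift_bounds_nat_ivl[of g 0 "l * L" L] by (simp add: lessThan_atLeast0 add.commute)
  qed simp
  also have "\<dots> = sum g {..<n div L * L}" by (rule sum.nat_group)
  also have "\<dots> \<le> sum g {..<n}" using assms(2) by (intro sum_mono2) auto
  finally show False using assms(3) by simp
qed

context compact_system
begin

text \<open>The ideal length, in natural units, of a code word for the first \<open>L\<close>
  letters of the name when words are weighted by \<open>Q\<close>.\<close>

definition code_cost :: "('a \<Rightarrow> nat) \<Rightarrow> nat \<Rightarrow> (nat list \<Rightarrow> real) \<Rightarrow> 'a \<Rightarrow> real" where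
  "code_cost \<xi> L Q x = - ln (Q (join_part f \<xi> L x))"

lemma join_part_in_words:
  assumes "\<And>x. x \<in> X \<Longrightarrow> \<xi> x < K" "x \<in> X"
  shows "join_part f \<xi> L x \<in> words K L"
  using assms funpow_in by (auto simp: words_def join_part_def)

text \<open>After a good offset the orbit splits into \<open>m\<close> aligned blocks of total code
  length below \<open>n * s\<close>, and at most \<open>exp (n * s)\<close> such block sequences
  exist. The offset and two further blocks account for the remaining factor.\<close>

lemma bowen_ball_cover_low_cost:
  assumes \<xi>: "\<And>x. x \<in> X \<Longrightarrow> \<xi> x < K" and diam: "\<And>x y. x \<in> X \<Longrightarrow> y \<in> X \<Longrightarrow> \<xi> x = \<xi> y \<Longrightarrow> dist x y < \<epsilon>"
    and L: "L > 0" and Q: "\<And>v. v \<in> words K L \<Longrightarrow> Q v > 0" "(\<Sum>v\<in>words K L. Q v) \<le> (1::real)"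
  shows "\<exists>C. finite C \<and> C \<subseteq> X \<and> real (card C) \<le> real L * (real (card (words K L)))\<^sup>2 * exp (real n * s) \<and>
     {x \<in> X. (\<Sum>i<n. code_cost \<xi> L Q ((f ^^ i) x)) < real L * (real n * s)} \<subseteq> (\<Union>x\<in>C. bowen_ball X f x n \<epsilon>)"
proof -
  let ?A = "words K L"
  define Z where "Z = {x \<in> X. (\<Sum>i<n. code_cost \<xi> L Q ((f ^^ i) x)) < real L * (real n * s)}"
  define m where "m = n div L"
  have jA: "join_part f \<xi> L x \<in> ?A" if "x \<in> X" for x using join_part_in_words[OF \<xi> that] .
  have Q1: "Q v \<le> 1" if "v \<in> ?A" for v
    using member_le_sum[OF that _ finite_words, of Q] Q less_imp_le by (metis (no_types, lifting) DiffD1 order_trans)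
  have nonneg: "code_cost \<xi> L Q x \<ge> 0" if "x \<in> X" for x
    using Q1[OF jA[OF that]] Q(1)[OF jA[OF that]] by (simp add: code_cost_def ln_le_zero_iff)
  have "\<exists>j<L. (\<Sum>l<m. code_cost \<xi> L Q ((f ^^ (j + l * L)) x)) < real n * s" if "x \<in> Z" for x
    unfolding m_def by (rule exists_good_offset[OF L]) (use that nonneg funpow_in in \<open>auto simp: Z_def\<close>)
  then obtain J where J: "\<And>x. x \<in> Z \<Longrightarrow> J x < L"
      "\<And>x. x \<in> Z \<Longrightarrow> (\<Sum>l<m. code_cost \<xi> L Q ((f ^^ (J x + l * L)) x)) < real n * s" by metis
  define blocks where "blocks x = restrict (\<lambda>l. join_part f \<xi> L ((f ^^ (J x + l * L)) x)) {..<m}" for x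
  \<comment> \<open>The first block fills the times before the offset, and the block at time
    \<open>m * L\<close> fills the fewer than \<open>L\<close> final times, so equal codes mean
    equal names up to time \<open>n\<close>.\<close>
  define code where "code x = (J x, join_part f \<xi> L x, join_part f \<xi> L ((f ^^ (m * L)) x), blocks x)" for x
  define B where "B = {b \<in> PiE {..<m} (\<lambda>_. ?A). exp (- (real n * s)) \<le> (\<Prod>l<m. Q (b l))}"
  have finB: "finite B" unfolding B_def by (intro finite_subset[OF _ finite_PiE[of "{..<m}" "\<lambda>_. ?A"]]) (auto simp: finite_words)
  have cardB: "real (card B) \<le> exp (real n * s)"
    using card_word_tuples_le[OF finite_words, of K L Q "exp (- (real n * s))" m] Q less_imp_le
    by (auto simp: B_def exp_minus field_simps)
  have blocksB: "blocks x \<in> B" if x: "x \<in> Z" for x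
  proof -
    have xX: "x \<in> X" using x by (simp add: Z_def)
    have pos: "Q (join_part f \<xi> L ((f ^^ (J x + l * L)) x)) > 0" for l using Q(1) jA funpow_in[OF xX] by blast
    have "ln (\<Prod>l<m. Q (blocks x l)) = (\<Sum>l<m. ln (Q (join_part f \<xi> L ((f ^^ (J x + l * L)) x))))"
      using pos[THEN less_imp_neq] by (subst ln_prod) (auto simp: blocks_def pos)
    also have "\<dots> > - (real n * s)" using J(2)[OF x] by (simp add: code_cost_def sum_negf)
    finally have "- (real n * s) < ln (\<Prod>l<m. Q (blocks x l))" .
    moreover have "(\<Prod>l<m. Q (blocks x l)) > 0" using pos by (intro prod_pos) (auto simp: blocks_def)
    ultimately have "exp (- (real n * s)) \<le> (\<Prod>l<m. Q (blocks x l))" by (metis exp_le_cancel_iff exp_ln less_imp_le)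
    thus ?thesis using jA funpow_in[OF xX] by (auto simp: B_def blocks_def)
  qed
  have codeT: "code ` Z \<subseteq> {..<L} \<times> ?A \<times> ?A \<times> B"
    using J(1) blocksB jA funpow_in by (auto simp: code_def Z_def)
  have finT: "finite ({..<L} \<times> ?A \<times> ?A \<times> B)" using finB finite_words by auto
  have same: "dist ((f ^^ i) x) ((f ^^ i) y) < \<epsilon>" if xy: "x \<in> Z" "y \<in> Z" "code x = code y" and i: "i < n" for x y i
  proof -
    have X: "x \<in> X" "y \<in> X" using xy by (auto simp: Z_def)
    have c: "J x = J y" "join_part f \<xi> L x = join_part f \<xi> L y"
      "join_part f \<xi> L ((f ^^ (m * L)) x) = join_part f \<xi> L ((f ^^ (m * L)) y)" "blocks x = blocks y"
      using xy(3) by (auto simp: code_def)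
    have "\<xi> ((f ^^ i) x) = \<xi> ((f ^^ i) y)"
    proof -
      consider "i < J x" | "J x \<le> i" "i < m * L" | "m * L \<le> i" by linarith
      thus ?thesis
      proof cases
        case 1
        thus ?thesis using c(2) J(1)[OF xy(1)] by (simp add: join_part_eq_iff)
      next
        case 2
        define l where "l = (i - J x) div L"
        define t where "t = (i - J x) mod L"
        have it: "i = t + (J x + l * L)" "t < L" using 2(1) L by (auto simp: l_def t_def)
        have "l * L < m * L" using it 2 by linarith
        hence "l < m" by simp
        hence "join_part f \<xi> L ((f ^^ (J x + l * L)) x) = join_part f \<xi> L ((f ^^ (J x + l * L)) y)"
          using fun_cong[OF c(4), of l] c(1) by (simp add: blocks_def)
        hence "\<xi> ((f ^^ t) ((f ^^ (J x + l * L)) x)) = \<xi> ((f ^^ t) ((f ^^ (J x + l * L)) y))"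
          using it(2) by (simp add: join_part_eq_iff)
        thus ?thesis unfolding it(1) funpow_add[of t] comp_def .
      next
        case 3
        have it: "i = (i - m * L) + m * L" "i - m * L < L"
        proof -
          have "n < m * L + L" using L unfolding m_def by (metis add.commute div_mult_mod_eq mod_less_divisor nat_add_left_cancel_less)
          thus "i - m * L < L" using 3 i by linarith
        qed (use 3 in simp)
        have "\<xi> ((f ^^ (i - m * L)) ((f ^^ (m * L)) x)) = \<xi> ((f ^^ (i - m * L)) ((f ^^ (m * L)) y))"
          using it(2) c(3) by (simp add: join_part_eq_iff)
        thus ?thesis by (subst (1 2) it(1)) (simp only: funpow_add comp_def)
      qed
    qed
    thus ?thesis using diam funpow_in X by blast
  qed
  define C where "C = inv_into Z code ` code ` Z"
  have finC: "finite (code ` Z)" using codeT finT by (rule finite_subset)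
  have "C \<subseteq> Z" unfolding C_def by (auto intro: inv_into_into)
  have "card C \<le> card (code ` Z)" unfolding C_def using finC by (rule card_image_le)
  also have "\<dots> \<le> card ({..<L} \<times> ?A \<times> ?A \<times> B)" using codeT finT by (intro card_mono)
  also have "\<dots> = L * (card ?A)\<^sup>2 * card B" by (simp add: card_cartesian_product power2_eq_square)
  finally have "real (card C) \<le> real L * (real (card ?A))\<^sup>2 * real (card B)"
    by (metis of_nat_le_iff of_nat_mult of_nat_power)
  also have "\<dots> \<le> real L * (real (card ?A))\<^sup>2 * exp (real n * s)" using cardB by (intro mult_left_mono) auto
  finally have "real (card C) \<le> real L * (real (card ?A))\<^sup>2 * exp (real n * s)" .
  moreover have "Z \<subseteq> (\<Union>x\<in>C. bowen_ball X f x n \<epsilon>)"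
  proof
    fix x assume x: "x \<in> Z"
    define y where "y = inv_into Z code (code x)"
    have y: "y \<in> C" "y \<in> Z" "code y = code x"
      using x unfolding C_def y_def by (auto intro: inv_into_into f_inv_into_f)
    have "x \<in> bowen_ball X f y n \<epsilon>" using same[OF y(2) x y(3)] x by (auto simp: bowen_ball_def Z_def)
    thus "x \<in> (\<Union>x\<in>C. bowen_ball X f x n \<epsilon>)" using y(1) by blast
  qed
  moreover have "finite C" unfolding C_def using finC by simp
  moreover have "C \<subseteq> X" using \<open>C \<subseteq> Z\<close> by (auto simp: Z_def)
  ultimately show ?thesis unfolding Z_def by blast
qed

text \<open>A Borel-Cantelli cover: every point lies in \<open>Z n\<close> for some
  \<open>n \<ge> N\<close>, so the covers of all these \<open>Z n\<close> are united. Their weights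
  are at most \<open>D * r ^ n\<close> with \<open>r = exp (s - s') < 1\<close>, and the tail of
  this geometric series vanishes as \<open>N\<close> grows.\<close>

lemma bowen_m_low_cost_eq_0:
  assumes \<xi>: "\<And>x. x \<in> X \<Longrightarrow> \<xi> x < K" and diam: "\<And>x y. x \<in> X \<Longrightarrow> y \<in> X \<Longrightarrow> \<xi> x = \<xi> y \<Longrightarrow> dist x y < \<epsilon>"
    and L: "L > 0" and Q: "\<And>v. v \<in> words K L \<Longrightarrow> Q v > 0" "(\<Sum>v\<in>words K L. Q v) \<le> (1::real)"
    and s: "s < s'"
  shows "bowen_m X f {x \<in> X. \<forall>N. \<exists>n\<ge>N. (\<Sum>i<n. code_cost \<xi> L Q ((f ^^ i) x)) < real L * (real n * s)} s' \<epsilon> = 0"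
proof -
  define Z where "Z n = {x \<in> X. (\<Sum>i<n. code_cost \<xi> L Q ((f ^^ i) x)) < real L * (real n * s)}" for n
  define D where "D = real L * (real (card (words K L)))\<^sup>2"
  define r where "r = exp (s - s')"
  have D: "D \<ge> 0" by (simp add: D_def)
  have r: "0 < r" "r < 1" using s by (simp_all add: r_def)
  let ?Z = "{x \<in> X. \<forall>N. \<exists>n\<ge>N. (\<Sum>i<n. code_cost \<xi> L Q ((f ^^ i) x)) < real L * (real n * s)}"
  define R where "R n C \<longleftrightarrow> finite C \<and> C \<subseteq> X \<and> real (card C) \<le> D * exp (real n * s) \<and>
      Z n \<subseteq> (\<Union>x\<in>C. bowen_ball X f x n \<epsilon>)" for n C
  have "\<exists>C. R n C" for n
    unfolding R_def Z_def D_def by (rule bowen_ball_cover_low_cost[of \<xi> K \<epsilon> L Q n s, OF \<xi> diam L Q])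
  then obtain C where "\<And>n. R n (C n)" by metis
  hence C: "\<And>n. finite (C n)" "\<And>n. C n \<subseteq> X" "\<And>n. real (card (C n)) \<le> D * exp (real n * s)"
      "\<And>n. Z n \<subseteq> (\<Union>x\<in>C n. bowen_ball X f x n \<epsilon>)" unfolding R_def by blast+
  have bound: "bowen_mN X f ?Z s' N \<epsilon> \<le> ennreal (D * r ^ N / (1 - r))" for N
  proof -
    define E where "E k = C (N + k) \<times> {N + k}" for k
    have cov: "(\<Union>k. E k) \<in> bowen_covers X f ?Z \<epsilon> N"
      unfolding bowen_covers_def
    proof (intro CollectI conjI subsetI)
      show "countable (\<Union>k. E k)" using C(1) unfolding E_def by (intro countable_UN countable_SIGMA) (auto intro: countable_finite)
      show "\<forall>(x, n)\<in>\<Union>k. E k. x \<in> X \<and> N \<le> n" using C(2) by (auto simp: E_def)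
      fix x assume "x \<in> ?Z"
      then obtain n where n: "n \<ge> N" "x \<in> Z n" unfolding Z_def by blast
      then obtain c where c: "c \<in> C n" "x \<in> bowen_ball X f c n \<epsilon>" using C(4) by blast
      have "(c, n) \<in> E (n - N)" using n c by (simp add: E_def)
      thus "x \<in> (\<Union>(x, n)\<in>\<Union>k. E k. bowen_ball X f x n \<epsilon>)" using c(2) by blast
    qed
    have summand: "(\<integral>\<^sup>+ p. ennreal (exp (- real (snd p) * s')) \<partial>count_space (E k)) \<le> ennreal (D * r ^ N * r ^ k)" for k
    proof -
      have "(\<integral>\<^sup>+ p. ennreal (exp (- real (snd p) * s')) \<partial>count_space (E k)) = (\<Sum>p\<in>E k. ennreal (exp (- real (snd p) * s')))"
        using C(1) by (intro nn_integral_count_space_finite) (simp add: E_def)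
      also have "\<dots> = (\<Sum>p\<in>E k. ennreal (exp (- real (N + k) * s')))" by (intro sum.cong) (auto simp: E_def algebra_simps)
      also have "\<dots> = ennreal (real (card (C (N + k))) * exp (- real (N + k) * s'))"
        by (simp add: E_def card_cartesian_product ennreal_mult' ennreal_of_nat_eq_real_of_nat del: of_nat_add)
      also have "\<dots> \<le> ennreal (D * exp (real (N + k) * s) * exp (- real (N + k) * s'))"
        using C(3)[of "N + k"] by (intro ennreal_leI mult_right_mono) auto
      also have "D * exp (real (N + k) * s) * exp (- real (N + k) * s') = D * r ^ (N + k)"
        unfolding r_def by (simp add: exp_of_nat_mult[symmetric] right_diff_distrib mult.assoc flip: exp_add del: of_nat_add)
      finally show ?thesis by (simp add: power_add mult.assoc)
    qed
    have "bowen_mN X f ?Z s' N \<epsilon> \<le> (\<integral>\<^sup>+ p. ennreal (exp (- real (snd p) * s')) \<partial>count_space (\<Union>k. E k))"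
      by (rule bowen_mN_le[OF cov])
    also have "\<dots> \<le> (\<Sum>k. \<integral>\<^sup>+ p. ennreal (exp (- real (snd p) * s')) \<partial>count_space (E k))"
      by (rule nn_integral_count_space_UN_le)
    also have "\<dots> \<le> (\<Sum>k. ennreal (D * r ^ N * r ^ k))" by (intro suminf_le summand) auto
    also have "\<dots> = ennreal (D * r ^ N / (1 - r))"
    proof -
      have "(\<lambda>k. D * r ^ N * r ^ k) sums (D * r ^ N * (1 / (1 - r)))"
        using r by (intro sums_mult geometric_sums) auto
      thus ?thesis using r D by (subst suminf_ennreal_eq) auto
    qed
    finally show ?thesis .
  qed
  have "bowen_mN X f ?Z s' N \<epsilon> = 0" for N
  proof -
    have lim: "(\<lambda>M. ennreal (D * r ^ M / (1 - r))) \<longlonglongrightarrow> ennreal (D * 0 / (1 - r))"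
      using r by (intro tendsto_ennrealI tendsto_intros LIMSEQ_realpow_zero) auto
    have "bowen_mN X f ?Z s' N \<epsilon> \<le> ennreal (D * 0 / (1 - r))"
    proof (rule LIMSEQ_le_const[OF lim], intro exI allI impI)
      fix M assume "N \<le> M"
      hence "bowen_mN X f ?Z s' N \<epsilon> \<le> bowen_mN X f ?Z s' M \<epsilon>" by (rule incseqD[OF incseq_bowen_mN])
      also have "\<dots> \<le> ennreal (D * r ^ M / (1 - r))" by (rule bound)
      finally show "bowen_mN X f ?Z s' N \<epsilon> \<le> ennreal (D * r ^ M / (1 - r))" .
    qed
    thus ?thesis by simp
  qed
  thus ?thesis unfolding bowen_m_eq_0_iff by blast
qed

end

text \<open>Makes a ball cover disjoint. The label depends only on which of the \<open>k\<close>
  inequalities hold, so away from the spheres it survives small changes of both the point and the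
  radius.\<close>

definition ball_label :: "(nat \<Rightarrow> 'a::metric_space) \<Rightarrow> nat \<Rightarrow> real \<Rightarrow> 'a \<Rightarrow> nat" where
  "ball_label c k r x = (LEAST i. i < k \<and> dist (c i) x < r)"

lemma ball_label:
  assumes "\<exists>i<k. dist (c i) x < r"
  shows "ball_label c k r x < k" "dist (c (ball_label c k r x)) x < r"
  using LeastI_ex[of "\<lambda>i. i < k \<and> dist (c i) x < r"] assms unfolding ball_label_def by auto

lemma ball_label_eq_iff:
  assumes "\<exists>i<k. dist (c i) x < r"
  shows "ball_label c k r x = j \<longleftrightarrow> j < k \<and> dist (c j) x < r \<and> (\<forall>i<j. \<not> dist (c i) x < r)"
proof
  assume j: "ball_label c k r x = j"
  show "j < k \<and> dist (c j) x < r \<and> (\<forall>i<j. \<not> dist (c i) x < r)"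
    using ball_label[OF assms] not_less_Least[of _ "\<lambda>i. i < k \<and> dist (c i) x < r"] j
    unfolding ball_label_def by (meson less_trans)
next
  assume j: "j < k \<and> dist (c j) x < r \<and> (\<forall>i<j. \<not> dist (c i) x < r)"
  show "ball_label c k r x = j" unfolding ball_label_def
    by (rule Least_equality) (use j in \<open>auto simp: not_less[symmetric]\<close>)
qed

lemma ball_label_cong:
  assumes "\<And>i. i < k \<Longrightarrow> dist (c i) x < r \<longleftrightarrow> dist (c i) y < r'"
  shows "ball_label c k r x = ball_label c k r' y"
  unfolding ball_label_def using assms by (intro arg_cong[where f = Least] ext) auto

lemma ball_label_diam:
  assumes "\<exists>i<k. dist (c i) x < r" "\<exists>i<k. dist (c i) y < r" "ball_label c k r x = ball_label c k r y"
  shows "dist x y < 2 * r"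
proof -
  have "dist x (c (ball_label c k r x)) < r" "dist y (c (ball_label c k r x)) < r"
    using ball_label(2)[OF assms(1)] ball_label(2)[OF assms(2)] unfolding assms(3) by (simp_all add: dist_commute)
  from dist_triangle_less_add[OF this] show ?thesis by simp
qed

text \<open>Mixing with the uniform weights makes all weights positive at the price of a factor
  \<open>exp (- t)\<close>; a second such factor leaves room for rationals below the mixture, so
  that the sum stays at most 1. The cost rises by at most \<open>2 * t\<close>, half the available
  slack.\<close>

lemma exists_rational_code:
  fixes p :: "'b \<Rightarrow> real"
  assumes fin: "finite A" and p: "\<And>v. v \<in> A \<Longrightarrow> p v \<ge> 0" "(\<Sum>v\<in>A. p v) = 1" and h: "- (\<Sum>v\<in>A. p v * ln (p v)) < h"
  obtains Q where "Q \<in> PiE A (\<lambda>_. \<rat>)" "\<And>v. v \<in> A \<Longrightarrow> Q v > 0" "(\<Sum>v\<in>A. Q v) \<le> 1" "- (\<Sum>v\<in>A. p v * ln (Q v)) < h"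
proof -
  have ne: "A \<noteq> {}" using p(2) by auto
  define D where "D = real (card A)"
  have D: "D > 0" using ne fin by (simp add: D_def card_gt_0_iff)
  define t where "t = (h + (\<Sum>v\<in>A. p v * ln (p v))) / 4"
  have t: "t > 0" using h by (simp add: t_def)
  define q where "q v = exp (- t) * p v + (1 - exp (- t)) / D" for v
  have q: "q v > 0" if "v \<in> A" for v
    unfolding q_def using p(1)[OF that] t D by (intro add_nonneg_pos mult_nonneg_nonneg divide_pos_pos) auto
  have sq: "(\<Sum>v\<in>A. q v) = 1"
  proof -
    have "(\<Sum>v\<in>A. q v) = exp (- t) * (\<Sum>v\<in>A. p v) + D * ((1 - exp (- t)) / D)"
      by (simp add: q_def sum.distrib sum_distrib_left D_def)
    thus ?thesis using D by (simp add: p(2))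
  qed
  have "\<exists>r\<in>\<rat>. exp (- t) * q v < r \<and> r < q v" if "v \<in> A" for v
    by (rule Rats_dense_in_real) (use q[OF that] t in simp)
  then obtain Q0 where Q0: "\<And>v. v \<in> A \<Longrightarrow> Q0 v \<in> \<rat>" "\<And>v. v \<in> A \<Longrightarrow> exp (- t) * q v < Q0 v" "\<And>v. v \<in> A \<Longrightarrow> Q0 v < q v"
    by metis
  \<comment> \<open>Restriction makes the code extensional, so that all codes together form a
    countable product of copies of the rationals.\<close>
  define Q where "Q = restrict Q0 A"
  have Qpos: "Q v > 0" if "v \<in> A" for v
    using Q0(2)[OF that] q[OF that] that order_less_trans[of 0 "exp (- t) * q v" "Q v"] by (simp add: Q_def)
  show ?thesis
  proof (rule that[of Q])
    show "Q \<in> PiE A (\<lambda>_. \<rat>)" using Q0(1) by (auto simp: Q_def)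
    show "(\<Sum>v\<in>A. Q v) \<le> 1" unfolding sq[symmetric] using Q0(3) by (intro sum_mono) (auto simp: Q_def less_imp_le)
    have "- (p v * ln (Q v)) \<le> - (p v * ln (p v)) + 2 * t * p v" if v: "v \<in> A" for v
    proof (cases "p v = 0")
      case False
      hence pv: "p v > 0" using p(1)[OF v] by simp
      have "exp (- (2 * t)) * p v = exp (- t) * (exp (- t) * p v)" by (simp add: exp_add[symmetric] mult.assoc[symmetric])
      also have "\<dots> \<le> exp (- t) * q v" unfolding q_def using t D by (intro mult_left_mono) auto
      also have "\<dots> \<le> Q v" using Q0(2)[OF v] v by (simp add: Q_def)
      finally have "ln (exp (- (2 * t)) * p v) \<le> ln (Q v)" using pv by (subst ln_le_cancel_iff) (auto simp: Qpos[OF v])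
      hence "- (2 * t) + ln (p v) \<le> ln (Q v)" using pv by (simp add: ln_mult)
      hence "p v * (- (2 * t) + ln (p v)) \<le> p v * ln (Q v)" using pv by (intro mult_left_mono) auto
      thus ?thesis by (simp add: algebra_simps)
    qed simp
    hence "(\<Sum>v\<in>A. - (p v * ln (Q v))) \<le> (\<Sum>v\<in>A. - (p v * ln (p v)) + 2 * t * p v)" by (rule sum_mono)
    also have "\<dots> = - (\<Sum>v\<in>A. p v * ln (p v)) + 2 * t" unfolding sum.distrib sum_negf sum_distrib_left[symmetric] p(2) by simp
    also have "\<dots> < h"
    proof -
      have "- S + 2 * ((h + S) / 4) < h" if "- S < h" for S :: real using that by (simp add: field_simps)
      from this[OF h] show ?thesis unfolding t_def .
    qed
    finally show "- (\<Sum>v\<in>A. p v * ln (Q v)) < h" by (simp add: sum_negf)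
  qed (rule Qpos)
qed

text \<open>For \<open>\<tau> > 0\<close> a trapezoidal cutoff: 1 up to distance \<tau> from 0, then
  linear, and 0 from distance \<open>2 * \<tau>\<close> on.\<close>

definition bump :: "real \<Rightarrow> real \<Rightarrow> real" where
  "bump \<tau> t = max 0 (min 1 (2 - \<bar>t\<bar> / \<tau>))"

lemma bump_bounds: "0 \<le> bump \<tau> t" "bump \<tau> t \<le> 1"
  by (auto simp: bump_def)

lemma bump_eq_1: "\<tau> > 0 \<Longrightarrow> \<bar>t\<bar> \<le> \<tau> \<Longrightarrow> bump \<tau> t = 1"
  by (simp add: bump_def field_simps)

lemma continuous_on_bump [continuous_intros]:
  "continuous_on S g \<Longrightarrow> continuous_on S (\<lambda>x. bump \<tau> (g x))"
  unfolding bump_def divide_inverse by (intro continuous_intros)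

lemma bump_tendsto: "(\<lambda>m. bump (1 / real (Suc m)) t) \<longlonglongrightarrow> (if t = 0 then 1 else 0)"
proof (cases "t = 0")
  case False
  obtain M where M: "2 < real M * \<bar>t\<bar>" using ex_less_of_nat_mult[of "\<bar>t\<bar>" 2] False by auto
  have "bump (1 / real (Suc m)) t = 0" if "m \<ge> M" for m
  proof -
    have "real M * \<bar>t\<bar> \<le> real (Suc m) * \<bar>t\<bar>" using that by (intro mult_right_mono) auto
    thus ?thesis using M by (simp add: bump_def algebra_simps)
  qed
  hence "eventually (\<lambda>m. bump (1 / real (Suc m)) t = 0) sequentially" by (auto simp: eventually_sequentially)
  thus ?thesis using False by (simp add: tendsto_eventually)
qed (simp add: bump_def)

section \<open>Perturbing the radius of a ball partition\<close>

context compact_system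
begin

text \<open>Each distance function has a law on the line with at most countably many atoms, so
  finitely many of them cannot use up an interval of radii.\<close>

lemma null_spheres_radius:
  fixes c :: "nat \<Rightarrow> 'a"
  assumes \<nu>: "\<nu> \<in> probs X" and "a < b"
  obtains r where "a < r" "r < b" "\<And>i. i < k \<Longrightarrow> measure \<nu> {x \<in> X. dist (c i) x = r} = 0"
proof -
  interpret prob_space \<nu> using \<nu> by (simp add: probs_iff)
  have m: "dist (c i) \<in> borel_measurable \<nu>" for i
    by (rule probs_measurable_continuous[OF \<nu>]) (intro continuous_intros)
  have atoms: "countable {r. measure \<nu> {x \<in> X. dist (c i) x = r} \<noteq> 0}" for i
  proof -
    interpret D: prob_space "distr \<nu> borel (dist (c i))" by (rule prob_space_distr[OF m])
    have "measure (distr \<nu> borel (dist (c i))) {r} = measure \<nu> {x \<in> X. dist (c i) x = r}" for r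
      using m by (subst measure_distr) (auto simp: space_probs[OF \<nu>] intro!: arg_cong[where f = "measure \<nu>"])
    thus ?thesis using D.countable_support by simp
  qed
  have "countable (\<Union>i<k. {r. measure \<nu> {x \<in> X. dist (c i) x = r} \<noteq> 0})" by (rule countable_UN[OF countableI_type atoms])
  moreover have "uncountable {a<..<b}" using \<open>a < b\<close> by (simp add: uncountable_open_interval)
  ultimately have "\<not> {a<..<b} \<subseteq> (\<Union>i<k. {r. measure \<nu> {x \<in> X. dist (c i) x = r} \<noteq> 0})"
    using countable_subset by blast
  then obtain r where "r \<in> {a<..<b}" "r \<notin> (\<Union>i<k. {r. measure \<nu> {x \<in> X. dist (c i) x = r} \<noteq> 0})" by blast
  thus ?thesis by (intro that[of r]) auto
qed

lemma integral_bump_tendsto_0: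
  assumes \<nu>: "\<nu> \<in> probs X" and null: "measure \<nu> {x \<in> X. dist c x = r} = 0"
  shows "(\<lambda>m. \<integral>x. bump (1 / real (Suc m)) (dist c x - r) \<partial>\<nu>) \<longlonglongrightarrow> 0"
proof -
  interpret prob_space \<nu> using \<nu> by (simp add: probs_iff)
  have S: "{x \<in> X. dist c x = r} \<in> sets \<nu>"
  proof -
    have "closedin (top_of_set X) {x \<in> X. dist c x = r}"
      by (intro continuous_closedin_preimage_constant continuous_intros)
    thus ?thesis using sets_borelX_closed \<nu> by (simp add: probs_iff)
  qed
  have "(\<lambda>m. \<integral>x. bump (1 / real (Suc m)) (dist c x - r) \<partial>\<nu>) \<longlonglongrightarrow> (\<integral>x. indicator {x \<in> X. dist c x = r} x \<partial>\<nu>)"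
  proof (rule integral_dominated_convergence[where w = "\<lambda>_. 1"])
    show "AE x in \<nu>. (\<lambda>m. bump (1 / real (Suc m)) (dist c x - r)) \<longlonglongrightarrow> indicator {x \<in> X. dist c x = r} x"
    proof (rule AE_I2)
      fix x assume "x \<in> space \<nu>"
      hence "indicator {x \<in> X. dist c x = r} x = (if dist c x - r = 0 then 1 else 0 :: real)"
        using space_probs[OF \<nu>] by auto
      thus "(\<lambda>m. bump (1 / real (Suc m)) (dist c x - r)) \<longlonglongrightarrow> indicator {x \<in> X. dist c x = r} x"
        using bump_tendsto[of "dist c x - r"] by (simp only:)
    qed
    show "AE x in \<nu>. norm (bump (1 / real (Suc m)) (dist c x - r)) \<le> 1" for m by (simp add: bump_bounds)
    show "(\<lambda>x. bump (1 / real (Suc m)) (dist c x - r)) \<in> borel_measurable \<nu>" for m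
      by (rule probs_measurable_continuous[OF \<nu>]) (intro continuous_intros)
  qed (use S in auto)
  thus ?thesis using S null by (simp add: Int_absorb2 sets.sets_into_space)
qed

lemma ball_label_finite_partition:
  assumes cov: "\<And>x. x \<in> X \<Longrightarrow> \<exists>i<k. dist (c i) x < r"
  shows "ball_label c k r \<in> finite_partitions X"
proof -
  have "ball_label c k r ` X \<subseteq> {..<k}" using ball_label(1) cov by blast
  hence fin: "finite (ball_label c k r ` X)" by (rule finite_subset) simp
  have [measurable]: "dist (c i) \<in> borel_measurable (borelX X)" for i
    by (intro borelX_measurable_continuous continuous_intros)
  have "ball_label c k r \<in> borelX X \<rightarrow>\<^sub>M count_space UNIV"
  proof (subst measurable_count_space_eq2_countable, intro conjI ballI)
    fix j :: nat
    have "ball_label c k r -` {j} \<inter> space (borelX X) = {x \<in> space (borelX X). j < k \<and> dist (c j) x < r \<and> (\<forall>i<j. \<not> dist (c i) x < r)}"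
      using ball_label_eq_iff[OF cov] by (auto simp only: vimage_def space_borelX singleton_iff)
    also have "\<dots> \<in> sets (borelX X)" by measurable
    finally show "ball_label c k r -` {j} \<inter> space (borelX X) \<in> sets (borelX X)" .
  qed simp
  thus ?thesis using fin by (simp add: finite_partitions_def)
qed

text \<open>In the proof, \<open>G\<close> is continuous since the cutoff \<open>1 - \<kappa>\<close> vanishes where the name of the
  orbit segment jumps. It dominates the code cost for all radii close to \<open>r\<close>, so that the radius
  can be taken rational and countably many parameters suffice.\<close>

lemma low_cost_parameters:
  assumes \<nu>: "\<nu> \<in> Minv X f" and s: "ms_entropy X f \<nu> < ereal s"
    and cov: "\<And>x. x \<in> X \<Longrightarrow> \<exists>i<k. dist (c i) x < a" and ab: "a < b"
  obtains L q Q where "L > 0" "q \<in> \<rat>" "a < q" "q < b" "Q \<in> PiE (words k L) (\<lambda>_. \<rat>)"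
    "\<And>v. v \<in> words k L \<Longrightarrow> Q v > 0" "(\<Sum>v\<in>words k L. Q v) \<le> 1"
    "\<And>x N. x \<in> X \<Longrightarrow> \<nu> \<in> Vx X f x \<Longrightarrow>
       \<exists>n\<ge>N. (\<Sum>i<n. code_cost (ball_label c k q) L Q ((f ^^ i) x)) < real L * (real n * s)"
proof -
  have p: "\<nu> \<in> probs X" using \<nu> by (simp add: Minv_def)
  interpret prob_space \<nu> using p by (simp add: probs_iff)
  obtain r where r: "a < r" "r < b" "\<And>i. i < k \<Longrightarrow> measure \<nu> {x \<in> X. dist (c i) x = r} = 0"
    using null_spheres_radius[OF p ab] by blast
  have covge: "\<exists>i<k. dist (c i) x < r'" if "x \<in> X" "a < r'" for x r'
    using cov[OF that(1)] that(2) by (meson less_trans)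
  let ?\<xi> = "ball_label c k"
  have \<xi>: "?\<xi> r \<in> finite_partitions X" by (rule ball_label_finite_partition) (use covge r in blast)
  have \<xi>k: "?\<xi> r' x < k" if "x \<in> X" "a < r'" for x r' using ball_label(1)[OF covge[OF that]] .
  have inw: "join_part f (?\<xi> r') L x \<in> words k L" if "x \<in> X" "a < r'" for x r' L
    using join_part_in_words[of "?\<xi> r'" k x L] \<xi>k that by blast
  have "ereal (ent_part \<nu> X f (?\<xi> r)) \<le> ms_entropy X f \<nu>" unfolding ms_entropy_def using \<xi> by (rule SUP_upper)
  hence "ent_part \<nu> X f (?\<xi> r) < s" using s by (metis less_ereal.simps(1) order_le_less_trans)
  hence "eventually (\<lambda>n. part_entropy \<nu> X (join_part f (?\<xi> r) n) / real n < s) sequentially"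
    using ent_part_LIMSEQ[OF \<nu> \<xi>] by (rule order_tendstoD(2)[rotated])
  then obtain L0 where L0: "\<And>n. n \<ge> L0 \<Longrightarrow> part_entropy \<nu> X (join_part f (?\<xi> r) n) / real n < s"
    unfolding eventually_sequentially by blast
  have "part_entropy \<nu> X (join_part f (?\<xi> r) (Suc L0)) / real (Suc L0) < s" by (rule L0) simp
  hence "part_entropy \<nu> X (join_part f (?\<xi> r) (Suc L0)) < real (Suc L0) * s"
    by (simp add: divide_less_eq mult.commute del: of_nat_Suc)
  then obtain L where L: "L > 0" "part_entropy \<nu> X (join_part f (?\<xi> r) L) < real L * s"
    using zero_less_Suc by blast
  let ?J = "\<lambda>q. join_part f (?\<xi> q) L"
  let ?A = "words k L"
  define pr where "pr v = measure \<nu> {x \<in> X. ?J r x = v}" for v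
  have JA: "?J r ` X \<subseteq> ?A" using inw r(1) by blast
  have out: "pr v = 0" if "v \<in> ?A - ?J r ` X" for v
  proof -
    have e: "{x \<in> X. ?J r x = v} = {}" using that by blast
    show ?thesis unfolding pr_def e by simp
  qed
  have sum1: "(\<Sum>v\<in>?A. pr v) = 1"
    using sum_measure_level_sets[OF p finite_join_part[OF \<xi>] join_part_measurable[OF \<xi>], of L]
      sum.mono_neutral_left[OF finite_words JA, of pr] out by (simp add: pr_def)
  have ent: "(\<Sum>v\<in>?A. pr v * ln (pr v)) = - part_entropy \<nu> X (?J r)"
    using sum.mono_neutral_left[OF finite_words JA, of "\<lambda>v. pr v * ln (pr v)"] out
    by (simp add: part_entropy_def pr_def)
  obtain Q where Q: "Q \<in> PiE ?A (\<lambda>_. \<rat>)" "\<And>v. v \<in> ?A \<Longrightarrow> Q v > 0" "(\<Sum>v\<in>?A. Q v) \<le> 1" "- (\<Sum>v\<in>?A. pr v * ln (Q v)) < real L * s"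
    by (rule exists_rational_code[OF finite_words, of k L pr "real L * s"]) (use L sum1 ent in \<open>auto simp: pr_def\<close>)
  let ?\<phi> = "\<lambda>q. code_cost (?\<xi> q) L Q"
  \<comment> \<open>The costs of all words added up: a bound on the code cost that is valid for
    every radius above \<open>a\<close>.\<close>
  define B where "B = (\<Sum>v\<in>?A. - ln (Q v))"
  have Q1: "0 \<le> - ln (Q v)" if "v \<in> ?A" for v
  proof -
    have "Q v \<le> (\<Sum>v\<in>?A. Q v)" using Q(2) less_imp_le by (intro member_le_sum[OF that _ finite_words]) auto
    thus ?thesis using Q(2)[OF that] Q(3) by (simp add: ln_le_zero_iff)
  qed
  have \<phi>b: "0 \<le> ?\<phi> q x" "?\<phi> q x \<le> B" if "x \<in> X" "a < q" for x q
    using inw[OF that] Q1 member_le_sum[OF inw[OF that, of L] _ finite_words, of "\<lambda>v. - ln (Q v)"]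
    by (auto simp: code_cost_def B_def)
  have B0: "B \<ge> 0" unfolding B_def using Q1 by (intro sum_nonneg) auto
  have int\<phi>: "(\<integral>x. ?\<phi> r x \<partial>\<nu>) < real L * s" and m\<phi>: "?\<phi> r \<in> borel_measurable (borelX X)"
  proof -
    have "(\<integral>x. ?\<phi> r x \<partial>\<nu>) = (\<Sum>v\<in>?J r ` X. pr v * - ln (Q v))"
      unfolding code_cost_def pr_def
      by (rule integral_finite_valued(1)[OF p finite_join_part[OF \<xi>] join_part_measurable[OF \<xi>], of "\<lambda>v. - ln (Q v)"])
    also have "\<dots> = (\<Sum>v\<in>?A. pr v * - ln (Q v))" using out by (intro sum.mono_neutral_left finite_words JA) auto
    also have "\<dots> < real L * s" using Q(4) by (simp add: sum_negf)
    finally show "(\<integral>x. ?\<phi> r x \<partial>\<nu>) < real L * s" .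
    show "?\<phi> r \<in> borel_measurable (borelX X)" unfolding code_cost_def
      by (rule integral_finite_valued(2)[OF p finite_join_part[OF \<xi>] join_part_measurable[OF \<xi>], of "\<lambda>v. - ln (Q v)"])
  qed
  \<comment> \<open>At least 1 as soon as one of the first \<open>L\<close> orbit points is within
    \<tau> of one of the spheres of radius \<open>r\<close>; by invariance its mean is
    \<open>L\<close> times a sum of means of single cutoffs, which is small for small
    \<tau>.\<close>
  define \<psi> where "\<psi> \<tau> x = (\<Sum>l<L. \<Sum>i<k. bump \<tau> (dist (c i) ((f ^^ l) x) - r))" for \<tau> x
  have cont\<psi>: "continuous_on X (\<psi> \<tau>)" for \<tau>
    unfolding \<psi>_def by (intro continuous_intros continuous_funpow)
  have int\<psi>: "(\<integral>x. \<psi> \<tau> x \<partial>\<nu>) = real L * (\<Sum>i<k. \<integral>x. bump \<tau> (dist (c i) x - r) \<partial>\<nu>)" for \<tau>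
  proof -
    have ci: "continuous_on X (\<lambda>x. bump \<tau> (dist (c i) ((f ^^ l) x) - r))" for i l
      by (intro continuous_intros continuous_funpow)
    have "(\<integral>x. \<psi> \<tau> x \<partial>\<nu>) = (\<Sum>l<L. \<Sum>i<k. \<integral>x. bump \<tau> (dist (c i) ((f ^^ l) x) - r) \<partial>\<nu>)"
      unfolding \<psi>_def using probs_integrable[OF compact_X p ci]
      by (simp add: Bochner_Integration.integral_sum)
    also have "\<dots> = (\<Sum>l<L. \<Sum>i<k. \<integral>x. bump \<tau> (dist (c i) x - r) \<partial>\<nu>)"
    proof (intro sum.cong refl)
      fix l i
      show "(\<integral>x. bump \<tau> (dist (c i) ((f ^^ l) x) - r) \<partial>\<nu>) = (\<integral>x. bump \<tau> (dist (c i) x - r) \<partial>\<nu>)"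
        by (rule integral_invariant[OF \<nu>, of "\<lambda>x. bump \<tau> (dist (c i) x - r)" l])
           (intro borelX_measurable_continuous continuous_intros)
    qed
    finally show ?thesis by simp
  qed
  have "(\<lambda>m. \<integral>x. \<psi> (1 / real (Suc m)) x \<partial>\<nu>) \<longlonglongrightarrow> real L * (\<Sum>i<k. 0)"
    unfolding int\<psi> by (intro tendsto_mult tendsto_const tendsto_sum integral_bump_tendsto_0[OF p]) (use r in auto)
  hence "(\<lambda>m. B * (\<integral>x. \<psi> (1 / real (Suc m)) x \<partial>\<nu>)) \<longlonglongrightarrow> B * 0" by (intro tendsto_mult tendsto_const) simp
  hence "eventually (\<lambda>m. B * (\<integral>x. \<psi> (1 / real (Suc m)) x \<partial>\<nu>) < real L * s - (\<integral>x. ?\<phi> r x \<partial>\<nu>)) sequentially"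
    using int\<phi> by (intro order_tendstoD(2)) auto
  then obtain m where "B * (\<integral>x. \<psi> (1 / real (Suc m)) x \<partial>\<nu>) < real L * s - (\<integral>x. ?\<phi> r x \<partial>\<nu>)"
    by (auto simp: eventually_sequentially)
  then obtain \<tau> where \<tau>: "\<tau> > 0" "(\<integral>x. ?\<phi> r x \<partial>\<nu>) + B * (\<integral>x. \<psi> \<tau> x \<partial>\<nu>) < real L * s"
    by (intro that[of "1 / real (Suc m)"]) auto
  \<comment> \<open>Replacing \<open>r\<close> by \<open>q\<close> changes a test
    \<open>dist (c i) x < r\<close> only for points within \<tau> of the sphere, and there the
    cutoff \<open>\<psi> \<tau>\<close> is at least 1.\<close>
  obtain q where q: "q \<in> \<rat>" "max a (r - \<tau>) < q" "q < r"
    using Rats_dense_in_real[of "max a (r - \<tau>)" r] r \<tau> by auto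
  define \<kappa> where "\<kappa> x = min 1 (\<psi> \<tau> x)" for x
  have \<psi>0: "\<psi> \<tau> x \<ge> 0" for x unfolding \<psi>_def by (intro sum_nonneg bump_bounds)
  have \<psi>1: "\<psi> \<tau> x \<ge> 1" if "l < L" "i < k" "\<bar>dist (c i) ((f ^^ l) x) - r\<bar> \<le> \<tau>" for x l i
  proof -
    have "1 = bump \<tau> (dist (c i) ((f ^^ l) x) - r)" using bump_eq_1[OF \<tau>(1) that(3)] by simp
    also have "\<dots> \<le> (\<Sum>i<k. bump \<tau> (dist (c i) ((f ^^ l) x) - r))"
      by (rule member_le_sum) (use that(2) bump_bounds in auto)
    also have "\<dots> \<le> \<psi> \<tau> x" unfolding \<psi>_def
      by (rule member_le_sum[of l "{..<L}" "\<lambda>l. \<Sum>i<k. bump \<tau> (dist (c i) ((f ^^ l) x) - r)"])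
         (use that(1) bump_bounds in \<open>auto intro: sum_nonneg\<close>)
    finally show ?thesis .
  qed
  define G where "G x = (1 - \<kappa> x) * ?\<phi> r x + B * \<kappa> x" for x
  have same: "?\<phi> r y = ?\<phi> q' x"
    if "\<And>l i. l < L \<Longrightarrow> i < k \<Longrightarrow> dist (c i) ((f ^^ l) y) < r \<longleftrightarrow> dist (c i) ((f ^^ l) x) < q'" for x y q'
  proof -
    have "?\<xi> r ((f ^^ l) y) = ?\<xi> q' ((f ^^ l) x)" if "l < L" for l
      by (rule ball_label_cong) (use \<open>\<And>l i. l < L \<Longrightarrow> i < k \<Longrightarrow> _\<close>[OF that] in blast)
    hence "?J r y = ?J q' x" by (simp add: join_part_def)
    thus ?thesis by (simp add: code_cost_def)
  qed
  have contG: "continuous_on X G"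
  proof -
    have "((\<lambda>y. (1 - \<kappa> y) * ?\<phi> r y) \<longlongrightarrow> (1 - \<kappa> x) * ?\<phi> r x) (at x within X)" if x: "x \<in> X" for x
    proof -
      have dlim: "((\<lambda>y. dist (c i) ((f ^^ l) y)) \<longlongrightarrow> dist (c i) ((f ^^ l) x)) (at x within X)" for i l
      proof -
        have "continuous_on X (\<lambda>y. dist (c i) ((f ^^ l) y))" by (intro continuous_intros continuous_funpow)
        thus ?thesis using x by (simp add: continuous_on_def)
      qed
      have \<kappa>lim: "(\<kappa> \<longlongrightarrow> \<kappa> x) (at x within X)"
      proof -
        have "continuous_on X \<kappa>" unfolding \<kappa>_def by (intro continuous_intros cont\<psi>)
        thus ?thesis using x by (simp add: continuous_on_def)
      qed
      show ?thesis
      proof (cases "\<exists>l<L. \<exists>i<k. dist (c i) ((f ^^ l) x) = r")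
        case True
        then obtain l i where li: "l < L" "i < k" "dist (c i) ((f ^^ l) x) = r" by blast
        have "eventually (\<lambda>y. dist (dist (c i) ((f ^^ l) y)) r < \<tau>) (at x within X)"
          using tendstoD[OF dlim[of i l] \<tau>(1)] li(3) by simp
        hence "eventually (\<lambda>y. (1 - \<kappa> y) * ?\<phi> r y = 0) (at x within X)"
          by eventually_elim (use \<psi>1[OF li(1,2)] in \<open>auto simp: \<kappa>_def dist_real_def min_def\<close>)
        moreover have "(1 - \<kappa> x) * ?\<phi> r x = 0" using \<psi>1[OF li(1,2), of x] li(3) \<tau>(1) by (simp add: \<kappa>_def)
        ultimately show ?thesis by (simp only: tendsto_eventually)
      next
        case False
        have ev: "eventually (\<lambda>y. dist (c i) ((f ^^ l) y) < r \<longleftrightarrow> dist (c i) ((f ^^ l) x) < r) (at x within X)" if "l < L" "i < k" for l i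
        proof (cases "dist (c i) ((f ^^ l) x) < r")
          case True
          from order_tendstoD(2)[OF dlim True] show ?thesis by eventually_elim (use True in simp)
        next
          case F: False
          hence "r < dist (c i) ((f ^^ l) x)" using False that by (metis linorder_neqE_linordered_idom)
          from order_tendstoD(1)[OF dlim this] show ?thesis by eventually_elim (use F in simp)
        qed
        have "eventually (\<lambda>y. \<forall>l\<in>{..<L}. \<forall>i\<in>{..<k}. dist (c i) ((f ^^ l) y) < r \<longleftrightarrow> dist (c i) ((f ^^ l) x) < r) (at x within X)"
          by (intro eventually_ball_finite ballI) (use ev in auto)
        hence "eventually (\<lambda>y. (1 - \<kappa> y) * ?\<phi> r x = (1 - \<kappa> y) * ?\<phi> r y) (at x within X)"
        proof eventually_elim
          case (elim y)
          have "?\<phi> r y = ?\<phi> r x" by (rule same) (use elim in auto)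
          thus ?case by simp
        qed
        moreover have "((\<lambda>y. (1 - \<kappa> y) * ?\<phi> r x) \<longlongrightarrow> (1 - \<kappa> x) * ?\<phi> r x) (at x within X)"
          by (intro tendsto_intros \<kappa>lim)
        ultimately show ?thesis by (rule Lim_transform_eventually[rotated])
      qed
    qed
    hence "continuous_on X (\<lambda>y. (1 - \<kappa> y) * ?\<phi> r y)" by (simp add: continuous_on_def)
    moreover have "continuous_on X (\<lambda>x. B * \<kappa> x)" unfolding \<kappa>_def by (intro continuous_intros cont\<psi>)
    ultimately show ?thesis unfolding G_def by (rule continuous_on_add)
  qed
  have domG: "?\<phi> q x \<le> G x" if x: "x \<in> X" for x
  proof (cases "\<kappa> x = 1")
    case True
    thus ?thesis using \<phi>b(2)[OF x, of q] q by (simp add: G_def)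
  next
    case False
    hence lt: "\<psi> \<tau> x < 1" by (auto simp: \<kappa>_def min_def split: if_splits)
    have "?\<phi> r x = ?\<phi> q x"
    proof (rule same)
      fix l i assume li: "l < L" "i < k"
      have "\<not> \<bar>dist (c i) ((f ^^ l) x) - r\<bar> \<le> \<tau>" using \<psi>1[OF li, of x] lt by linarith
      thus "dist (c i) ((f ^^ l) x) < r \<longleftrightarrow> dist (c i) ((f ^^ l) x) < q" using q by auto
    qed
    moreover have "0 \<le> \<kappa> x" using \<psi>0 by (simp add: \<kappa>_def)
    hence "\<kappa> x * ?\<phi> r x \<le> \<kappa> x * B" using \<phi>b(2)[OF x r(1)] by (rule mult_left_mono[rotated])
    ultimately show ?thesis by (simp add: G_def algebra_simps)
  qed
  have intG: "(\<integral>x. G x \<partial>\<nu>) < real L * s"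
  proof -
    have i\<phi>: "integrable \<nu> (?\<phi> r)"
      by (rule probs_integrable_bounded[OF p m\<phi>, of B]) (use \<phi>b r(1) in \<open>auto simp: abs_le_iff\<close>)
    have i\<psi>: "integrable \<nu> (\<psi> \<tau>)" by (rule probs_integrable[OF compact_X p cont\<psi>])
    have "(\<integral>x. G x \<partial>\<nu>) \<le> (\<integral>x. ?\<phi> r x + B * \<psi> \<tau> x \<partial>\<nu>)"
    proof (rule integral_mono)
      show "integrable \<nu> G" by (rule probs_integrable[OF compact_X p contG])
      show "integrable \<nu> (\<lambda>x. ?\<phi> r x + B * \<psi> \<tau> x)" using i\<phi> i\<psi> by simp
      fix x assume "x \<in> space \<nu>"
      hence x: "x \<in> X" using space_probs[OF p] by simp
      have "(1 - \<kappa> x) * ?\<phi> r x \<le> 1 * ?\<phi> r x" using \<psi>0 \<phi>b(1)[OF x r(1)] by (intro mult_right_mono) (auto simp: \<kappa>_def)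
      moreover have "B * \<kappa> x \<le> B * \<psi> \<tau> x" using B0 by (intro mult_left_mono) (auto simp: \<kappa>_def)
      ultimately show "G x \<le> ?\<phi> r x + B * \<psi> \<tau> x" by (simp add: G_def)
    qed
    also have "\<dots> = (\<integral>x. ?\<phi> r x \<partial>\<nu>) + B * (\<integral>x. \<psi> \<tau> x \<partial>\<nu>)" using i\<phi> i\<psi> by simp
    also have "\<dots> < real L * s" by (rule \<tau>(2))
    finally show ?thesis .
  qed
  show ?thesis
  proof (rule that[OF L(1) q(1) _ _ Q(1,2,3)])
    show "a < q" "q < b" using q r by auto
    fix x N assume x: "x \<in> X" "\<nu> \<in> Vx X f x"
    define e where "e = real L * s - (\<integral>x. G x \<partial>\<nu>)"
    have e: "e > 0" using intG by (simp add: e_def)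
    obtain n where n: "n \<ge> N" "n > 0" "\<And>g. g \<in> {G} \<Longrightarrow> \<bar>(\<Sum>i<n. g ((f ^^ i) x)) / n - integral\<^sup>L \<nu> g\<bar> < e"
      by (rule Vx_approx[OF x(2,1) _ _ e, of "{G}" N]) (use contG in auto)
    have "(\<Sum>i<n. ?\<phi> q ((f ^^ i) x)) \<le> (\<Sum>i<n. G ((f ^^ i) x))"
      by (intro sum_mono domG funpow_in x)
    also have "(\<Sum>i<n. G ((f ^^ i) x)) / n < real L * s" using n(3)[of G] unfolding e_def by auto
    hence "(\<Sum>i<n. G ((f ^^ i) x)) < real L * (real n * s)" using n(2) by (simp add: field_simps)
    finally show "\<exists>n\<ge>N. (\<Sum>i<n. ?\<phi> q ((f ^^ i) x)) < real L * (real n * s)" using n(1) by blast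
  qed
qed

lemma bowen_h_eps_Delta_cap_le:
  assumes U: "U \<subseteq> Minv X f" and t: "\<And>\<nu>. \<nu> \<in> U \<Longrightarrow> ms_entropy X f \<nu> \<le> ereal t" and \<epsilon>: "\<epsilon> > 0"
  shows "bowen_h_eps X f (Delta_cap X f U) \<epsilon> \<le> ereal t"
proof (rule bowen_h_eps_le)
  fix s' assume "t < s'"
  then obtain s where s: "t < s" "s < s'" using dense by blast
  have "X \<subseteq> (\<Union>x\<in>X. ball x (\<epsilon>/4))" using \<epsilon> by auto
  then obtain C where C: "C \<subseteq> X" "finite C" "X \<subseteq> (\<Union>x\<in>C. ball x (\<epsilon>/4))"
    by (rule compactE_image[OF compact_X, of X "\<lambda>x. ball x (\<epsilon>/4)", rotated]) auto
  obtain k and c :: "nat \<Rightarrow> 'a" where c: "C = c ` {i. i < k}"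
    using finite_imp_nat_seg_image_inj_on[OF C(2)] by blast
  have cov: "\<exists>i<k. dist (c i) x < \<epsilon>/4" if "x \<in> X" for x using subsetD[OF C(3) that] unfolding c UN_iff by (auto simp: mem_ball simp del: divide_const_simps)
  \<comment> \<open>All block lengths, rational radii and rational codes; countable because a code
    has only the finitely many words of its block length as arguments.\<close>
  define I where "I = (SIGMA (L::nat):UNIV. SIGMA (q::real):\<rat>. PiE (words k L) (\<lambda>_. \<rat> :: real set))"
  have cI: "countable I" unfolding I_def
    by (intro countable_SIGMA countable_PiE finite_words countable_rat) auto
  define Z where "Z = (\<lambda>(L, q, Q). {x \<in> X. \<forall>N. \<exists>n\<ge>N. (\<Sum>i<n. code_cost (ball_label c k q) L Q ((f ^^ i) x)) < real L * (real n * s)})"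
  \<comment> \<open>Radii above \<open>\<epsilon>/4\<close> keep the balls a cover of
    \<open>X\<close>; radii below \<open>\<epsilon>/2\<close> give cells whose points are less than
    \<epsilon> apart.\<close>
  define I' where "I' = {(L, q, Q) \<in> I. L > 0 \<and> \<epsilon>/4 < q \<and> q < \<epsilon>/2 \<and> (\<forall>v\<in>words k L. Q v > 0) \<and> (\<Sum>v\<in>words k L. Q v) \<le> 1}"
  have "countable I'" unfolding I'_def by (rule countable_subset[OF _ cI]) auto
  hence "bowen_m X f (\<Union>i\<in>I'. Z i) s' \<epsilon> = 0"
  proof (rule bowen_m_countable_UN_eq_0)
    fix i assume "i \<in> I'"
    then obtain L q Q where i: "i = (L, q, Q)" "L > 0" "\<epsilon>/4 < q" "q < \<epsilon>/2" "\<And>v. v \<in> words k L \<Longrightarrow> Q v > 0" "(\<Sum>v\<in>words k L. Q v) \<le> 1"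
      unfolding I'_def by auto
    have covq: "\<exists>i<k. dist (c i) x < q" if "x \<in> X" for x using cov[OF that] i(3) by (meson less_trans)
    have lab: "ball_label c k q x < k" if "x \<in> X" for x using ball_label(1)[OF covq[OF that]] .
    have diam: "dist x y < \<epsilon>" if "x \<in> X" "y \<in> X" "ball_label c k q x = ball_label c k q y" for x y
      using ball_label_diam[OF covq[OF that(1)] covq[OF that(2)] that(3)] i(4) by simp
    show "bowen_m X f (Z i) s' \<epsilon> = 0"
      unfolding i(1) Z_def prod.case by (rule bowen_m_low_cost_eq_0[OF lab diam i(2) i(5,6) s(2)])
  qed
  moreover have "Delta_cap X f U \<subseteq> (\<Union>i\<in>I'. Z i)"
  proof
    fix x assume "x \<in> Delta_cap X f U"
    then obtain \<nu> where x: "x \<in> X" "\<nu> \<in> Vx X f x" "\<nu> \<in> U" unfolding Delta_cap_def by blast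
    have \<nu>: "\<nu> \<in> Minv X f" using x(3) U by blast
    have "ms_entropy X f \<nu> < ereal s" using t[OF x(3)] s(1) by (meson ereal_less_eq(3) less_ereal.simps(1) order_le_less_trans)
    then obtain L q Q where *: "L > 0" "q \<in> \<rat>" "\<epsilon>/4 < q" "q < \<epsilon>/2" "Q \<in> PiE (words k L) (\<lambda>_. \<rat>)"
      "\<And>v. v \<in> words k L \<Longrightarrow> Q v > 0" "(\<Sum>v\<in>words k L. Q v) \<le> 1"
      "\<And>x N. x \<in> X \<Longrightarrow> \<nu> \<in> Vx X f x \<Longrightarrow>
         \<exists>n\<ge>N. (\<Sum>i<n. code_cost (ball_label c k q) L Q ((f ^^ i) x)) < real L * (real n * s)"
      by (rule low_cost_parameters[OF \<nu> _ cov, of s "\<epsilon>/2"]) (use \<epsilon> in auto)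
    have "(L, q, Q) \<in> I'" unfolding I'_def I_def using * by auto
    moreover have "x \<in> Z (L, q, Q)" unfolding Z_def using *(8)[OF x(1,2)] x(1) by auto
    ultimately show "x \<in> (\<Union>i\<in>I'. Z i)" by blast
  qed
  hence "bowen_mN X f (Delta_cap X f U) s' N \<epsilon> \<le> bowen_mN X f (\<Union>i\<in>I'. Z i) s' N \<epsilon>" for N
    unfolding bowen_mN_def by (intro INF_superset_mono bowen_covers_mono_set) auto
  ultimately show "bowen_m X f (Delta_cap X f U) s' \<epsilon> = 0" unfolding bowen_m_eq_0_iff by simp
qed

text \<open>An infinite supremum bounds everything; otherwise it is a real number, because entropies
  are nonnegative and \<open>U\<close> is nonempty, and the bound at each radius does not depend on
  the radius.\<close>

lemma bowen_entropy_Delta_cap_le: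
  assumes U: "U \<subseteq> Minv X f" "U \<noteq> {}"
  shows "bowen_entropy X f (Delta_cap X f U) \<le> (SUP \<nu>\<in>U. ms_entropy X f \<nu>)"
proof (cases "(SUP \<nu>\<in>U. ms_entropy X f \<nu>) = \<infinity>")
  case False
  obtain \<nu> where \<nu>: "\<nu> \<in> U" using U(2) by blast
  have "0 \<le> ms_entropy X f \<nu>" using ms_entropy_nonneg \<nu> U(1) by blast
  also have "\<dots> \<le> (SUP \<nu>\<in>U. ms_entropy X f \<nu>)" using \<nu> by (rule SUP_upper)
  finally obtain t where t: "(SUP \<nu>\<in>U. ms_entropy X f \<nu>) = ereal t"
    using False by (cases "SUP \<nu>\<in>U. ms_entropy X f \<nu>") auto
  have "ms_entropy X f \<nu> \<le> ereal t" if "\<nu> \<in> U" for \<nu> unfolding t[symmetric] using that by (rule SUP_upper)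
  hence "bowen_h_eps X f (Delta_cap X f U) \<epsilon> \<le> ereal t" if "\<epsilon> > 0" for \<epsilon>
    using bowen_h_eps_Delta_cap_le[OF U(1) _ that] by blast
  thus ?thesis unfolding t bowen_entropy_SUP by (intro SUP_least) auto
qed simp

end

section \<open>Freely concatenated words\<close>

text \<open>Countable subadditivity over an arbitrary countable index set, with the sum written as
  in \<open>bowen_mN\<close> so that it can be compared with the weight of a cover.\<close>

lemma emeasure_countable_cover_le:
  assumes C: "countable C" and A: "\<And>p. p \<in> C \<Longrightarrow> A p \<in> sets M" and cov: "S \<subseteq> (\<Union>p\<in>C. A p)" "S \<in> sets M"
  shows "emeasure M S \<le> (\<integral>\<^sup>+ p. emeasure M (A p) \<partial>count_space C)"
proof -
  define T where "T = to_nat_on C ` C"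
  define B where "B k = (if k \<in> T then A (from_nat_into C k) else {})" for k
  have inv: "from_nat_into C (to_nat_on C p) = p" if "p \<in> C" for p using C that by (rule from_nat_into_to_nat_on)
  have B: "B k \<in> sets M" for k using A inv by (auto simp: B_def T_def)
  have "S \<subseteq> (\<Union>k. B k)"
  proof
    fix x assume "x \<in> S"
    then obtain p where p: "p \<in> C" "x \<in> A p" using cov by blast
    hence "x \<in> B (to_nat_on C p)" using inv by (simp add: B_def T_def)
    thus "x \<in> (\<Union>k. B k)" by blast
  qed
  hence "emeasure M S \<le> emeasure M (\<Union>k. B k)" using B by (intro emeasure_mono) auto
  also have "\<dots> \<le> (\<Sum>k. emeasure M (B k))" using B by (intro emeasure_subadditive_countably) auto
  also have "\<dots> = (\<integral>\<^sup>+ k. emeasure M (B k) \<partial>count_space UNIV)" by (simp add: nn_integral_count_space_nat)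
  also have "\<dots> = (\<integral>\<^sup>+ k. emeasure M (A (from_nat_into C k)) * indicator T k \<partial>count_space UNIV)"
    by (intro nn_integral_cong) (auto simp: B_def indicator_def)
  also have "\<dots> = (\<integral>\<^sup>+ k. emeasure M (A (from_nat_into C k)) \<partial>count_space T)"
    by (simp add: nn_integral_count_space_indicator)
  also have "\<dots> = (\<integral>\<^sup>+ p. emeasure M (A (from_nat_into C (to_nat_on C p))) \<partial>count_space C)"
    using C unfolding T_def
    by (intro nn_integral_bij_count_space[symmetric] inj_on_imp_bij_betw inj_on_to_nat_on)
  also have "\<dots> = (\<integral>\<^sup>+ p. emeasure M (A p) \<partial>count_space C)"
    using inv by (intro nn_integral_cong) simp
  finally show ?thesis .
qed

context compact_system
begin

text \<open>A mass distribution argument for the uniform product measure on sequences of words: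
  sequences whose shadowing points share a Bowen ball of length \<open>n\<close> agree in the first
  \<open>n div P\<close> words, hence lie in a cylinder of mass at most
  \<open>c * exp (- n * h)\<close>. As the total mass is 1, every cover has weight at least
  \<open>1 / c\<close>.\<close>

lemma bowen_m_shadowed_words_pos:
  fixes W :: "'a list set"
  assumes W: "finite W" "W \<noteq> {}" and P: "P > 0"
    and sep: "\<And>v w. v \<in> W \<Longrightarrow> w \<in> W \<Longrightarrow> v \<noteq> w \<Longrightarrow> \<exists>i<P. 4 * \<epsilon> \<le> dist (v ! i) (w ! i)"
    and sh: "\<And>\<omega>. (\<And>k. \<omega> k \<in> W) \<Longrightarrow> sh \<omega> \<in> Z"
      "\<And>\<omega> i. (\<And>k. \<omega> k \<in> W) \<Longrightarrow> dist ((f ^^ i) (sh \<omega>)) (\<omega> (i div P) ! (i mod P)) < \<epsilon>"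
  shows "bowen_m X f Z (ln (real (card W)) / real P) \<epsilon> \<noteq> 0"
proof -
  define h where "h = ln (real (card W)) / real P"
  define c where "c = real (card W)"
  have c1: "c \<ge> 1" using W by (simp add: c_def Suc_le_eq card_gt_0_iff)
  interpret prob_space "uniform_count_measure W" using W by (rule prob_space_uniform_count_measure)
  interpret PP: product_prob_space "\<lambda>_. uniform_count_measure W" "UNIV :: nat set" ..
  let ?M = "PiM (UNIV :: nat set) (\<lambda>_. uniform_count_measure W)"
  have spM: "space ?M = {\<omega>. \<forall>k. \<omega> k \<in> W}"
    by (auto simp: space_PiM space_uniform_count_measure PiE_def Pi_def)
  define cyl where "cyl \<omega>0 m = {\<omega>. (\<forall>k. \<omega> k \<in> W) \<and> (\<forall>k<m. \<omega> k = \<omega>0 k)}" for \<omega>0 :: "nat \<Rightarrow> 'a list" and m :: nat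
  have cyl: "cyl \<omega>0 m \<in> sets ?M" "emeasure ?M (cyl \<omega>0 m) = ennreal ((1 / c) ^ m)"
    if "\<And>k. \<omega>0 k \<in> W" for \<omega>0 :: "nat \<Rightarrow> 'a list" and m
  proof -
    have s: "{\<omega>0 i} \<in> sets (uniform_count_measure W)" for i using that by (simp add: sets_uniform_count_measure)
    have eq: "cyl \<omega>0 m = prod_emb UNIV (\<lambda>_. uniform_count_measure W) {..<m} (PiE {..<m} (\<lambda>k. {\<omega>0 k}))"
      unfolding cyl_def prod_emb_def
      by (auto simp: space_uniform_count_measure PiE_def Pi_def extensional_def restrict_def)
    show "cyl \<omega>0 m \<in> sets ?M" unfolding eq using s by (intro sets_PiM_I) auto
    have "emeasure ?M (cyl \<omega>0 m) = (\<Prod>i<m. emeasure (uniform_count_measure W) {\<omega>0 i})"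
      unfolding eq using s by (intro PP.emeasure_PiM_emb) auto
    also have "\<dots> = (\<Prod>i<m. ennreal (1 / c))"
      using W that by (intro prod.cong refl) (simp add: emeasure_uniform_count_measure c_def)
    also have "\<dots> = ennreal ((1 / c) ^ m)" using c1 by (simp add: ennreal_power)
    finally show "emeasure ?M (cyl \<omega>0 m) = ennreal ((1 / c) ^ m)" .
  qed
  have same: "\<omega> k = \<omega>' k" if w: "\<And>k. \<omega> k \<in> W" "\<And>k. \<omega>' k \<in> W"
    and b: "sh \<omega> \<in> bowen_ball X f z n \<epsilon>" "sh \<omega>' \<in> bowen_ball X f z n \<epsilon>" and k: "k < n div P" for \<omega> \<omega>' z n k
  proof (rule ccontr)
    assume "\<omega> k \<noteq> \<omega>' k"
    then obtain i where i: "i < P" "4 * \<epsilon> \<le> dist (\<omega> k ! i) (\<omega>' k ! i)" using sep w by blast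
    define j where "j = k * P + i"
    have "Suc k * P \<le> n" using k P by (metis Suc_leI div_le_mono2 less_eq_div_iff_mult_less_eq)
    hence j: "j < n" "j div P = k" "j mod P = i" using i(1) by (simp_all add: j_def)
    have "dist ((f ^^ j) (sh \<omega>)) (\<omega> k ! i) < \<epsilon>" "dist ((f ^^ j) (sh \<omega>')) (\<omega>' k ! i) < \<epsilon>"
      using sh(2)[OF w(1), of j] sh(2)[OF w(2), of j] j by simp_all
    moreover have "dist ((f ^^ j) z) ((f ^^ j) (sh \<omega>)) < \<epsilon>" "dist ((f ^^ j) z) ((f ^^ j) (sh \<omega>')) < \<epsilon>"
      using b j(1) by (auto simp: bowen_ball_def)
    \<comment> \<open>Four steps shorter than \<epsilon>: from a word entry to its shadowing orbit,
      to the centre, to the other shadowing orbit, to the other entry.\<close>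
    ultimately have "dist (\<omega> k ! i) (\<omega>' k ! i) < 4 * \<epsilon>" by metric
    thus False using i(2) by simp
  qed
  have "ennreal (1 / c) \<le> bowen_mN X f Z h 0 \<epsilon>"
    unfolding bowen_mN_def
  proof (rule INF_greatest)
    fix C assume C: "C \<in> bowen_covers X f Z \<epsilon> 0"
    \<comment> \<open>The shadowing point is an arbitrary choice, so the sequences landing in a ball
      need not form a measurable set; the cylinder around one of them, which contains them all,
      takes its place.\<close>
    define A where "A p = (if \<exists>\<omega>. (\<forall>k. \<omega> k \<in> W) \<and> sh \<omega> \<in> bowen_ball X f (fst p) (snd p) \<epsilon>
        then cyl (SOME \<omega>. (\<forall>k. \<omega> k \<in> W) \<and> sh \<omega> \<in> bowen_ball X f (fst p) (snd p) \<epsilon>) (snd p div P) else {})" for p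
    have A: "A p \<in> sets ?M \<and> emeasure ?M (A p) \<le> ennreal c * ennreal (exp (- real (snd p) * h)) \<and>
       {\<omega> \<in> space ?M. sh \<omega> \<in> bowen_ball X f (fst p) (snd p) \<epsilon>} \<subseteq> A p" for p
    proof (cases "\<exists>\<omega>. (\<forall>k. \<omega> k \<in> W) \<and> sh \<omega> \<in> bowen_ball X f (fst p) (snd p) \<epsilon>")
      case True
      define \<omega>0 where "\<omega>0 = (SOME \<omega>. (\<forall>k. \<omega> k \<in> W) \<and> sh \<omega> \<in> bowen_ball X f (fst p) (snd p) \<epsilon>)"
      have \<omega>0: "\<And>k. \<omega>0 k \<in> W" "sh \<omega>0 \<in> bowen_ball X f (fst p) (snd p) \<epsilon>"
        using someI_ex[OF True] unfolding \<omega>0_def by blast+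
      have Ap: "A p = cyl \<omega>0 (snd p div P)" using True unfolding A_def \<omega>0_def by simp
      have "(1 / c) ^ (snd p div P) = exp (- (real (snd p div P) * ln c))"
        using c1 by (simp add: exp_minus exp_of_nat_mult power_one_over inverse_eq_divide)
      \<comment> \<open>Rounding down in \<open>n div P\<close> loses less than one word, which
        costs at most the factor \<open>c\<close>.\<close>
      also have "\<dots> \<le> exp (ln c + - real (snd p) * h)"
      proof -
        have "real (snd p) \<le> (real (snd p div P) + 1) * real P"
        proof -
          have "snd p < Suc (snd p div P) * P" using P dividend_less_div_times[of P "snd p"] by simp
          hence "real (snd p) \<le> real (Suc (snd p div P) * P)" by (simp only: of_nat_le_iff)
          thus ?thesis by (simp add: algebra_simps)
        qed
        hence "real (snd p) / real P \<le> real (snd p div P) + 1" using P by (simp add: field_simps)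
        hence "real (snd p) / real P * ln c \<le> (real (snd p div P) + 1) * ln c" using c1 by (intro mult_right_mono) auto
        thus ?thesis by (simp add: h_def c_def algebra_simps)
      qed
      also have "\<dots> = c * exp (- real (snd p) * h)" using c1 unfolding exp_add by simp
      finally have "ennreal ((1 / c) ^ (snd p div P)) \<le> ennreal c * ennreal (exp (- real (snd p) * h))"
        using c1 by (simp add: ennreal_leI flip: ennreal_mult)
      moreover have "{\<omega> \<in> space ?M. sh \<omega> \<in> bowen_ball X f (fst p) (snd p) \<epsilon>} \<subseteq> A p"
        unfolding Ap cyl_def spM using same[OF _ \<omega>0(1) _ \<omega>0(2)] by blast
      ultimately show ?thesis using cyl[OF \<omega>0(1)] unfolding Ap by simp
    next
      case False
      thus ?thesis unfolding A_def spM by auto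
    qed
    have "1 = emeasure ?M (space ?M)" by (simp add: PP.emeasure_space_1)
    also have "\<dots> \<le> (\<integral>\<^sup>+ p. emeasure ?M (A p) \<partial>count_space C)"
    proof (rule emeasure_countable_cover_le)
      show "countable C" using C by (simp add: bowen_covers_def)
      show "space ?M \<subseteq> (\<Union>p\<in>C. A p)"
      proof
        fix \<omega> assume \<omega>: "\<omega> \<in> space ?M"
        hence "sh \<omega> \<in> Z" using sh(1) by (simp add: spM)
        hence "sh \<omega> \<in> (\<Union>(x,n)\<in>C. bowen_ball X f x n \<epsilon>)" using C unfolding bowen_covers_def by blast
        then obtain p where p: "p \<in> C" "sh \<omega> \<in> bowen_ball X f (fst p) (snd p) \<epsilon>" by (auto simp: case_prod_beta)
        hence "\<omega> \<in> A p" using A[of p] \<omega> by blast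
        thus "\<omega> \<in> (\<Union>p\<in>C. A p)" using p(1) by blast
      qed
    qed (use A in auto)
    also have "\<dots> \<le> (\<integral>\<^sup>+ p. ennreal c * ennreal (exp (- real (snd p) * h)) \<partial>count_space C)"
      using A by (intro nn_integral_mono) blast
    also have "\<dots> = ennreal c * (\<integral>\<^sup>+ p. ennreal (exp (- real (snd p) * h)) \<partial>count_space C)"
      by (intro nn_integral_cmult) simp
    finally have "ennreal (1 / c) * 1 \<le> ennreal (1 / c) * (ennreal c * (\<integral>\<^sup>+ p. ennreal (exp (- real (snd p) * h)) \<partial>count_space C))"
      by (rule mult_left_mono) simp
    also have "\<dots> = ennreal (1 / c * c) * (\<integral>\<^sup>+ p. ennreal (exp (- real (snd p) * h)) \<partial>count_space C)"
      using c1 by (subst ennreal_mult) (auto simp: mult.assoc)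
    also have "1 / c * c = 1" using c1 by simp
    finally show "ennreal (1 / c) \<le> (\<integral>\<^sup>+ p. ennreal (exp (- real (snd p) * h)) \<partial>count_space C)" by simp
  qed
  moreover have "ennreal (1 / c) > 0" using c1 by (simp add: ennreal_less_zero_iff)
  ultimately have "bowen_mN X f Z h 0 \<epsilon> \<noteq> 0" by auto
  thus ?thesis unfolding bowen_m_eq_0_iff h_def by blast
qed

text \<open>Three sources of error: \<open>b\<close> from the averages over words, \<open>b'\<close>
  from shadowing, and the incomplete last word, whose bounded contribution falls below
  \<open>b''\<close> after division by a large \<open>n\<close>.\<close>

lemma shadowed_average_bound:
  fixes g :: "'a \<Rightarrow> real"
  assumes P: "P > 0" and blk: "\<And>k. \<bar>(\<Sum>i<P. g (\<omega> k ! i)) - real P * c\<bar> \<le> real P * b"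
    and osc: "\<And>i. \<bar>g ((f ^^ i) x) - g (\<omega> (i div P) ! (i mod P))\<bar> \<le> b'"
    and B: "\<And>i. \<bar>g ((f ^^ i) x)\<bar> \<le> B" and b: "b'' > 0"
  shows "\<exists>N. \<forall>n\<ge>N. \<bar>(\<Sum>i<n. g ((f ^^ i) x)) / n - c\<bar> \<le> b + b' + b''"
proof -
  have b0: "0 \<le> b + b'"
  proof -
    have "0 \<le> real P * b" using blk[of 0] by linarith
    hence "0 \<le> b" using P by (simp add: zero_le_mult_iff)
    moreover have "0 \<le> b'" using osc[of 0] by linarith
    ultimately show ?thesis by simp
  qed
  have B0: "0 \<le> B + \<bar>c\<bar>" using B[of 0] by linarith
  have block: "\<bar>\<Sum>i=k*P..<k*P+P. g ((f ^^ i) x) - c\<bar> \<le> real P * (b + b')" for k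
  proof -
    have "(\<Sum>i=k*P..<k*P+P. g ((f ^^ i) x) - c) = (\<Sum>i<P. g ((f ^^ (i + k * P)) x) - c)"
      using sum.shift_bounds_nat_ivl[of "\<lambda>i. g ((f ^^ i) x) - c" 0 "k * P" P] by (simp add: lessThan_atLeast0 add.commute)
    also have "\<dots> = (\<Sum>i<P. g ((f ^^ (i + k * P)) x) - g (\<omega> k ! i)) + ((\<Sum>i<P. g (\<omega> k ! i)) - real P * c)"
      by (simp add: sum_subtractf)
    finally have eq: "(\<Sum>i=k*P..<k*P+P. g ((f ^^ i) x) - c) = \<dots>" .
    have "\<bar>\<Sum>i<P. g ((f ^^ (i + k * P)) x) - g (\<omega> k ! i)\<bar> \<le> (\<Sum>i<P. b')"
    proof (rule order_trans[OF sum_abs sum_mono])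
      fix i assume "i \<in> {..<P}"
      thus "\<bar>g ((f ^^ (i + k * P)) x) - g (\<omega> k ! i)\<bar> \<le> b'" using osc[of "i + k * P"] by simp
    qed
    thus ?thesis unfolding eq using blk[of k] by (simp add: algebra_simps)
  qed
  have tot: "\<bar>\<Sum>i<n. g ((f ^^ i) x) - c\<bar> \<le> real n * (b + b') + real P * (B + \<bar>c\<bar>)" for n
  proof -
    define m where "m = n div P"
    have mn: "m * P \<le> n" "n - m * P \<le> P"
      using P by (simp_all add: m_def minus_div_mult_eq_mod less_imp_le)
    have "(\<Sum>i<n. g ((f ^^ i) x) - c) = (\<Sum>i<m*P. g ((f ^^ i) x) - c) + (\<Sum>i=m*P..<n. g ((f ^^ i) x) - c)"
      using sum.atLeastLessThan_concat[of 0 "m*P" n "\<lambda>i. g ((f ^^ i) x) - c"] mn(1) by (simp add: lessThan_atLeast0)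
    also have "(\<Sum>i<m*P. g ((f ^^ i) x) - c) = (\<Sum>k<m. \<Sum>i=k*P..<k*P+P. g ((f ^^ i) x) - c)"
      by (rule sum.nat_group[symmetric])
    finally have "\<bar>\<Sum>i<n. g ((f ^^ i) x) - c\<bar> \<le> \<bar>\<Sum>k<m. \<Sum>i=k*P..<k*P+P. g ((f ^^ i) x) - c\<bar> + \<bar>\<Sum>i=m*P..<n. g ((f ^^ i) x) - c\<bar>"
      by (simp only: abs_triangle_ineq)
    also have "\<bar>\<Sum>k<m. \<Sum>i=k*P..<k*P+P. g ((f ^^ i) x) - c\<bar> \<le> (\<Sum>k<m. real P * (b + b'))"
      by (rule order_trans[OF sum_abs sum_mono]) (rule block)
    also have "\<dots> = real (m * P) * (b + b')" by simp
    also have "\<dots> \<le> real n * (b + b')" using mn(1) b0 by (intro mult_right_mono) (simp_all only: of_nat_le_iff)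
    also have "\<bar>\<Sum>i=m*P..<n. g ((f ^^ i) x) - c\<bar> \<le> (\<Sum>i=m*P..<n. B + \<bar>c\<bar>)"
      by (rule order_trans[OF sum_abs sum_mono]) (use B in \<open>smt (verit)\<close>)
    also have "\<dots> = real (n - m * P) * (B + \<bar>c\<bar>)" by simp
    also have "\<dots> \<le> real P * (B + \<bar>c\<bar>)" using mn(2) B0 by (intro mult_right_mono) (simp_all only: of_nat_le_iff)
    finally show ?thesis by simp
  qed
  obtain N where N: "real P * (B + \<bar>c\<bar>) < real N * b''" using ex_less_of_nat_mult[OF b] by blast
  show ?thesis
  proof (intro exI[of _ "Suc N"] allI impI)
    fix n assume n: "n \<ge> Suc N"
    have "real N * b'' \<le> real n * b''" using n b by (intro mult_right_mono) auto
    hence "\<bar>\<Sum>i<n. g ((f ^^ i) x) - c\<bar> \<le> real n * (b + b' + b'')" using tot[of n] N by (simp add: algebra_simps)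
    moreover have "(\<Sum>i<n. g ((f ^^ i) x)) / n - c = (\<Sum>i<n. g ((f ^^ i) x) - c) / n"
      using n by (simp add: sum_subtractf field_simps)
    ultimately show "\<bar>(\<Sum>i<n. g ((f ^^ i) x)) / n - c\<bar> \<le> b + b' + b''" using n by (simp add: field_simps)
  qed
qed

text \<open>The last clause ranges over all pairs, equal ones included, so the words may follow each
  other in any order.\<close>

definition free_words :: "real \<Rightarrow> nat \<Rightarrow> 'a list set \<Rightarrow> bool" where
  "free_words \<delta> P W \<longleftrightarrow> (\<forall>w\<in>W. length w = P \<and> set w \<subseteq> X \<and> (\<forall>i. Suc i < P \<longrightarrow> dist (f (w ! i)) (w ! Suc i) \<le> \<delta>)) \<and>
     (\<forall>v\<in>W. \<forall>w\<in>W. dist (f (v ! (P - 1))) (w ! 0) \<le> \<delta>)"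

lemma pseudo_orbit_free_words:
  assumes W: "free_words \<delta> P W" and P: "P > 0" and \<omega>: "\<And>k. \<omega> k \<in> W"
  shows "pseudo_orbit X f \<delta> (\<lambda>i. \<omega> (i div P) ! (i mod P))"
  unfolding pseudo_orbit_def
proof (intro conjI allI)
  fix i
  have w: "length (\<omega> k) = P" "set (\<omega> k) \<subseteq> X" "\<And>i. Suc i < P \<Longrightarrow> dist (f (\<omega> k ! i)) (\<omega> k ! Suc i) \<le> \<delta>"
    "\<And>j. dist (f (\<omega> k ! (P - 1))) (\<omega> j ! 0) \<le> \<delta>" for k
    using W \<omega> unfolding free_words_def by blast+
  show "\<omega> (i div P) ! (i mod P) \<in> X" using nth_mem[of "i mod P" "\<omega> (i div P)"] w(1,2)[of "i div P"] P by auto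
  show "dist (f (\<omega> (i div P) ! (i mod P))) (\<omega> (Suc i div P) ! (Suc i mod P)) \<le> \<delta>"
  proof (cases "Suc (i mod P) = P")
    case True
    hence "i mod P = P - 1" "Suc i mod P = 0" by (auto simp: mod_Suc)
    thus ?thesis using w(4)[of "i div P" "Suc i div P"] by simp
  next
    case False
    hence "Suc i mod P = Suc (i mod P)" "Suc i div P = i div P" "Suc (i mod P) < P"
      using P by (auto simp: mod_Suc div_Suc less_Suc_eq Suc_lessI)
    thus ?thesis using w(3)[of "i mod P" "i div P"] by simp
  qed
qed

text \<open>Each \<eta> in \<open>3 * \<eta>\<close> has its own source: averages over words,
  oscillation at distance \<epsilon>, and the incomplete last word. The bound holds at all large
  times, so every limit point is in \<open>U\<close>, which puts the shadowing points in
  \<open>Delta_sub\<close>.\<close>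

lemma free_words_entropy_le:
  fixes G :: "('a \<Rightarrow> real) set"
  assumes W: "finite W" "W \<noteq> {}" "free_words \<delta> P W" and P: "P > 0"
    and sep: "\<And>v w. v \<in> W \<Longrightarrow> w \<in> W \<Longrightarrow> v \<noteq> w \<Longrightarrow> \<exists>i<P. 4 * \<epsilon> \<le> dist (v ! i) (w ! i)"
    and sh: "\<And>xs. pseudo_orbit X f \<delta> xs \<Longrightarrow> \<exists>x\<in>X. \<forall>i. dist ((f ^^ i) x) (xs i) < \<epsilon>" and \<epsilon>: "\<epsilon> > 0"
    and G: "\<And>g. g \<in> G \<Longrightarrow> continuous_on X g" and \<eta>: "\<eta> > 0"
    and osc: "\<And>g x y. g \<in> G \<Longrightarrow> x \<in> X \<Longrightarrow> y \<in> X \<Longrightarrow> dist x y < \<epsilon> \<Longrightarrow> \<bar>g x - g y\<bar> \<le> \<eta>"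
    and avg: "\<And>g w. g \<in> G \<Longrightarrow> w \<in> W \<Longrightarrow> \<bar>(\<Sum>i<P. g (w ! i)) - real P * c g\<bar> \<le> real P * \<eta>"
    and U: "\<And>\<mu>. \<mu> \<in> Minv X f \<Longrightarrow> (\<And>g. g \<in> G \<Longrightarrow> \<bar>integral\<^sup>L \<mu> g - c g\<bar> \<le> 3 * \<eta>) \<Longrightarrow> \<mu> \<in> U"
  shows "ereal (ln (real (card W)) / real P) \<le> bowen_entropy X f (Delta_sub X f U)"
proof -
  have len: "length w = P" "set w \<subseteq> X" if "w \<in> W" for w using W(3) that by (auto simp: free_words_def)
  have "\<exists>x. x \<in> X \<and> (\<forall>i. dist ((f ^^ i) x) (\<omega> (i div P) ! (i mod P)) < \<epsilon>)" if "\<And>k. \<omega> k \<in> W" for \<omega>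
    using sh[OF pseudo_orbit_free_words[OF W(3) P, of \<omega>, OF that]] by blast
  then obtain x where x: "\<And>\<omega>. (\<And>k. \<omega> k \<in> W) \<Longrightarrow> x \<omega> \<in> X"
    "\<And>\<omega> i. (\<And>k. \<omega> k \<in> W) \<Longrightarrow> dist ((f ^^ i) (x \<omega>)) (\<omega> (i div P) ! (i mod P)) < \<epsilon>" by metis
  have mem: "x \<omega> \<in> Delta_sub X f U" if \<omega>: "\<And>k. \<omega> k \<in> W" for \<omega>
  proof -
    have "\<mu> \<in> U" if \<mu>: "\<mu> \<in> Vx X f (x \<omega>)" for \<mu>
    proof (rule U)
      show "\<mu> \<in> Minv X f" using Vx_subset_Minv[OF x(1)[of \<omega>, OF \<omega>]] \<mu> by blast
      fix g assume g: "g \<in> G"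
      obtain B where B: "B > 0" "\<And>x. x \<in> X \<Longrightarrow> \<bar>g x\<bar> \<le> B" using compact_continuous_bounded[OF compact_X G[OF g]] by blast
      have "\<exists>N. \<forall>n\<ge>N. \<bar>(\<Sum>i<n. g ((f ^^ i) (x \<omega>))) / n - c g\<bar> \<le> \<eta> + \<eta> + \<eta>"
      proof (rule shadowed_average_bound[OF P _ _ _ \<eta>, of g \<omega> _ _ _ _ B])
        show "\<bar>(\<Sum>i<P. g (\<omega> k ! i)) - real P * c g\<bar> \<le> real P * \<eta>" for k
          using \<omega> avg[OF g] by blast
        have "\<omega> (i div P) ! (i mod P) \<in> X" for i
          using nth_mem[of "i mod P" "\<omega> (i div P)"] len[OF \<omega>, of "i div P"] P by auto
        thus "\<bar>g ((f ^^ i) (x \<omega>)) - g (\<omega> (i div P) ! (i mod P))\<bar> \<le> \<eta>" for i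
          by (intro osc[OF g] funpow_in x \<omega>)
        show "\<bar>g ((f ^^ i) (x \<omega>))\<bar> \<le> B" for i by (intro B funpow_in x \<omega>)
      qed
      then obtain N where "\<And>n. n \<ge> N \<Longrightarrow> \<bar>(\<Sum>i<n. g ((f ^^ i) (x \<omega>))) / n - c g\<bar> \<le> \<eta> + \<eta> + \<eta>" by blast
      from Vx_average_bound[OF \<mu> x(1)[of \<omega>, OF \<omega>] G[OF g] this]
      show "\<bar>integral\<^sup>L \<mu> g - c g\<bar> \<le> 3 * \<eta>" by simp
    qed
    thus ?thesis using x(1)[of \<omega>, OF \<omega>] by (auto simp: Delta_sub_def)
  qed
  have "bowen_m X f (Delta_sub X f U) (ln (real (card W)) / real P) \<epsilon> \<noteq> 0"
    by (rule bowen_m_shadowed_words_pos[where sh = x, OF W(1,2) P sep]) (use x(2) mem in blast)+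
  hence "ereal (ln (real (card W)) / real P) \<le> bowen_h_eps X f (Delta_sub X f U) \<epsilon>" by (rule bowen_h_eps_ge)
  also have "\<dots> \<le> bowen_entropy X f (Delta_sub X f U)" unfolding bowen_entropy_SUP using \<epsilon> by (intro SUP_upper) simp
  finally show ?thesis .
qed

end

section \<open>Typical samples of orbit segments\<close>

text \<open>Sets that can be enclosed between a closed and an open set with a difference of
  arbitrarily small measure form a sigma-algebra containing the closed sets. The open side is
  carried along because complements exchange the two sides.\<close>

lemma probs_inner_regular:
  fixes X :: "'a::metric_space set"
  assumes X: "compact X" and \<nu>: "\<nu> \<in> probs X" and A: "A \<in> sets (borelX X)" and e: "e > 0"
  obtains K where "closedin (top_of_set X) K" "K \<subseteq> A" "measure \<nu> (A - K) < e"
proof -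
  interpret prob_space \<nu> using \<nu> by (simp add: probs_iff)
  have s\<nu>: "sets \<nu> = sets (borelX X)" using \<nu> by (simp add: probs_iff)
  have cl: "K \<in> sets \<nu>" if "closedin (top_of_set X) K" for K using sets_borelX_closed[OF that] s\<nu> by simp
  have op: "V \<in> sets \<nu>" if "openin (top_of_set X) V" for V using sets_borelX_open[OF that] s\<nu> by simp
  let ?P = "\<lambda>A. \<forall>e>0. \<exists>K V. closedin (top_of_set X) K \<and> openin (top_of_set X) V \<and> K \<subseteq> A \<and> A \<subseteq> V \<and> measure \<nu> (V - K) < e"
  have "A \<in> sigma_sets X {K. closedin (top_of_set X) K}"
    using A sets_borelX_closed_generated[OF compact_imp_closed[OF X]] by simp
  hence "?P A"
  proof induction
    case (Basic K)
    hence K: "closedin (top_of_set X) K" by simp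
    show ?case
    proof (intro allI impI)
      fix e :: real assume e: "e > 0"
      show "\<exists>K' V. closedin (top_of_set X) K' \<and> openin (top_of_set X) V \<and> K' \<subseteq> K \<and> K \<subseteq> V \<and> measure \<nu> (V - K') < e"
      proof (cases "K = {}")
        case True
        thus ?thesis using e by (intro exI[of _ "{}"]) auto
      next
        case False
        have clK: "closed K" using X K by (metis closedin_closed_eq compact_imp_closed)
        define V where "V n = {x \<in> X. infdist x K < 1 / real (Suc n)}" for n
        have opO: "openin (top_of_set X) (V n)" for n
        proof -
          have "openin (top_of_set X) (X \<inter> (\<lambda>x. infdist x K) -` {..<1 / real (Suc n)})"
            by (intro continuous_openin_preimage_gen continuous_intros open_lessThan)
          thus ?thesis by (simp add: V_def vimage_def Int_def)
        qed
        have dec: "decseq (\<lambda>n. V n - K)"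
        proof (rule decseq_SucI)
          fix n
          have "1 / real (Suc (Suc n)) \<le> 1 / real (Suc n)" by (intro divide_left_mono) auto
          thus "V (Suc n) - K \<subseteq> V n - K" unfolding V_def by auto
        qed
        have int: "(\<Inter>n. V n - K) = {}"
        proof (rule ccontr)
          assume "(\<Inter>n. V n - K) \<noteq> {}"
          then obtain x where x: "\<And>n. x \<in> V n" "x \<notin> K" by blast
          have "infdist x K > 0" using clK False x(2) by (simp add: infdist_pos_not_in_closed)
          then obtain n where "1 / real (Suc n) < infdist x K" using nat_approx_posE by blast
          thus False using x(1)[of n] by (simp add: V_def)
        qed
        have "(\<lambda>n. measure \<nu> (V n - K)) \<longlonglongrightarrow> measure \<nu> (\<Inter>n. V n - K)"
          using op[OF opO] cl[OF K] dec by (intro finite_Lim_measure_decseq) auto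
        hence "eventually (\<lambda>n. measure \<nu> (V n - K) < e) sequentially"
          using e unfolding int by (intro order_tendstoD(2)) auto
        then obtain n where n: "measure \<nu> (V n - K) < e" by (auto simp: eventually_sequentially)
        have "K \<subseteq> V n" using closedin_imp_subset[OF K] by (auto simp: V_def)
        thus ?thesis using K opO n by blast
      qed
    qed
  next
    case Empty
    show ?case by (intro allI impI exI[of _ "{}"]) auto
  next
    case (Compl A)
    show ?case
    proof (intro allI impI)
      fix e :: real assume e: "e > 0"
      from mp[OF spec[OF Compl.IH] e]
      obtain K V where KO: "closedin (top_of_set X) K" "openin (top_of_set X) V" "K \<subseteq> A" "A \<subseteq> V" "measure \<nu> (V - K) < e"
        by blast
      have "V \<subseteq> X" using openin_imp_subset[OF KO(2)] .
      hence "(X - K) - (X - V) = V - K" by blast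
      moreover have "closedin (top_of_set X) (X - V)" using KO(2) by (simp add: closedin_diff)
      moreover have "openin (top_of_set X) (X - K)" using KO(1) by (simp add: openin_diff)
      ultimately show "\<exists>K V. closedin (top_of_set X) K \<and> openin (top_of_set X) V \<and> K \<subseteq> X - A \<and> X - A \<subseteq> V \<and> measure \<nu> (V - K) < e"
        using KO by (intro exI[of _ "X - V"] exI[of _ "X - K"]) auto
    qed
  next
    case (Union A)
    show ?case
    proof (intro allI impI)
      fix e :: real assume e: "e > 0"
      \<comment> \<open>These tolerances add up to \<open>e / 2\<close>; the other half pays for
        cutting the union of the closed sets down to a finite, hence closed, union.\<close>
      have "\<exists>K V. closedin (top_of_set X) K \<and> openin (top_of_set X) V \<and> K \<subseteq> A n \<and> A n \<subseteq> V \<and> measure \<nu> (V - K) < e / 2 * (1/2) ^ Suc n" for n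
        by (rule mp[OF spec[OF Union.IH]]) (use e in simp)
      then obtain K V where KO: "\<And>n. closedin (top_of_set X) (K n)" "\<And>n. openin (top_of_set X) (V n)" "\<And>n. K n \<subseteq> A n" "\<And>n. A n \<subseteq> V n"
        "\<And>n. measure \<nu> (V n - K n) < e / 2 * (1/2) ^ Suc n" by metis
      let ?V = "\<Union>n. V n"
      have su: "(\<lambda>n. e / 2 * (1/2) ^ Suc n) sums (e / 2 * 1)" by (intro sums_mult power_half_series)
      have sm: "summable (\<lambda>n. measure \<nu> (V n - K n))"
        by (rule summable_comparison_test'[OF sums_summable[OF su], of 0]) (use KO(5) less_imp_le in auto)
      have Om: "V n \<in> sets \<nu>" "K n \<in> sets \<nu>" for n using op[OF KO(2)] cl[OF KO(1)] by auto
      have "measure \<nu> (?V - (\<Union>n. K n)) \<le> measure \<nu> (\<Union>n. V n - K n)"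
        using Om by (intro finite_measure_mono) auto
      also have "\<dots> \<le> (\<Sum>n. measure \<nu> (V n - K n))"
        using Om sm by (intro finite_measure_subadditive_countably) auto
      also have "\<dots> \<le> (\<Sum>n. e / 2 * (1/2) ^ Suc n)"
        by (intro suminf_le sm sums_summable[OF su]) (use KO(5) less_imp_le in blast)
      also have "\<dots> = e / 2" using sums_unique[OF su] by simp
      finally have le: "measure \<nu> (?V - (\<Union>n. K n)) \<le> e / 2" .
      have "(\<lambda>n. measure \<nu> (?V - (\<Union>i<n. K i))) \<longlonglongrightarrow> measure \<nu> (\<Inter>n. ?V - (\<Union>i<n. K i))"
      proof (rule finite_Lim_measure_decseq)
        show "range (\<lambda>n. ?V - (\<Union>i<n. K i)) \<subseteq> sets \<nu>" using Om by auto
        show "decseq (\<lambda>n. ?V - (\<Union>i<n. K i))" by (intro decseq_SucI) auto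
      qed
      also have "(\<Inter>n. ?V - (\<Union>i<n. K i)) = ?V - (\<Union>n. K n)" by auto
      finally have lim: "(\<lambda>n. measure \<nu> (?V - (\<Union>i<n. K i))) \<longlonglongrightarrow> measure \<nu> (?V - (\<Union>n. K n))" .
      have "eventually (\<lambda>n. measure \<nu> (?V - (\<Union>i<n. K i)) < e) sequentially"
        by (rule order_tendstoD(2)[OF lim]) (use le e in simp)
      then obtain n where n: "measure \<nu> (?V - (\<Union>i<n. K i)) < e" by (auto simp: eventually_sequentially)
      have "closedin (top_of_set X) (\<Union>i<n. K i)" using KO(1) by (intro closedin_Union) auto
      moreover have "openin (top_of_set X) ?V" using KO(2) by (intro openin_Union) auto
      moreover have "(\<Union>i<n. K i) \<subseteq> (\<Union>n. A n)" "(\<Union>n. A n) \<subseteq> ?V" using KO(3,4) by blast+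
      ultimately show "\<exists>K V. closedin (top_of_set X) K \<and> openin (top_of_set X) V \<and> K \<subseteq> (\<Union>n. A n) \<and> (\<Union>n. A n) \<subseteq> V \<and> measure \<nu> (V - K) < e"
        using n by blast
    qed
  qed
  from mp[OF spec[OF this] e]
  obtain K V where KO: "closedin (top_of_set X) K" "openin (top_of_set X) V" "K \<subseteq> A" "A \<subseteq> V" "measure \<nu> (V - K) < e"
    by blast
  have "measure \<nu> (A - K) \<le> measure \<nu> (V - K)"
    using KO op cl by (intro finite_measure_mono) auto
  thus ?thesis using that KO by (meson order_le_less_trans)
qed

lemma compact_closed_disjoint_separated:
  fixes S T :: "'a::metric_space set"
  assumes "compact S" "closed T" "S \<inter> T = {}"
  shows "\<exists>d>0. \<forall>x\<in>S. \<forall>y\<in>T. d \<le> dist x y"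
proof (cases "S = {} \<or> T = {}")
  case True
  thus ?thesis by (intro exI[of _ 1]) auto
next
  case False
  have "continuous_on S (\<lambda>x. infdist x T)" by (intro continuous_intros)
  then obtain x where x: "x \<in> S" "\<And>y. y \<in> S \<Longrightarrow> infdist x T \<le> infdist y T"
    using continuous_attains_inf[OF assms(1), of "\<lambda>x. infdist x T"] False by blast
  have "infdist x T > 0" using assms False x(1) by (intro infdist_pos_not_in_closed) auto
  moreover have "infdist x T \<le> dist y z" if "y \<in> S" "z \<in> T" for y z
    using x(2)[OF that(1)] infdist_le[OF that(2), of y] by simp
  ultimately show ?thesis by blast
qed

text \<open>The last assumption lets each property survive a smaller bound, so a minimum over
  finitely many indices works; this serves both the separation of cells and uniform
  continuity.\<close>

lemma finite_common_gap:
  fixes R :: "'i \<Rightarrow> real \<Rightarrow> bool"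
  assumes "finite I" "\<And>i. i \<in> I \<Longrightarrow> \<exists>d>0. R i d" "\<And>i d d'. R i d \<Longrightarrow> 0 < d' \<Longrightarrow> d' \<le> d \<Longrightarrow> R i d'"
  shows "\<exists>d>0. \<forall>i\<in>I. R i d"
  using assms(1,2)
proof (induction I rule: finite_induct)
  case empty
  show ?case by (intro exI[of _ 1]) simp
next
  case (insert i I)
  have "\<exists>d>0. \<forall>i\<in>I. R i d" by (rule insert.IH) (use insert.prems in blast)
  then obtain d where d: "d > 0" "\<forall>i\<in>I. R i d" by blast
  obtain d' where d': "d' > 0" "R i d'" using insert.prems by blast
  have "0 < min d d'" using d d' by simp
  moreover have "\<forall>j\<in>insert i I. R j (min d d')"
    using d d' assms(3)[of _ d "min d d'"] assms(3)[of i d' "min d d'"] by auto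
  ultimately show ?case by blast
qed

section \<open>Independent samples and the law of large numbers\<close>

lemma indep_vars_PiM_coordinates:
  assumes M: "prob_space M" and \<phi>: "(\<phi> :: 'a \<Rightarrow> real) \<in> borel_measurable M" and N: "N > (0::nat)"
  shows "prob_space.indep_vars (PiM {..<N} (\<lambda>_. M)) (\<lambda>_. borel) (\<lambda>j x. \<phi> (x j)) {..<N}"
    and "j < N \<Longrightarrow> distr (PiM {..<N} (\<lambda>_. M)) borel (\<lambda>x. \<phi> (x j)) = distr M borel \<phi>"
proof -
  let ?M = "PiM {..<N} (\<lambda>_. M)"
  let ?D = "distr M borel \<phi>"
  interpret M: prob_space M by fact
  interpret PM: prob_space ?M by (intro prob_space_PiM M)
  show d: "distr ?M borel (\<lambda>x. \<phi> (x j)) = distr M borel \<phi>" if "j < N" for j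
  proof -
    have "distr ?M borel (\<lambda>x. \<phi> (x j)) = distr (distr ?M M (\<lambda>x. x j)) borel \<phi>"
      using that \<phi> by (subst distr_distr) (auto simp: comp_def)
    also have "distr ?M M (\<lambda>x. x j) = M"
      using that M by (intro distr_PiM_component) auto
    finally show ?thesis .
  qed
  show "PM.indep_vars (\<lambda>_. borel) (\<lambda>j x. \<phi> (x j)) {..<N}"
  proof (subst PM.indep_vars_iff_distr_eq_PiM')
    show "{..<N} \<noteq> {}" using N by auto
    show "(\<lambda>x. \<phi> (x i)) \<in> borel_measurable ?M" if "i \<in> {..<N}" for i
      using that \<phi> by (intro measurable_compose[OF measurable_component_singleton]) auto
    have "distr ?M (PiM {..<N} (\<lambda>_. borel)) (\<lambda>x. \<lambda>i\<in>{..<N}. \<phi> (x i)) = distr ?M (PiM {..<N} (\<lambda>_. borel)) (compose {..<N} \<phi>)"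
      by (simp add: compose_def[abs_def])
    also have "\<dots> = distr ?M (PiM {..<N} (\<lambda>_. ?D)) (compose {..<N} \<phi>)"
      by (intro distr_cong sets_PiM_cong refl) auto
    also have "\<dots> = PiM {..<N} (\<lambda>_. distr M ?D \<phi>)"
      using \<phi> M M.prob_space_distr[OF \<phi>] by (intro distr_PiM_finite_prob_space') auto
    also have "\<dots> = PiM {..<N} (\<lambda>_. ?D)"
    proof -
      have "distr M ?D \<phi> = ?D" by (intro distr_cong) auto
      thus ?thesis by simp
    qed
    also have "\<dots> = PiM {..<N} (\<lambda>i. distr ?M borel (\<lambda>x. \<phi> (x i)))"
      by (intro PiM_cong refl) (simp add: d)
    finally show "distr ?M (PiM {..<N} (\<lambda>_. borel)) (\<lambda>x. \<lambda>i\<in>{..<N}. \<phi> (x i)) = PiM {..<N} (\<lambda>i. distr ?M borel (\<lambda>x. \<phi> (x i)))" .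
  qed
qed

text \<open>Hoeffding's inequality for a deviation \<open>N * \<gamma>\<close> of \<open>N\<close>
  summands, each in an interval of length \<open>2 * b\<close>; the resulting bound decays
  geometrically in \<open>N\<close>.\<close>

lemma iid_deviation_tendsto_0:
  fixes \<phi> :: "'a \<Rightarrow> real"
  assumes M: "prob_space M" and \<phi>: "\<phi> \<in> borel_measurable M" and B: "\<And>x. x \<in> space M \<Longrightarrow> \<bar>\<phi> x\<bar> \<le> B" and \<gamma>: "\<gamma> > 0"
  shows "(\<lambda>N. measure (PiM {..<N} (\<lambda>_. M)) {x \<in> space (PiM {..<N} (\<lambda>_. M)). real N * \<gamma> \<le> \<bar>(\<Sum>j<N. \<phi> (x j)) - real N * integral\<^sup>L M \<phi>\<bar>}) \<longlonglongrightarrow> 0"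
proof -
  interpret M: prob_space M by fact
  obtain x0 where "x0 \<in> space M" using M.not_empty by blast
  hence "0 \<le> B" using B[of x0] by linarith
  \<comment> \<open>Adding 1 keeps the interval from \<open>- b\<close> to \<open>b\<close>
    nondegenerate even when \<open>B\<close> is 0.\<close>
  define b where "b = B + 1"
  have b: "b > 0" "\<And>x. x \<in> space M \<Longrightarrow> \<bar>\<phi> x\<bar> \<le> b" using \<open>0 \<le> B\<close> by (auto simp: b_def intro: order_trans[OF B])
  have bound: "measure (PiM {..<N} (\<lambda>_. M)) {x \<in> space (PiM {..<N} (\<lambda>_. M)). real N * \<gamma> \<le> \<bar>(\<Sum>j<N. \<phi> (x j)) - real N * integral\<^sup>L M \<phi>\<bar>}
     \<le> 2 * exp (- (\<gamma>\<^sup>2 / (2 * b\<^sup>2))) ^ N" if N: "N > 0" for N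
  proof -
    let ?M = "PiM {..<N} (\<lambda>_. M)"
    interpret PM: prob_space ?M by (intro prob_space_PiM M)
    have m: "(\<lambda>x. \<phi> (x i)) \<in> borel_measurable ?M" if "i < N" for i
      using that \<phi> by (intro measurable_compose[OF measurable_component_singleton]) auto
    have ex: "PM.expectation (\<lambda>x. \<phi> (x i)) = integral\<^sup>L M \<phi>" if "i < N" for i
    proof -
      have "PM.expectation (\<lambda>x. \<phi> (x i)) = integral\<^sup>L (distr ?M borel (\<lambda>x. \<phi> (x i))) (\<lambda>y. y)"
        using m[OF that] by (subst integral_distr) auto
      also have "\<dots> = integral\<^sup>L M \<phi>"
        unfolding indep_vars_PiM_coordinates(2)[OF M \<phi> N that] using \<phi> by (subst integral_distr) auto
      finally show ?thesis .
    qed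
    interpret H: Hoeffding_ineq ?M "{..<N}" "\<lambda>j x. \<phi> (x j)" "\<lambda>_. - b" "\<lambda>_. b" "\<Sum>i<N. PM.expectation (\<lambda>x. \<phi> (x i))"
    proof unfold_locales
      show "finite {..<N}" by simp
      show "PM.indep_vars (\<lambda>_. borel) (\<lambda>j x. \<phi> (x j)) {..<N}" by (rule indep_vars_PiM_coordinates(1)[OF M \<phi> N])
      show "AE x in ?M. \<phi> (x i) \<in> {- b..b}" if "i \<in> {..<N}" for i
      proof (rule AE_I2)
        fix x assume "x \<in> space ?M"
        hence "x i \<in> space M" using that by (auto simp: space_PiM)
        thus "\<phi> (x i) \<in> {- b..b}" using b(2)[of "x i"] by auto
      qed
    qed simp
    have "PM.prob {x \<in> space ?M. real N * \<gamma> \<le> \<bar>(\<Sum>i<N. \<phi> (x i)) - (\<Sum>i<N. PM.expectation (\<lambda>x. \<phi> (x i)))\<bar>}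
       \<le> 2 * exp (- 2 * (real N * \<gamma>)\<^sup>2 / (\<Sum>i<N. (b - (- b))\<^sup>2))"
      using N b \<gamma> by (intro H.Hoeffding_ineq_abs_ge) auto
    also have "(\<Sum>i<N. PM.expectation (\<lambda>x. \<phi> (x i))) = real N * integral\<^sup>L M \<phi>" using ex by simp
    also have "- 2 * (real N * \<gamma>)\<^sup>2 / (\<Sum>i<N. (b - (- b))\<^sup>2) = real N * (- (\<gamma>\<^sup>2 / (2 * b\<^sup>2)))"
      using N b by (simp add: power2_eq_square field_simps)
    finally show ?thesis by (simp only: exp_of_nat_mult)
  qed
  have "(\<lambda>N. 2 * exp (- (\<gamma>\<^sup>2 / (2 * b\<^sup>2))) ^ N) \<longlonglongrightarrow> 2 * 0"
    using \<gamma> b by (intro tendsto_intros LIMSEQ_realpow_zero) auto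
  hence lim: "(\<lambda>N. 2 * exp (- (\<gamma>\<^sup>2 / (2 * b\<^sup>2))) ^ N) \<longlonglongrightarrow> 0" by simp
  show ?thesis
  proof (rule tendsto_sandwich[OF _ _ tendsto_const lim])
    show "eventually (\<lambda>N. measure (PiM {..<N} (\<lambda>_. M)) {x \<in> space (PiM {..<N} (\<lambda>_. M)). real N * \<gamma> \<le> \<bar>(\<Sum>j<N. \<phi> (x j)) - real N * integral\<^sup>L M \<phi>\<bar>}
     \<le> 2 * exp (- (\<gamma>\<^sup>2 / (2 * b\<^sup>2))) ^ N) sequentially"
      using eventually_gt_at_top[of 0] by eventually_elim (rule bound)
  qed simp
qed

lemma iid_typical_prob:
  fixes F :: "('a \<Rightarrow> real) set"
  assumes M: "prob_space M" and F: "finite F" "\<And>\<phi>. \<phi> \<in> F \<Longrightarrow> \<phi> \<in> borel_measurable M"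
    and B: "\<And>\<phi> x. \<phi> \<in> F \<Longrightarrow> x \<in> space M \<Longrightarrow> \<bar>\<phi> x\<bar> \<le> B" and \<gamma>: "\<gamma> > 0"
  shows "eventually (\<lambda>N. 1 / 2 \<le> measure (PiM {..<N} (\<lambda>_. M))
     {x \<in> space (PiM {..<N} (\<lambda>_. M)). \<forall>\<phi>\<in>F. \<bar>(\<Sum>j<N. \<phi> (x j)) - real N * integral\<^sup>L M \<phi>\<bar> < real N * \<gamma>}) sequentially"
proof -
  let ?M = "\<lambda>N::nat. PiM {..<N} (\<lambda>_. M)"
  let ?bad = "\<lambda>N \<phi>. {x \<in> space (?M N). real N * \<gamma> \<le> \<bar>(\<Sum>j<N. \<phi> (x j)) - real N * integral\<^sup>L M \<phi>\<bar>}"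
  have "(\<lambda>N. \<Sum>\<phi>\<in>F. measure (?M N) (?bad N \<phi>)) \<longlonglongrightarrow> (\<Sum>\<phi>\<in>F. 0)"
    by (intro tendsto_sum iid_deviation_tendsto_0[OF M F(2) B \<gamma>])
  hence "eventually (\<lambda>N. (\<Sum>\<phi>\<in>F. measure (?M N) (?bad N \<phi>)) < 1 / 2) sequentially"
    by (intro order_tendstoD(2)) auto
  thus ?thesis
  proof eventually_elim
    case (elim N)
    interpret PM: prob_space "?M N" by (intro prob_space_PiM M)
    have m: "(\<lambda>x. \<phi> (x i)) \<in> borel_measurable (?M N)" if "i < N" "\<phi> \<in> F" for i \<phi>
      using that F(2) by (intro measurable_compose[OF measurable_component_singleton]) auto
    have bad: "?bad N \<phi> \<in> sets (?M N)" if "\<phi> \<in> F" for \<phi>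
    proof -
      have "(\<lambda>x. \<bar>(\<Sum>j<N. \<phi> (x j)) - real N * integral\<^sup>L M \<phi>\<bar>) \<in> borel_measurable (?M N)"
        using m[OF _ that] by (intro borel_measurable_abs borel_measurable_diff borel_measurable_sum borel_measurable_const) auto
      thus ?thesis by (rule borel_measurable_le[OF borel_measurable_const])
    qed
    have "measure (?M N) (\<Union>\<phi>\<in>F. ?bad N \<phi>) \<le> (\<Sum>\<phi>\<in>F. measure (?M N) (?bad N \<phi>))"
      using F(1) bad by (intro PM.finite_measure_subadditive_finite) auto
    hence "1 / 2 \<le> 1 - measure (?M N) (\<Union>\<phi>\<in>F. ?bad N \<phi>)" using elim by simp
    also have "\<dots> = measure (?M N) (space (?M N) - (\<Union>\<phi>\<in>F. ?bad N \<phi>))"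
      using F(1) bad by (intro PM.prob_compl[symmetric]) auto
    also have "space (?M N) - (\<Union>\<phi>\<in>F. ?bad N \<phi>) = {x \<in> space (?M N). \<forall>\<phi>\<in>F. \<bar>(\<Sum>j<N. \<phi> (x j)) - real N * integral\<^sup>L M \<phi>\<bar> < real N * \<gamma>}"
      by auto
    finally show ?case .
  qed
qed

text \<open>A typical sequence of names has probability at most \<open>exp (- N * (H - \<gamma>))\<close>, so that half of
  the probability is carried only by at least \<open>exp (N * (H - \<gamma>)) / 2\<close> of them.\<close>

lemma many_typical_names:
  fixes X :: "'a::metric_space set" and J :: "'a \<Rightarrow> 'b" and F :: "('a \<Rightarrow> real) set"
  assumes \<nu>: "\<nu> \<in> probs X" and fin: "finite (J ` X)" and meas: "\<And>v. {x \<in> X. J x = v} \<in> sets (borelX X)"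
    and F: "finite F" "\<And>\<phi>. \<phi> \<in> F \<Longrightarrow> \<phi> \<in> borel_measurable (borelX X)" "\<And>\<phi> x. \<phi> \<in> F \<Longrightarrow> x \<in> X \<Longrightarrow> \<bar>\<phi> x\<bar> \<le> B" and \<gamma>: "\<gamma> > 0"
  shows "eventually (\<lambda>N. \<exists>T. finite T \<and> (\<forall>x\<in>T. \<forall>j<N. x j \<in> X) \<and>
      (\<forall>x\<in>T. \<forall>\<phi>\<in>F. \<bar>(\<Sum>j<N. \<phi> (x j)) - real N * integral\<^sup>L \<nu> \<phi>\<bar> < real N * \<gamma>) \<and>
      (\<forall>x\<in>T. \<forall>y\<in>T. (\<forall>j<N. J (x j) = J (y j)) \<longrightarrow> x = y) \<and>
      exp (real N * (part_entropy \<nu> X J - \<gamma>)) / 2 \<le> real (card T)) sequentially"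
proof -
  interpret prob_space \<nu> using \<nu> by (simp add: probs_iff)
  have s\<nu>: "sets \<nu> = sets (borelX X)" using \<nu> by (simp add: probs_iff)
  have sp: "space \<nu> = X" using space_probs[OF \<nu>] .
  define pr where "pr v = measure \<nu> {x \<in> X. J x = v}" for v
  define info where "info x = - ln (pr (J x))" for x
  have H: "integral\<^sup>L \<nu> info = part_entropy \<nu> X J"
    unfolding info_def[abs_def] pr_def by (rule part_entropy_integral[OF \<nu> fin meas, symmetric])
  have minfo: "info \<in> borel_measurable (borelX X)"
    unfolding info_def[abs_def] by (rule integral_finite_valued(2)[OF \<nu> fin meas, of "\<lambda>v. - ln (pr v)"])
  define Bi where "Bi = (\<Sum>v\<in>J ` X. \<bar>- ln (pr v)\<bar>)"
  have Bi: "\<bar>info x\<bar> \<le> Bi" if "x \<in> X" for x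
    unfolding info_def Bi_def by (rule member_le_sum[of "J x"]) (use that fin in auto)
  have mF: "\<phi> \<in> borel_measurable \<nu>" if "\<phi> \<in> insert info F" for \<phi>
    using that F(2) minfo s\<nu> measurable_cong_sets[of \<nu> "borelX X" borel borel] by blast
  have "eventually (\<lambda>N. 1 / 2 \<le> measure (PiM {..<N} (\<lambda>_. \<nu>))
     {x \<in> space (PiM {..<N} (\<lambda>_. \<nu>)). \<forall>\<phi>\<in>insert info F. \<bar>(\<Sum>j<N. \<phi> (x j)) - real N * integral\<^sup>L \<nu> \<phi>\<bar> < real N * \<gamma>}) sequentially"
  proof (rule iid_typical_prob[OF prob_space_axioms _ mF _ \<gamma>])
    show "\<bar>\<phi> x\<bar> \<le> max B Bi" if "\<phi> \<in> insert info F" "x \<in> space \<nu>" for \<phi> x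
      using that F(3) Bi unfolding sp by (fastforce simp: le_max_iff_disj)
  qed (use F(1) in auto)
  thus ?thesis
  proof eventually_elim
    case (elim N)
    let ?M = "PiM {..<N} (\<lambda>_. \<nu>)"
    interpret PM: prob_space ?M by (intro prob_space_PiM prob_space_axioms)
    interpret FP: finite_product_prob_space "\<lambda>_. \<nu>" "{..<N}" by standard simp
    define T0 where "T0 = {x \<in> space ?M. \<forall>\<phi>\<in>insert info F. \<bar>(\<Sum>j<N. \<phi> (x j)) - real N * integral\<^sup>L \<nu> \<phi>\<bar> < real N * \<gamma>}"
    define lab where "lab x = restrict (\<lambda>j. J (x j)) {..<N}" for x
    have X: "x j \<in> X" if "x \<in> space ?M" "j < N" for x j using that sp by (auto simp: space_PiM)
    have labs: "lab ` T0 \<subseteq> PiE {..<N} (\<lambda>_. J ` X)" 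
    proof
      fix l assume "l \<in> lab ` T0"
      then obtain x where "x \<in> T0" "l = lab x" by blast
      thus "l \<in> PiE {..<N} (\<lambda>_. J ` X)" unfolding lab_def T0_def using X by (simp add: restrict_PiE_iff)
    qed
    have finlab: "finite (lab ` T0)" using labs by (rule finite_subset) (use fin in \<open>auto intro!: finite_PiE\<close>)
    \<comment> \<open>One sample for each sequence of names, so that distinct elements of
      \<open>T\<close> have distinct names.\<close>
    define T where "T = inv_into T0 lab ` lab ` T0"
    have cT: "card T = card (lab ` T0)" unfolding T_def by (intro card_image inj_on_inv_into) simp
    have TT: "T \<subseteq> T0" unfolding T_def by (auto intro: inv_into_into)
    define cell where "cell l = PiE {..<N} (\<lambda>j. {x \<in> X. J x = l j})" for l
    have mc: "{x \<in> X. J x = v} \<in> sets \<nu>" for v using meas s\<nu> by simp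
    have cell_sets: "cell l \<in> sets ?M" for l unfolding cell_def using mc by (intro sets_PiM_I_finite) auto
    have cell_le: "measure ?M (cell l) \<le> exp (- (real N * (part_entropy \<nu> X J - \<gamma>)))" if l: "l \<in> lab ` T0" for l
    proof -
      obtain x where x: "x \<in> T0" "l = lab x" using l by blast
      have "measure ?M (cell l) = (\<Prod>j<N. pr (l j))"
        unfolding cell_def pr_def by (rule FP.finite_measure_PiM_emb) (rule mc)
      also have "\<dots> \<le> exp (- (real N * (part_entropy \<nu> X J - \<gamma>)))"
      proof (cases "\<exists>j<N. pr (l j) = 0")
        \<comment> \<open>A name through a null cell has mass 0; only in the other case may the
          logarithm of the product be split.\<close>
        case True
        hence z: "(\<Prod>j<N. pr (l j)) = 0" by auto
        show ?thesis unfolding z by simp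
      next
        case False
        hence pos: "pr (l j) > 0" if "j < N" for j using that by (auto simp: pr_def zero_less_measure_iff)
        have "ln (\<Prod>j<N. pr (l j)) = (\<Sum>j<N. ln (pr (l j)))" using pos by (subst ln_prod) (auto simp: less_imp_neq[symmetric])
        also have "\<dots> = - (\<Sum>j<N. info (x j))" unfolding x(2) lab_def info_def by (simp add: sum_negf)
        also have "\<dots> \<le> - (real N * (part_entropy \<nu> X J - \<gamma>))"
        proof -
          have "\<bar>(\<Sum>j<N. info (x j)) - real N * part_entropy \<nu> X J\<bar> < real N * \<gamma>" using x(1) H by (auto simp: T0_def)
          thus ?thesis unfolding right_diff_distrib by linarith
        qed
        finally have "ln (\<Prod>j<N. pr (l j)) \<le> - (real N * (part_entropy \<nu> X J - \<gamma>))" .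
        moreover have "(\<Prod>j<N. pr (l j)) > 0" using pos by (intro prod_pos) auto
        ultimately show ?thesis by (metis exp_le_cancel_iff exp_ln)
      qed
      finally show ?thesis .
    qed
    have "1 / 2 \<le> measure ?M T0" using elim by (simp only: T0_def)
    also have "\<dots> \<le> measure ?M (\<Union>l\<in>lab ` T0. cell l)"
    proof (rule PM.finite_measure_mono)
      show "T0 \<subseteq> (\<Union>l\<in>lab ` T0. cell l)"
      proof
        fix x assume x: "x \<in> T0"
        hence "x \<in> extensional {..<N}" "\<And>j. j < N \<Longrightarrow> x j \<in> X" using X by (auto simp: T0_def space_PiM PiE_def)
        hence "x \<in> cell (lab x)" by (auto simp: cell_def lab_def PiE_def)
        thus "x \<in> (\<Union>l\<in>lab ` T0. cell l)" using x by blast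
      qed
      show "(\<Union>l\<in>lab ` T0. cell l) \<in> sets ?M" using finlab cell_sets by (intro sets.finite_UN) auto
    qed
    also have "\<dots> \<le> (\<Sum>l\<in>lab ` T0. measure ?M (cell l))"
      using finlab cell_sets by (intro PM.finite_measure_subadditive_finite) auto
    also have "\<dots> \<le> (\<Sum>l\<in>lab ` T0. exp (- (real N * (part_entropy \<nu> X J - \<gamma>))))"
      by (intro sum_mono cell_le)
    also have "\<dots> = real (card T) * exp (- (real N * (part_entropy \<nu> X J - \<gamma>)))" by (simp add: cT)
    finally have half: "1 / 2 \<le> real (card T) * exp (- (real N * (part_entropy \<nu> X J - \<gamma>)))" .
    have "exp (real N * (part_entropy \<nu> X J - \<gamma>)) / 2 \<le> real (card T)"
    proof -
      have "1 / 2 \<le> c * exp (- y) \<Longrightarrow> exp y / 2 \<le> c" for c y :: real by (simp add: exp_minus field_simps)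
      from this[OF half] show ?thesis .
    qed
    moreover have "finite T" unfolding T_def using finlab by simp
    moreover have "\<forall>x\<in>T. \<forall>j<N. x j \<in> X" using TT X by (auto simp: T0_def)
    moreover have "\<forall>x\<in>T. \<forall>\<phi>\<in>F. \<bar>(\<Sum>j<N. \<phi> (x j)) - real N * integral\<^sup>L \<nu> \<phi>\<bar> < real N * \<gamma>" using TT by (auto simp: T0_def)
    moreover have "\<forall>x\<in>T. \<forall>y\<in>T. (\<forall>j<N. J (x j) = J (y j)) \<longrightarrow> x = y"
    proof (intro ballI impI)
      fix x y assume xy: "x \<in> T" "y \<in> T" "\<forall>j<N. J (x j) = J (y j)"
      obtain u w where u: "u \<in> lab ` T0" "x = inv_into T0 lab u" "w \<in> lab ` T0" "y = inv_into T0 lab w"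
        using xy(1,2) unfolding T_def by blast
      have "lab x = lab y" unfolding lab_def using xy(3) by (intro restrict_ext) auto
      hence "u = w" using u by (simp add: f_inv_into_f)
      thus "x = y" using u by simp
    qed
    ultimately show ?case by blast
  qed
qed

section \<open>The lower bound\<close>

lemma concat_map_upt_Suc: "concat (map b [0..<Suc N]) = concat (map b [0..<N]) @ b N"
  by simp

lemma length_concat_map_upt: "length (concat (map b [0..<N])) = (\<Sum>j<N. length (b j))"
  by (induction N) simp_all

lemma sum_list_map_concat_upt:
  fixes g :: "'a \<Rightarrow> real"
  shows "sum_list (map g (concat (map b [0..<N]))) = (\<Sum>j<N. sum_list (map g (b j)))"
  by (induction N) simp_all

lemma nth_concat_map_upt:
  assumes "j < N" "i < length (b j)"
  shows "(\<Sum>l<j. length (b l)) + i < length (concat (map b [0..<N])) \<and>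
    concat (map b [0..<N]) ! ((\<Sum>l<j. length (b l)) + i) = b j ! i"
  using assms(1)
proof (induction N)
  case (Suc N)
  show ?case
  proof (cases "j = N")
    case True
    thus ?thesis using assms(2) unfolding concat_map_upt_Suc
      by (simp add: nth_append length_concat_map_upt)
  next
    case False
    hence "j < N" using Suc.prems by simp
    thus ?thesis using Suc.IH unfolding concat_map_upt_Suc by (simp add: nth_append)
  qed
qed simp

lemma successively_concat_map_upt:
  assumes "\<And>j. j < N \<Longrightarrow> b j \<noteq> [] \<and> successively R (b j)"
    and "\<And>j. Suc j < N \<Longrightarrow> R (last (b j)) (hd (b (Suc j)))"
  shows "successively R (concat (map b [0..<N])) \<and>
    (N > 0 \<longrightarrow> concat (map b [0..<N]) \<noteq> [] \<and> hd (concat (map b [0..<N])) = hd (b 0) \<and> last (concat (map b [0..<N])) = last (b (N - 1)))"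
  using assms
proof (induction N)
  case (Suc N)
  have IH: "successively R (concat (map b [0..<N])) \<and>
    (N > 0 \<longrightarrow> concat (map b [0..<N]) \<noteq> [] \<and> hd (concat (map b [0..<N])) = hd (b 0) \<and> last (concat (map b [0..<N])) = last (b (N - 1)))"
    using Suc.prems by (intro Suc.IH) auto
  have bN: "b N \<noteq> []" "successively R (b N)" using Suc.prems(1)[of N] by auto
  show ?case
  proof (cases "N = 0")
    case True
    thus ?thesis using bN by simp
  next
    case False
    have "R (last (b (N - 1))) (hd (b N))" using Suc.prems(2)[of "N - 1"] False by simp
    thus ?thesis using IH bN False unfolding concat_map_upt_Suc by (simp add: successively_append_iff)
  qed
qed simp

lemma successively_nth:
  "successively R xs \<Longrightarrow> Suc i < length xs \<Longrightarrow> R (xs ! i) (xs ! Suc i)"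
proof (induction xs arbitrary: i)
  case (Cons a xs)
  thus ?case by (cases i) (auto simp: successively_Cons hd_conv_nth)
qed simp

text \<open>An exponential Chebyshev bound by \<open>card_word_tuples_le\<close>: a blank weighs
  \<open>1 / Z\<close>, every label \<open>exp (- \<mu>) / Z\<close>, and \<open>Z\<close>
  normalises the total to 1. A sequence with at most \<open>r\<close> labels weighs at least
  \<open>exp (- (\<mu> * r)) / Z ^ m\<close>. The parameter \<mu> stays free to balance the two
  terms of the bound.\<close>

lemma card_sparse_words:
  assumes A: "finite A" and \<mu>: "\<mu> \<ge> 0"
  shows "real (card {s \<in> PiE {..<m::nat} (\<lambda>_. insert None (Some ` A)). real (card {p. p < m \<and> s p \<noteq> None}) \<le> r})
    \<le> exp (\<mu> * r + real m * (real (card A) * exp (- \<mu>)))"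
proof -
  define Z where "Z = 1 + real (card A) * exp (- \<mu>)"
  have Z: "Z \<ge> 1" by (simp add: Z_def)
  define Q where "Q a = (if a = None then 1 else exp (- \<mu>)) / Z" for a :: "'a option"
  let ?A = "insert None (Some ` A)"
  have Q0: "Q a \<ge> 0" for a using Z by (simp add: Q_def)
  have sumQ: "(\<Sum>a\<in>?A. Q a) \<le> 1"
  proof -
    have "(\<Sum>a\<in>?A. Q a) = Q None + (\<Sum>a\<in>A. Q (Some a))" using A by (simp add: sum.reindex)
    also have "\<dots> = (1 + real (card A) * exp (- \<mu>)) / Z" by (simp add: Q_def add_divide_distrib)
    also have "\<dots> = 1" using Z by (simp flip: Z_def)
    finally show ?thesis by simp
  qed
  define c where "c = exp (- (\<mu> * r)) / Z ^ m"
  have c: "c > 0" using Z by (simp add: c_def)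
  let ?S = "{s \<in> PiE {..<m} (\<lambda>_. ?A). real (card {p. p < m \<and> s p \<noteq> None}) \<le> r}"
  let ?B = "{s \<in> PiE {..<m} (\<lambda>_. ?A). c \<le> (\<Prod>p<m. Q (s p))}"
  have "?S \<subseteq> ?B"
  proof
    fix s assume s: "s \<in> ?S"
    have "(\<Prod>p<m. Q (s p)) = (\<Prod>p<m. if s p = None then 1 else exp (- \<mu>)) / Z ^ m"
      by (simp add: Q_def prod_dividef)
    also have "(\<Prod>p<m. if s p = None then 1 else exp (- \<mu>)) = exp (- \<mu>) ^ card {p. p < m \<and> s p \<noteq> None}"
    proof -
      have "(\<Prod>p<m. if s p = None then 1 else exp (- \<mu>)) = (\<Prod>p\<in>{p. p < m \<and> s p \<noteq> None}. exp (- \<mu>))"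
        by (rule prod.mono_neutral_cong_right) auto
      thus ?thesis by simp
    qed
    also have "\<dots> = exp (- (\<mu> * real (card {p. p < m \<and> s p \<noteq> None})))"
      by (simp add: exp_of_nat_mult[symmetric] mult.commute)
    finally have "(\<Prod>p<m. Q (s p)) = exp (- (\<mu> * real (card {p. p < m \<and> s p \<noteq> None}))) / Z ^ m" .
    moreover have "\<mu> * real (card {p. p < m \<and> s p \<noteq> None}) \<le> \<mu> * r" using s \<mu> by (intro mult_left_mono) auto
    ultimately have "c \<le> (\<Prod>p<m. Q (s p))" unfolding c_def using Z by (simp add: divide_right_mono)
    thus "s \<in> ?B" using s by simp
  qed
  moreover have "finite ?B"
    by (rule finite_subset[of _ "PiE {..<m} (\<lambda>_. ?A)"]) (use A in \<open>auto intro!: finite_PiE\<close>)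
  ultimately have "real (card ?S) \<le> real (card ?B)" by (simp add: card_mono)
  also have "\<dots> \<le> 1 / c" by (rule card_word_tuples_le) (use A Q0 sumQ c in auto)
  also have "\<dots> = exp (\<mu> * r) * Z ^ m" by (simp add: c_def exp_minus field_simps)
  also have "\<dots> \<le> exp (\<mu> * r) * exp (real (card A) * exp (- \<mu>)) ^ m"
    using Z exp_ge_add_one_self[of "real (card A) * exp (- \<mu>)"] by (intro mult_left_mono power_mono) (auto simp: Z_def)
  also have "\<dots> = exp (\<mu> * r + real m * (real (card A) * exp (- \<mu>)))"
    by (simp add: exp_add exp_of_nat_mult)
  finally show ?thesis .
qed

lemma large_fibre:
  assumes T: "finite T" "T \<noteq> {}" and S: "finite S" "s ` T \<subseteq> S"
  shows "\<exists>a. real (card T) \<le> real (card S) * real (card {x \<in> T. s x = a})"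
proof (rule ccontr)
  assume "\<not> ?thesis"
  hence lt: "real (card S) * real (card {x \<in> T. s x = a}) < real (card T)" for a by (auto simp: not_le)
  have "real (card T) = (\<Sum>x\<in>T. 1)" by simp
  also have "\<dots> = (\<Sum>a\<in>s ` T. \<Sum>x\<in>{x \<in> T. s x = a}. 1)" by (rule sum.image_gen[OF T(1)])
  finally have eq: "real (card T) = (\<Sum>a\<in>s ` T. real (card {x \<in> T. s x = a}))" by simp
  have "real (card S) * real (card T) = (\<Sum>a\<in>s ` T. real (card S) * real (card {x \<in> T. s x = a}))"
    by (subst eq) (simp add: sum_distrib_left)
  also have "\<dots> < (\<Sum>a\<in>s ` T. real (card T))" using T lt by (intro sum_strict_mono) auto
  also have "\<dots> = real (card (s ` T)) * real (card T)" by simp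
  also have "\<dots> \<le> real (card S) * real (card T)" using S by (intro mult_right_mono) (auto intro: card_mono)
  finally show False by simp
qed

section \<open>Separated cells and connecting orbit pieces\<close>

context compact_system
begin

text \<open>Cells of a Borel partition may touch each other. Inner regularity gives closed parts
  carrying almost all the mass, and finitely many disjoint compact sets have a positive gap.\<close>

lemma separated_cells:
  assumes \<nu>: "\<nu> \<in> probs X" and \<xi>: "\<xi> \<in> finite_partitions X" and \<kappa>: "\<kappa> > 0"
  obtains D \<epsilon> where "D \<in> sets (borelX X)" "measure \<nu> (X - D) < \<kappa>" "\<epsilon> > 0"
    "\<And>x y. x \<in> D \<Longrightarrow> y \<in> D \<Longrightarrow> \<xi> x \<noteq> \<xi> y \<Longrightarrow> \<epsilon> \<le> dist x y"
proof -
  interpret prob_space \<nu> using \<nu> by (simp add: probs_iff)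
  have s\<nu>: "sets \<nu> = sets (borelX X)" using \<nu> by (simp add: probs_iff)
  have fin: "finite (\<xi> ` X)" and m\<xi>: "\<xi> \<in> borelX X \<rightarrow>\<^sub>M count_space UNIV" using \<xi> by (auto simp: finite_partitions_def)
  define cell where "cell v = {x \<in> X. \<xi> x = v}" for v
  have cell: "cell v \<in> sets (borelX X)" for v
    using measurable_sets[OF m\<xi>, of "{v}"] by (simp add: cell_def vimage_def Int_def conj_commute)
  \<comment> \<open>The extra 1 makes the losses of all cells add up to strictly less than \<kappa>,
    and keeps \<open>c\<close> positive.\<close>
  define c where "c = real (card (\<xi> ` X)) + 1"
  have c: "c > 0" by (simp add: c_def)
  have "\<exists>K. closedin (top_of_set X) K \<and> K \<subseteq> cell v \<and> measure \<nu> (cell v - K) < \<kappa> / c" for v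
    using probs_inner_regular[OF compact_X \<nu> cell, of "\<kappa> / c" v] \<kappa> c by (metis divide_pos_pos)
  then obtain K where K: "\<And>v. closedin (top_of_set X) (K v)" "\<And>v. K v \<subseteq> cell v" "\<And>v. measure \<nu> (cell v - K v) < \<kappa> / c" by metis
  define D where "D = (\<Union>v\<in>\<xi> ` X. K v)"
  have "closedin (top_of_set X) D" unfolding D_def using fin K(1) by (intro closedin_Union) auto
  hence D: "D \<in> sets (borelX X)" by (rule sets_borelX_closed)
  have Kc: "compact (K v)" for v using K(1) compact_X by (meson closedin_compact)
  have mm: "cell v - K v \<in> sets \<nu>" for v using cell K(1) sets_borelX_closed s\<nu> by (metis sets.Diff)
  have "X - D \<subseteq> (\<Union>v\<in>\<xi> ` X. cell v - K v)" by (auto simp: D_def cell_def)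
  hence "measure \<nu> (X - D) \<le> measure \<nu> (\<Union>v\<in>\<xi> ` X. cell v - K v)"
    using mm fin by (intro finite_measure_mono sets.finite_UN) auto
  also have "\<dots> \<le> (\<Sum>v\<in>\<xi> ` X. measure \<nu> (cell v - K v))"
    using mm fin by (intro finite_measure_subadditive_finite) auto
  also have "\<dots> \<le> (\<Sum>v\<in>\<xi> ` X. \<kappa> / c)" using K(3) less_imp_le by (intro sum_mono) blast
  also have "\<dots> < \<kappa>" using \<kappa> c by (simp add: c_def field_simps)
  finally have mD: "measure \<nu> (X - D) < \<kappa>" .
  have "\<exists>d>0. \<forall>p\<in>(\<xi> ` X) \<times> (\<xi> ` X). fst p \<noteq> snd p \<longrightarrow> (\<forall>x\<in>K (fst p). \<forall>y\<in>K (snd p). d \<le> dist x y)"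
  proof (rule finite_common_gap)
    show "finite ((\<xi> ` X) \<times> (\<xi> ` X))" using fin by simp
    fix p :: "nat \<times> nat"
    show "\<exists>d>0. fst p \<noteq> snd p \<longrightarrow> (\<forall>x\<in>K (fst p). \<forall>y\<in>K (snd p). d \<le> dist x y)"
    proof (cases "fst p = snd p")
      case True
      thus ?thesis by (intro exI[of _ 1]) simp
    next
      case False
      hence "K (fst p) \<inter> K (snd p) = {}" using K(2)[of "fst p"] K(2)[of "snd p"] unfolding cell_def by (smt (verit) disjoint_iff mem_Collect_eq subsetD)
      from compact_closed_disjoint_separated[OF Kc compact_imp_closed[OF Kc] this] show ?thesis by blast
    qed
  qed (meson order_trans)
  then obtain \<epsilon> where \<epsilon>: "\<epsilon> > 0"
    and gap: "\<forall>p\<in>(\<xi> ` X) \<times> (\<xi> ` X). fst p \<noteq> snd p \<longrightarrow> (\<forall>x\<in>K (fst p). \<forall>y\<in>K (snd p). \<epsilon> \<le> dist x y)"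
    by blast
  show ?thesis
  proof (rule that[OF D mD \<epsilon>])
    fix x y assume "x \<in> D" "y \<in> D" "\<xi> x \<noteq> \<xi> y"
    then obtain v w where vw: "v \<in> \<xi> ` X" "w \<in> \<xi> ` X" "x \<in> K v" "y \<in> K w" unfolding D_def by blast
    have "x \<in> cell v" "y \<in> cell w" using vw K(2) by blast+
    hence "v \<noteq> w" using \<open>\<xi> x \<noteq> \<xi> y\<close> by (simp add: cell_def)
    thus "\<epsilon> \<le> dist x y" using bspec[OF gap, of "(v, w)"] vw by simp
  qed
qed

text \<open>Transitivity gives one connecting orbit piece for every pair of balls of a finite cover,
  whence the common bound \<open>M\<close> on the lengths. As the piece depends only on the cells of
  its end points, sequences with equal cells can use equal connectors.\<close>

lemma bounded_connectors:
  assumes trans: "top_transitive X f" and \<delta>: "\<delta> > 0"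
  obtains q M :: nat and cell :: "'a \<Rightarrow> nat" and y :: "nat \<Rightarrow> nat \<Rightarrow> 'a" and n :: "nat \<Rightarrow> nat \<Rightarrow> nat"
    where "\<And>x. x \<in> X \<Longrightarrow> cell x < q"
      "\<And>x x'. x \<in> X \<Longrightarrow> x' \<in> X \<Longrightarrow> y (cell x) (cell x') \<in> X \<and> 1 \<le> n (cell x) (cell x') \<and> n (cell x) (cell x') \<le> M \<and>
        dist x (y (cell x) (cell x')) \<le> \<delta> \<and> dist ((f ^^ n (cell x) (cell x')) (y (cell x) (cell x'))) x' \<le> \<delta>"
proof -
  have "X \<subseteq> (\<Union>x\<in>X. ball x (\<delta>/2))" using \<delta> by auto
  then obtain C where C: "C \<subseteq> X" "finite C" "X \<subseteq> (\<Union>x\<in>C. ball x (\<delta>/2))"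
    by (rule compactE_image[OF compact_X, of X "\<lambda>x. ball x (\<delta>/2)", rotated]) auto
  obtain k and c :: "nat \<Rightarrow> 'a" where c: "C = c ` {i. i < k}"
    using finite_imp_nat_seg_image_inj_on[OF C(2)] by blast
  have cov: "\<exists>i<k. dist (c i) x < \<delta>/2" if "x \<in> X" for x
    using subsetD[OF C(3) that] unfolding c UN_iff by (auto simp: mem_ball simp del: divide_const_simps)
  let ?cell = "ball_label c k (\<delta>/2)"
  have "\<exists>y n. y \<in> X \<and> 1 \<le> n \<and> dist (c a) y < \<delta>/2 \<and> dist (c b) ((f ^^ n) y) < \<delta>/2" if "a < k" "b < k" for a b
  proof -
    have cX: "c a \<in> X" "c b \<in> X" using that C(1) c by auto
    let ?U = "\<lambda>z. X \<inter> ball z (\<delta>/2)"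
    have "openin (top_of_set X) (?U z)" for z by (intro openin_open_Int) simp
    moreover have "?U z \<noteq> {}" if "z \<in> X" for z using that \<delta> by (auto intro!: exI[of _ z])
    ultimately have "\<exists>n\<ge>1. (f ^^ n) ` ?U (c a) \<inter> ?U (c b) \<noteq> {}"
      using trans cX unfolding top_transitive_def by meson
    then obtain n where n: "n \<ge> 1" "(f ^^ n) ` ?U (c a) \<inter> ?U (c b) \<noteq> {}" by blast
    then obtain y where "y \<in> ?U (c a)" "(f ^^ n) y \<in> ?U (c b)" by blast
    thus ?thesis using n(1) by (intro exI[of _ y] exI[of _ n]) auto
  qed
  then obtain y n where yn: "\<And>a b. a < k \<Longrightarrow> b < k \<Longrightarrow> y a b \<in> X \<and> 1 \<le> n a b \<and> dist (c a) (y a b) < \<delta>/2 \<and> dist (c b) ((f ^^ n a b) (y a b)) < \<delta>/2"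
    by metis
  define M where "M = (\<Sum>a<k. \<Sum>b<k. n a b)"
  have M: "n a b \<le> M" if "a < k" "b < k" for a b
  proof -
    have "n a b \<le> (\<Sum>b<k. n a b)" using that by (intro member_le_sum) auto
    also have "\<dots> \<le> M" unfolding M_def using that by (intro member_le_sum) auto
    finally show ?thesis .
  qed
  show ?thesis
  proof (rule that[of ?cell k y n M])
    show "?cell x < k" if "x \<in> X" for x using ball_label(1)[OF cov[OF that]] .
    fix x x' assume x: "x \<in> X" "x' \<in> X"
    have lt: "?cell x < k" "?cell x' < k" using ball_label(1) cov x by blast+
    have d: "dist (c (?cell x)) x < \<delta>/2" "dist (c (?cell x')) x' < \<delta>/2" using ball_label(2) cov x by blast+
    note Y = yn[OF lt]
    have "dist x (y (?cell x) (?cell x')) \<le> \<delta>" using Y d(1) dist_triangle_half_r[of "c (?cell x)" x \<delta>] by (meson less_imp_le)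
    moreover have "dist ((f ^^ n (?cell x) (?cell x')) (y (?cell x) (?cell x'))) x' \<le> \<delta>"
      using Y d(2) dist_triangle_half_r[of "c (?cell x')" _ \<delta> x'] by (meson less_imp_le)
    ultimately show "y (?cell x) (?cell x') \<in> X \<and> 1 \<le> n (?cell x) (?cell x') \<and> n (?cell x) (?cell x') \<le> M \<and>
        dist x (y (?cell x) (?cell x')) \<le> \<delta> \<and> dist ((f ^^ n (?cell x) (?cell x')) (y (?cell x) (?cell x'))) x' \<le> \<delta>"
      using Y M[OF lt] by blast
  qed
qed

section \<open>Words traced along orbits\<close>

definition segment :: "nat \<Rightarrow> 'a \<Rightarrow> 'a list" where
  "segment n x = map (\<lambda>i. (f ^^ i) x) [0..<n]"

lemma length_segment [simp]: "length (segment n x) = n"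
  by (simp add: segment_def)

lemma segment_nth: "i < n \<Longrightarrow> segment n x ! i = (f ^^ i) x"
  by (simp add: segment_def)

lemma set_segment: "x \<in> X \<Longrightarrow> set (segment n x) \<subseteq> X"
  by (auto simp: segment_def funpow_in)

lemma sum_list_segment: "sum_list (map g (segment n x)) = (\<Sum>i<n. g ((f ^^ i) x))"
  by (simp add: segment_def comp_def sum_list_sum_nth atLeast0LessThan)

lemma hd_segment: "n > 0 \<Longrightarrow> hd (segment n x) = x"
  by (simp add: hd_conv_nth segment_nth flip: length_greater_0_conv)

lemma f_last_segment: "n > 0 \<Longrightarrow> f (last (segment n x)) = (f ^^ n) x"
  by (cases n) (simp_all add: segment_def)

lemma successively_segment: "\<delta> \<ge> 0 \<Longrightarrow> successively (\<lambda>u v. dist (f u) v \<le> \<delta>) (segment n x)"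
proof (induction n)
  case (Suc n)
  have "segment (Suc n) x = segment n x @ [(f ^^ n) x]" by (simp add: segment_def)
  thus ?case using Suc f_last_segment[of n x] by (cases "n = 0") (auto simp: successively_append_iff segment_def)
qed (simp add: segment_def)

text \<open>The connectors, started at \<open>y j\<close> with length \<open>n j\<close>, are
  parameters common to all sequences \<open>x\<close>, so all resulting words have the same
  length.\<close>

definition orbit_word :: "nat \<Rightarrow> nat \<Rightarrow> (nat \<Rightarrow> nat) \<Rightarrow> (nat \<Rightarrow> 'a) \<Rightarrow> (nat \<Rightarrow> 'a) \<Rightarrow> 'a list" where
  "orbit_word N L n y x = concat (map (\<lambda>j. segment L (x j) @ segment (n j) (y j)) [0..<N])"

lemma length_orbit_word: "length (orbit_word N L n y x) = (\<Sum>j<N. L + n j)"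
  unfolding orbit_word_def by (simp only: length_concat_map_upt length_append length_segment)

lemma orbit_word_nth:
  assumes "j < N" "i < L"
  shows "(\<Sum>l<j. L + n l) + i < (\<Sum>j<N. L + n j)" "orbit_word N L n y x ! ((\<Sum>l<j. L + n l) + i) = (f ^^ i) (x j)"
  using nth_concat_map_upt[OF assms(1), of i "\<lambda>j. segment L (x j) @ segment (n j) (y j)"] assms(2)
  by (auto simp: length_concat_map_upt nth_append segment_nth orbit_word_def)

lemma orbit_word_sum:
  fixes g :: "'a \<Rightarrow> real"
  shows "(\<Sum>i<(\<Sum>j<N. L + n j). g (orbit_word N L n y x ! i)) =
    (\<Sum>j<N. (\<Sum>i<L. g ((f ^^ i) (x j))) + (\<Sum>i<n j. g ((f ^^ i) (y j))))"
proof -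
  have "(\<Sum>i<(\<Sum>j<N. L + n j). g (orbit_word N L n y x ! i)) = sum_list (map g (orbit_word N L n y x))"
    by (simp add: sum_list_sum_nth atLeast0LessThan length_orbit_word)
  also have "\<dots> = (\<Sum>j<N. sum_list (map g (segment L (x j) @ segment (n j) (y j))))"
    unfolding orbit_word_def by (rule sum_list_map_concat_upt)
  finally show ?thesis by (simp add: sum_list_segment)
qed

text \<open>The index \<open>Suc j mod N\<close> sends the last connector back to the start: by
  \<open>yx\<close> it ends near \<open>x 0\<close> for every \<open>x\<close> in \<open>T\<close>,
  so each word can be followed by any other.\<close>

lemma free_orbit_words:
  assumes N: "N > 0" and L: "L > 0" and n: "\<And>j. j < N \<Longrightarrow> n j > 0" and \<delta>: "\<delta> \<ge> 0"
    and y: "\<And>j. j < N \<Longrightarrow> y j \<in> X" and x: "\<And>x j. x \<in> T \<Longrightarrow> j < N \<Longrightarrow> x j \<in> X"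
    and xy: "\<And>x j. x \<in> T \<Longrightarrow> j < N \<Longrightarrow> dist ((f ^^ L) (x j)) (y j) \<le> \<delta>"
    and yx: "\<And>x j. x \<in> T \<Longrightarrow> j < N \<Longrightarrow> dist ((f ^^ n j) (y j)) (x (Suc j mod N)) \<le> \<delta>"
  shows "free_words \<delta> (\<Sum>j<N. L + n j) (orbit_word N L n y ` T)"
proof -
  let ?P = "\<Sum>j<N. L + n j"
  let ?R = "\<lambda>u v. dist (f u) v \<le> \<delta>"
  let ?b = "\<lambda>x j. segment L (x j) @ segment (n j) (y j)"
  have ne: "segment m z \<noteq> []" if "m > 0" for m z using that by (simp flip: length_0_conv)
  have w: "successively ?R (orbit_word N L n y x)" "orbit_word N L n y x \<noteq> []" "hd (orbit_word N L n y x) = x 0"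
      "f (last (orbit_word N L n y x)) = (f ^^ n (N - 1)) (y (N - 1))" if xT: "x \<in> T" for x
  proof -
    have *: "successively ?R (concat (map (?b x) [0..<N])) \<and>
      (N > 0 \<longrightarrow> concat (map (?b x) [0..<N]) \<noteq> [] \<and> hd (concat (map (?b x) [0..<N])) = hd (?b x 0) \<and> last (concat (map (?b x) [0..<N])) = last (?b x (N - 1)))"
    proof (rule successively_concat_map_upt)
      fix j assume j: "j < N"
      show "?b x j \<noteq> [] \<and> successively ?R (?b x j)"
        using ne[OF L] ne[OF n[OF j]] successively_segment[OF \<delta>] xy[OF xT j] L n[OF j]
        by (auto simp: successively_append_iff f_last_segment hd_segment)
    next
      fix j assume j: "Suc j < N"
      hence j': "j < N" by simp
      show "?R (last (?b x j)) (hd (?b x (Suc j)))"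
        using ne[OF L] ne[OF n[OF j']] L n[OF j'] yx[OF xT j'] j by (simp add: f_last_segment hd_segment)
    qed
    have "n (N - 1) > 0" using n N by simp
    thus "successively ?R (orbit_word N L n y x)" "orbit_word N L n y x \<noteq> []" "hd (orbit_word N L n y x) = x 0"
      "f (last (orbit_word N L n y x)) = (f ^^ n (N - 1)) (y (N - 1))"
      using * N ne[OF L] ne[of "n (N - 1)"] L unfolding orbit_word_def by (auto simp: hd_segment f_last_segment)
  qed
  show ?thesis
    unfolding free_words_def
  proof (intro conjI ballI allI impI)
    fix w assume "w \<in> orbit_word N L n y ` T"
    then obtain x' where x': "x' \<in> T" "w = orbit_word N L n y x'" by blast
    show "length w = ?P" unfolding x'(2) by (rule length_orbit_word)
    show "set w \<subseteq> X" unfolding x'(2) orbit_word_def using set_segment x[OF x'(1)] y by fastforce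
    fix i assume "Suc i < ?P"
    thus "dist (f (w ! i)) (w ! Suc i) \<le> \<delta>"
      using successively_nth[OF w(1)[OF x'(1)], of i] unfolding x'(2) length_orbit_word by blast
  next
    fix v w assume "v \<in> orbit_word N L n y ` T" "w \<in> orbit_word N L n y ` T"
    then obtain u z where u: "u \<in> T" "v = orbit_word N L n y u" and z: "z \<in> T" "w = orbit_word N L n y z" by blast
    have "f (v ! (?P - 1)) = (f ^^ n (N - 1)) (y (N - 1))"
      using w(4)[OF u(1)] w(2)[OF u(1)] by (simp add: last_conv_nth u(2) length_orbit_word)
    moreover have "w ! 0 = z 0" using w(3)[OF z(1)] w(2)[OF z(1)] by (simp add: hd_conv_nth z(2))
    moreover have "dist ((f ^^ n (N - 1)) (y (N - 1))) (z (Suc (N - 1) mod N)) \<le> \<delta>" using yx[OF z(1), of "N - 1"] N by simp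
    ultimately show "dist (f (v ! (?P - 1))) (w ! 0) \<le> \<delta>" using N by simp
  qed
qed

lemma integral_block_sum:
  fixes g :: "'a \<Rightarrow> real"
  assumes \<nu>: "\<nu> \<in> Minv X f" and g: "g \<in> borel_measurable (borelX X)" "\<And>x. x \<in> X \<Longrightarrow> \<bar>g x\<bar> \<le> C"
  shows "(\<integral>x. (\<Sum>i<L. g ((f ^^ i) x)) \<partial>\<nu>) = real L * integral\<^sup>L \<nu> g"
proof -
  have p: "\<nu> \<in> probs X" using \<nu> by (simp add: Minv_def)
  have m: "(\<lambda>x. g ((f ^^ i) x)) \<in> borel_measurable (borelX X)" for i using g(1) by measurable
  have "integrable \<nu> (\<lambda>x. g ((f ^^ i) x))" for i
    by (rule probs_integrable_bounded[OF p m]) (use g(2) funpow_in in blast)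
  thus ?thesis using integral_invariant[OF \<nu> g(1)] by (simp add: Bochner_Integration.integral_sum)
qed

section \<open>Assembling free words for one partition\<close>

lemma uniform_oscillation:
  fixes G :: "('a \<Rightarrow> real) set"
  assumes "finite G" "\<And>g. g \<in> G \<Longrightarrow> continuous_on X g" "\<eta> > 0"
  shows "\<exists>d>0. \<forall>g\<in>G. \<forall>x\<in>X. \<forall>y\<in>X. dist x y < d \<longrightarrow> \<bar>g x - g y\<bar> \<le> \<eta>"
proof (rule finite_common_gap[OF assms(1)])
  fix g assume "g \<in> G"
  hence "uniformly_continuous_on X g" using assms(2) compact_X by (intro compact_uniformly_continuous)
  then obtain d where d: "d > 0" "\<And>x y. x \<in> X \<Longrightarrow> y \<in> X \<Longrightarrow> dist y x < d \<Longrightarrow> dist (g y) (g x) < \<eta>"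
    using assms(3) unfolding uniformly_continuous_on_def by meson
  show "\<exists>d>0. \<forall>x\<in>X. \<forall>y\<in>X. dist x y < d \<longrightarrow> \<bar>g x - g y\<bar> \<le> \<eta>"
    using d by (intro exI[of _ d]) (auto simp: dist_real_def less_imp_le)
qed (meson order_less_le_trans)

lemma common_bound:
  fixes G :: "('a \<Rightarrow> real) set"
  assumes "finite G" "\<And>g. g \<in> G \<Longrightarrow> continuous_on X g"
  obtains B where "B \<ge> 1" "\<And>g x. g \<in> G \<Longrightarrow> x \<in> X \<Longrightarrow> \<bar>g x\<bar> \<le> B"
proof -
  have "\<exists>B. B > 0 \<and> (\<forall>x\<in>X. \<bar>g x\<bar> \<le> B)" if "g \<in> G" for g
    using compact_continuous_bounded[OF compact_X assms(2)[OF that]] by metis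
  then obtain b where b: "\<And>g. g \<in> G \<Longrightarrow> b g > 0" "\<And>g x. g \<in> G \<Longrightarrow> x \<in> X \<Longrightarrow> \<bar>g x\<bar> \<le> b g" by metis
  show ?thesis
  proof (rule that[of "1 + (\<Sum>g\<in>G. b g)"])
    show "1 \<le> 1 + (\<Sum>g\<in>G. b g)" using sum_nonneg[of G b] b(1)[THEN less_imp_le] by simp
    fix g x assume gx: "g \<in> G" "x \<in> X"
    have "b g \<le> (\<Sum>g\<in>G. b g)" using gx(1) assms(1) b(1) less_imp_le by (intro member_le_sum) auto
    thus "\<bar>g x\<bar> \<le> 1 + (\<Sum>g\<in>G. b g)" using b(2)[OF gx] by simp
  qed
qed

text \<open>For an orbit sequence, \<open>sig\<close> records the names at the times outside the well separated set
  \<open>D\<close> together with the cells in which the orbit segments start and end; sequences with equal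
  signature admit common connectors, and if they are distinct they are \<open>4 * \<epsilon>\<close>-separated.\<close>

lemma less_ent_part_le_bowen_entropy_Delta_sub:
  fixes G :: "('a \<Rightarrow> real) set"
  assumes trans: "top_transitive X f" and shad: "shadowing X f"
    and \<nu>: "\<nu> \<in> Minv X f" and \<xi>: "\<xi> \<in> finite_partitions X" and h: "h < ent_part \<nu> X f \<xi>"
    and G: "finite G" "\<And>g. g \<in> G \<Longrightarrow> continuous_on X g" and \<eta>: "\<eta> > 0"
    and U: "\<And>\<mu>. \<mu> \<in> Minv X f \<Longrightarrow> (\<And>g. g \<in> G \<Longrightarrow> \<bar>integral\<^sup>L \<mu> g - integral\<^sup>L \<nu> g\<bar> \<le> 3 * \<eta>) \<Longrightarrow> \<mu> \<in> U"
  shows "ereal h \<le> bowen_entropy X f (Delta_sub X f U)"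
proof -
  have p: "\<nu> \<in> probs X" using \<nu> by (simp add: Minv_def)
  interpret prob_space \<nu> using p by (simp add: probs_iff)
  have s\<nu>: "sets \<nu> = sets (borelX X)" using p by (simp add: probs_iff)
  define h0 where "h0 = ent_part \<nu> X f \<xi>"
  \<comment> \<open>The budget of \<open>8 * \<gamma>\<close>: three for the number of typical
    sequences (finite block length, deviation, factor 1/2), three for the signatures, two for the
    extra length of the connectors.\<close>
  define \<gamma> where "\<gamma> = (h0 - h) / 8"
  have \<gamma>: "\<gamma> > 0" "h0 = h + 8 * \<gamma>" using h unfolding \<gamma>_def h0_def by (simp_all add: field_simps)
  define k where "k = real (card (\<xi> ` X))"
  \<comment> \<open>Large enough for \<open>k * exp (- \<mu>) \<le> \<gamma>\<close> in the count of
    sparse names.\<close>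
  define \<mu> where "\<mu> = k / \<gamma>"
  have \<mu>: "\<mu> \<ge> 0" using \<gamma> by (simp add: \<mu>_def k_def)
  have k\<mu>: "k * exp (- \<mu>) \<le> \<gamma>"
  proof -
    have "\<mu> \<le> exp \<mu>" using exp_ge_add_one_self[of \<mu>] by linarith
    hence "\<mu> * \<gamma> \<le> exp \<mu> * \<gamma>" using \<gamma> by (intro mult_right_mono) auto
    hence "k \<le> \<gamma> * exp \<mu>" using \<gamma> by (simp add: \<mu>_def mult.commute)
    thus ?thesis by (simp add: exp_minus field_simps)
  qed
  define \<kappa> where "\<kappa> = \<gamma> / (\<mu> + 1)"
  have \<kappa>: "\<kappa> > 0" "\<mu> * \<kappa> \<le> \<gamma>" using \<mu> \<gamma> by (simp_all add: \<kappa>_def field_simps)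
  obtain D \<epsilon>0 where D: "D \<in> sets (borelX X)" "measure \<nu> (X - D) < \<kappa> / 2" and \<epsilon>0: "\<epsilon>0 > 0"
    and Dsep: "\<And>x y. x \<in> D \<Longrightarrow> y \<in> D \<Longrightarrow> \<xi> x \<noteq> \<xi> y \<Longrightarrow> \<epsilon>0 \<le> dist x y"
    using separated_cells[OF p \<xi>, of "\<kappa> / 2"] \<kappa>(1) by (metis half_gt_zero)
  obtain e1 where e1: "e1 > 0" "\<forall>g\<in>G. \<forall>x\<in>X. \<forall>y\<in>X. dist x y < e1 \<longrightarrow> \<bar>g x - g y\<bar> \<le> \<eta>"
    using uniform_oscillation[OF G \<eta>] by blast
  \<comment> \<open>A quarter of the gap for the separation by \<open>4 * \<epsilon>\<close>, and at
    most \<open>e1\<close> for the oscillation of the test functions.\<close>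
  define \<epsilon> where "\<epsilon> = min (\<epsilon>0 / 4) e1"
  have \<epsilon>: "\<epsilon> > 0" "4 * \<epsilon> \<le> \<epsilon>0" "\<epsilon> \<le> e1" using \<epsilon>0 e1 by (auto simp: \<epsilon>_def)
  obtain \<delta> where \<delta>: "\<delta> > 0" "\<And>xs. pseudo_orbit X f \<delta> xs \<Longrightarrow> \<exists>x\<in>X. \<forall>i. dist ((f ^^ i) x) (xs i) < \<epsilon>"
    using shad \<epsilon>(1) unfolding shadowing_def by meson
  obtain q M :: nat and cell :: "'a \<Rightarrow> nat" and Y :: "nat \<Rightarrow> nat \<Rightarrow> 'a" and con :: "nat \<Rightarrow> nat \<Rightarrow> nat"
    where cell: "\<And>x. x \<in> X \<Longrightarrow> cell x < q"
      and con: "\<And>x x'. x \<in> X \<Longrightarrow> x' \<in> X \<Longrightarrow> Y (cell x) (cell x') \<in> X \<and> 1 \<le> con (cell x) (cell x') \<and> con (cell x) (cell x') \<le> M \<and>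
        dist x (Y (cell x) (cell x')) \<le> \<delta> \<and> dist ((f ^^ con (cell x) (cell x')) (Y (cell x) (cell x'))) x' \<le> \<delta>"
    by (rule bounded_connectors[OF trans \<delta>(1)]) (rule that)
  obtain B where B: "B \<ge> 1" "\<And>g x. g \<in> G \<Longrightarrow> x \<in> X \<Longrightarrow> \<bar>g x\<bar> \<le> B" using common_bound[OF G] by blast
  have intB: "\<bar>integral\<^sup>L \<nu> g\<bar> \<le> B" if "g \<in> G" for g
  proof -
    have i: "integrable \<nu> g" by (rule probs_integrable[OF compact_X p G(2)[OF that]])
    have "integral\<^sup>L \<nu> g \<le> B" using B(2)[OF that] space_probs[OF p]
      by (intro integral_le_const[OF i] AE_I2) (auto simp: abs_le_iff)
    moreover have "- B \<le> integral\<^sup>L \<nu> g" using B(2)[OF that] space_probs[OF p]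
      by (intro integral_ge_const[OF i] AE_I2) (auto simp: abs_le_iff minus_le_iff)
    ultimately show ?thesis by (simp add: abs_le_iff)
  qed
  let ?J = "\<lambda>L. join_part f \<xi> L"
  obtain L where L: "L > 0" "real L * (h0 - \<gamma>) \<le> part_entropy \<nu> X (?J L)"
    "2 * ln (real q) \<le> real L * \<gamma>" "h * real M \<le> real L * (2 * \<gamma>)" "4 * B * real M \<le> real L * \<eta>"
  proof -
    \<comment> \<open>As \<open>q\<close> and \<open>M\<close> are fixed before \<open>L\<close>, a
      long block makes negligible, in this order, the cells in the signature, the length of the
      connectors and their share in the averages.\<close>
    define c where "c = max (2 * ln (real q) / \<gamma>) (max (h * real M / (2 * \<gamma>)) (4 * B * real M / \<eta>))"
    have "eventually (\<lambda>n. h0 - \<gamma> < part_entropy \<nu> X (?J n) / real n) sequentially"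
      using ent_part_LIMSEQ[OF \<nu> \<xi>] \<gamma>(1) unfolding h0_def by (intro order_tendstoD(1)) auto
    moreover have "eventually (\<lambda>n. n > 0 \<and> c \<le> real n) sequentially"
      by (intro eventually_conj eventually_gt_at_top eventually_sequentiallyI[of "nat \<lceil>c\<rceil>"]) linarith
    ultimately have "eventually (\<lambda>n. h0 - \<gamma> < part_entropy \<nu> X (?J n) / real n \<and> n > 0 \<and> c \<le> real n) sequentially"
      by (rule eventually_conj)
    then obtain n where n: "h0 - \<gamma> < part_entropy \<nu> X (?J n) / real n" "n > 0" "c \<le> real n"
      by (auto simp: eventually_sequentially)
    have "2 * ln (real q) / \<gamma> \<le> real n" "h * real M / (2 * \<gamma>) \<le> real n" "4 * B * real M / \<eta> \<le> real n"
      using n(3) by (auto simp: c_def)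
    thus ?thesis using n(1,2) \<gamma>(1) \<eta> by (intro that[of n]) (auto simp: field_simps)
  qed
  define bad where "bad x = (if x \<in> D then 0 else 1 :: real)" for x
  define z where "z x = (\<Sum>i<L. bad ((f ^^ i) x))" for x
  define S where "S g x = (\<Sum>i<L. g ((f ^^ i) x))" for g :: "'a \<Rightarrow> real" and x
  have mbad: "bad \<in> borel_measurable (borelX X)" unfolding bad_def using D(1) by measurable
  have intz: "integral\<^sup>L \<nu> z \<le> real L * (\<kappa> / 2)"
  proof -
    have "integral\<^sup>L \<nu> bad = integral\<^sup>L \<nu> (indicator (X - D))"
      using space_probs[OF p] by (intro Bochner_Integration.integral_cong) (auto simp: bad_def)
    also have "\<dots> = measure \<nu> (X - D)" using space_probs[OF p] D(1) s\<nu> by (simp add: Int_absorb2)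
    finally have "integral\<^sup>L \<nu> bad \<le> \<kappa> / 2" using D(2) by simp
    moreover have "integral\<^sup>L \<nu> z = real L * integral\<^sup>L \<nu> bad"
      unfolding z_def[abs_def] by (rule integral_block_sum[OF \<nu> mbad, of 1]) (simp add: bad_def)
    ultimately show ?thesis by (simp only: mult_left_mono of_nat_0_le_iff)
  qed
  have intS: "integral\<^sup>L \<nu> (S g) = real L * integral\<^sup>L \<nu> g" if "g \<in> G" for g
    unfolding S_def[abs_def] by (rule integral_block_sum[OF \<nu> borelX_measurable_continuous[OF G(2)[OF that]] B(2)[OF that]])
  \<comment> \<open>One tolerance for three uses: entropy (\<gamma>), visits outside
    \<open>D\<close> (\<open>\<kappa> / 2\<close> on top of a mean of at most
    \<open>\<kappa> / 2\<close>) and averages (\<open>\<eta> / 2\<close>).\<close>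
  define \<gamma>1 where "\<gamma>1 = min \<gamma> (min (\<kappa> / 2) (\<eta> / 2))"
  have \<gamma>1: "\<gamma>1 > 0" "\<gamma>1 \<le> \<gamma>" "\<gamma>1 \<le> \<kappa> / 2" "\<gamma>1 \<le> \<eta> / 2" using \<gamma> \<kappa> \<eta> by (auto simp: \<gamma>1_def)
  define typical where "typical N T \<longleftrightarrow> finite T \<and> (\<forall>x\<in>T. \<forall>j<N. x j \<in> X) \<and>
      (\<forall>x\<in>T. \<forall>\<phi>\<in>insert z (S ` G). \<bar>(\<Sum>j<N. \<phi> (x j)) - real N * integral\<^sup>L \<nu> \<phi>\<bar> < real N * \<gamma>1) \<and>
      (\<forall>x\<in>T. \<forall>y\<in>T. (\<forall>j<N. ?J L (x j) = ?J L (y j)) \<longrightarrow> x = y) \<and>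
      exp (real N * (part_entropy \<nu> X (?J L) - \<gamma>1)) / 2 \<le> real (card T)" for N and T :: "(nat \<Rightarrow> 'a) set"
  have evT: "eventually (\<lambda>N. \<exists>T. typical N T) sequentially"
    unfolding typical_def
  proof (rule many_typical_names[OF p finite_join_part[OF \<xi>] join_part_measurable[OF \<xi>] _ _ _ \<gamma>1(1), where B = "real L * B"])
    show "finite (insert z (S ` G))" using G(1) by simp
    fix \<phi> assume \<phi>: "\<phi> \<in> insert z (S ` G)"
    then obtain g where g: "\<phi> = (\<lambda>x. \<Sum>i<L. g ((f ^^ i) x))" "g \<in> borel_measurable (borelX X)" "\<And>x. x \<in> X \<Longrightarrow> \<bar>g x\<bar> \<le> B"
    proof (cases "\<phi> = z")
      case True
      thus ?thesis using mbad B(1) by (intro that[of bad]) (auto simp: z_def[abs_def] bad_def)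
    next
      case False
      then obtain g where "g \<in> G" "\<phi> = S g" using \<phi> by blast
      thus ?thesis using B(2) borelX_measurable_continuous[OF G(2)] by (intro that[of g]) (auto simp: S_def[abs_def])
    qed
    have mg: "(\<lambda>x. g ((f ^^ i) x)) \<in> borel_measurable (borelX X)" for i using g(2) by measurable
    show "\<phi> \<in> borel_measurable (borelX X)" unfolding g(1) by (intro borel_measurable_sum mg)
    fix x assume x: "x \<in> X"
    have "\<bar>\<Sum>i<L. g ((f ^^ i) x)\<bar> \<le> (\<Sum>i<L. B)"
      by (rule order_trans[OF sum_abs sum_mono]) (use g(3) funpow_in[OF x] in blast)
    thus "\<bar>\<phi> x\<bar> \<le> real L * B" unfolding g(1) by simp
  qed
  have "eventually (\<lambda>N. N > 0 \<and> ln 2 / (real L * \<gamma>) \<le> real N) sequentially"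
    by (intro eventually_conj eventually_gt_at_top eventually_sequentiallyI[of "nat \<lceil>ln 2 / (real L * \<gamma>)\<rceil>"]) linarith
  from eventually_happens'[OF sequentially_bot eventually_conj[OF this evT]]
  obtain N T where N: "N > 0" "ln 2 / (real L * \<gamma>) \<le> real N" and T_typ: "typical N T" by blast
  have T: "finite T" "\<And>x j. x \<in> T \<Longrightarrow> j < N \<Longrightarrow> x j \<in> X"
      "\<And>x \<phi>. x \<in> T \<Longrightarrow> \<phi> \<in> insert z (S ` G) \<Longrightarrow> \<bar>(\<Sum>j<N. \<phi> (x j)) - real N * integral\<^sup>L \<nu> \<phi>\<bar> < real N * \<gamma>1"
      "\<And>x y. x \<in> T \<Longrightarrow> y \<in> T \<Longrightarrow> (\<forall>j<N. ?J L (x j) = ?J L (y j)) \<Longrightarrow> x = y"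
      "exp (real N * (part_entropy \<nu> X (?J L) - \<gamma>1)) / 2 \<le> real (card T)"
  proof -
    note c1 = T_typ[unfolded typical_def]
    note c2 = conjunct2[OF c1]
    note c3 = conjunct2[OF c2]
    note c4 = conjunct2[OF c3]
    show "finite T" by (rule conjunct1[OF c1])
    show "x j \<in> X" if "x \<in> T" "j < N" for x j using conjunct1[OF c2] that by blast
    show "\<bar>(\<Sum>j<N. \<phi> (x j)) - real N * integral\<^sup>L \<nu> \<phi>\<bar> < real N * \<gamma>1" if "x \<in> T" "\<phi> \<in> insert z (S ` G)" for x \<phi>
      by (rule bspec[OF bspec[OF conjunct1[OF c3] that(1)] that(2)])
    show "x = y" if "x \<in> T" "y \<in> T" "\<forall>j<N. ?J L (x j) = ?J L (y j)" for x y
      by (rule mp[OF bspec[OF bspec[OF conjunct1[OF c4] that(1)] that(2)] that(3)])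
    show "exp (real N * (part_entropy \<nu> X (?J L) - \<gamma>1)) / 2 \<le> real (card T)" by (rule conjunct2[OF c4])
  qed
  define R where "R = real N * real L"
  have R: "R > 0" "real N \<le> R" using N(1) L(1) by (simp_all add: R_def)
  have half: "exp (- (R * \<gamma>)) \<le> 1 / 2"
  proof -
    have "ln 2 \<le> R * \<gamma>" using N(2) L(1) \<gamma>(1) by (simp add: R_def field_simps)
    hence "exp (- (R * \<gamma>)) \<le> exp (- ln 2)" by simp
    thus ?thesis by (simp add: exp_minus)
  qed
  have cardT: "exp (R * (h0 - 3 * \<gamma>)) \<le> real (card T)"
  proof -
    have "R * (h0 - 3 * \<gamma>) \<le> real N * (part_entropy \<nu> X (?J L) - \<gamma>1) + - (R * \<gamma>)"
    proof -
      have "real N * (real L * (h0 - \<gamma>)) \<le> real N * part_entropy \<nu> X (?J L)" using L(2) by (intro mult_left_mono) auto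
      moreover have "real N * \<gamma>1 \<le> R * \<gamma>" using R(2) \<gamma>1(1,2) by (intro mult_mono) auto
      ultimately show ?thesis by (simp add: R_def algebra_simps)
    qed
    hence "exp (R * (h0 - 3 * \<gamma>)) \<le> exp (real N * (part_entropy \<nu> X (?J L) - \<gamma>1)) * exp (- (R * \<gamma>))"
      by (simp flip: exp_add)
    also have "\<dots> \<le> exp (real N * (part_entropy \<nu> X (?J L) - \<gamma>1)) * (1 / 2)" using half by (intro mult_left_mono) auto
    also have "\<dots> \<le> real (card T)" using T(5) by simp
    finally show ?thesis .
  qed
  have Tne: "T \<noteq> {}" using cardT by (auto simp: not_le)
  define names where "names x = restrict (\<lambda>r. if (f ^^ (r mod L)) (x (r div L)) \<in> D then None
      else Some (\<xi> ((f ^^ (r mod L)) (x (r div L))))) {..<N * L}" for x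
  define sig where "sig x = (names x, restrict (\<lambda>j. cell (x j)) {..<N}, restrict (\<lambda>j. cell ((f ^^ L) (x j))) {..<N})" for x
  define Sp where "Sp = {s \<in> PiE {..<N * L} (\<lambda>_. insert None (Some ` \<xi> ` X)). real (card {r. r < N * L \<and> s r \<noteq> None}) \<le> R * \<kappa>}"
  define Sig where "Sig = Sp \<times> PiE {..<N} (\<lambda>_. {..<q}) \<times> PiE {..<N} (\<lambda>_. {..<q})"
  have fin\<xi>: "finite (\<xi> ` X)" using \<xi> by (simp add: finite_partitions_def)
  have finSp: "finite Sp" unfolding Sp_def
    by (rule finite_subset[of _ "PiE {..<N * L} (\<lambda>_. insert None (Some ` \<xi> ` X))"]) (use fin\<xi> in \<open>auto intro!: finite_PiE\<close>)
  have finSig: "finite Sig" unfolding Sig_def using finSp by (auto intro!: finite_PiE)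
  have xN: "x (r div L) \<in> X" if "x \<in> T" "r < N * L" for x r
    using T(2)[OF that(1)] that(2) by (simp add: less_mult_imp_div_less)
  have namesSp: "names x \<in> Sp" if x: "x \<in> T" for x
  proof -
    have "names x \<in> PiE {..<N * L} (\<lambda>_. insert None (Some ` \<xi> ` X))"
      unfolding names_def restrict_PiE_iff using xN[OF x] funpow_in by auto
    moreover have "real (card {r. r < N * L \<and> names x r \<noteq> None}) \<le> R * \<kappa>"
    proof -
      have "real (card {r. r < N * L \<and> names x r \<noteq> None}) = (\<Sum>r\<in>{r. r < N * L \<and> names x r \<noteq> None}. 1)" by simp
      also have "\<dots> = (\<Sum>r<N * L. bad ((f ^^ (r mod L)) (x (r div L))))"
        by (rule sum.mono_neutral_cong_left) (auto simp: names_def bad_def)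
      also have "\<dots> = (\<Sum>j<N. \<Sum>r=j*L..<j*L+L. bad ((f ^^ (r mod L)) (x (r div L))))"
        by (rule sum.nat_group[symmetric])
      also have "\<dots> = (\<Sum>j<N. z (x j))"
      proof (rule sum.cong[OF refl])
        fix j
        have "(\<Sum>r=j*L..<j*L+L. bad ((f ^^ (r mod L)) (x (r div L)))) = (\<Sum>i<L. bad ((f ^^ ((i + j*L) mod L)) (x ((i + j*L) div L))))"
          using sum.shift_bounds_nat_ivl[of "\<lambda>r. bad ((f ^^ (r mod L)) (x (r div L)))" 0 "j * L" L]
          by (simp add: lessThan_atLeast0 add.commute)
        thus "(\<Sum>r=j*L..<j*L+L. bad ((f ^^ (r mod L)) (x (r div L)))) = z (x j)" by (simp add: z_def)
      qed
      also have "\<dots> \<le> real N * integral\<^sup>L \<nu> z + real N * \<gamma>1" using T(3)[OF x, of z] by auto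
      also have "real N * integral\<^sup>L \<nu> z \<le> R * (\<kappa> / 2)" using mult_left_mono[OF intz, of "real N"] by (simp add: R_def mult.assoc)
      also have "real N * \<gamma>1 \<le> R * (\<kappa> / 2)" using R \<gamma>1 by (intro mult_mono) auto
      finally show ?thesis by simp
    qed
    ultimately show ?thesis by (simp add: Sp_def)
  qed
  have sigSig: "sig ` T \<subseteq> Sig"
  proof (rule image_subsetI)
    fix x assume x: "x \<in> T"
    have "cell (x j) < q" "cell ((f ^^ L) (x j)) < q" if "j < N" for j
      using cell T(2)[OF x that] funpow_in by blast+
    thus "sig x \<in> Sig" unfolding sig_def Sig_def using namesSp[OF x] by (simp add: restrict_PiE_iff)
  qed
  have cardSig: "real (card Sig) \<le> exp (R * (3 * \<gamma>))"
  proof -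
    obtain x0 where "x0 \<in> T" using Tne by blast
    hence q0: "q > 0" using cell T(2)[of x0 0] N(1) by fastforce
    have "real (card Sp) \<le> exp (\<mu> * (R * \<kappa>) + real (N * L) * (k * exp (- \<mu>)))"
      unfolding Sp_def k_def by (rule card_sparse_words[OF fin\<xi> \<mu>])
    also have "\<dots> \<le> exp (R * (2 * \<gamma>))"
    proof -
      have "R * (\<mu> * \<kappa>) \<le> R * \<gamma>" "R * (k * exp (- \<mu>)) \<le> R * \<gamma>" using R \<kappa>(2) k\<mu> by (auto intro: mult_left_mono)
      thus ?thesis by (simp add: R_def algebra_simps)
    qed
    finally have 1: "real (card Sp) \<le> exp (R * (2 * \<gamma>))" .
    have "exp (real N * ln (real q)) = real (q ^ N)" using q0 by (simp add: exp_of_nat_mult)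
    hence "real (q ^ N) * real (q ^ N) = exp (real N * ln (real q) + real N * ln (real q))" by (simp only: exp_add)
    also have "\<dots> = exp (real N * (2 * ln (real q)))" by (simp add: algebra_simps)
    also have "\<dots> \<le> exp (R * \<gamma>)" using L(3) by (simp add: R_def mult.assoc mult_left_mono)
    finally have 2: "real (q ^ N) * real (q ^ N) \<le> exp (R * \<gamma>)" .
    have "real (card Sig) = real (card Sp) * (real (q ^ N) * real (q ^ N))"
      by (simp add: Sig_def card_cartesian_product card_PiE)
    also have "\<dots> \<le> exp (R * (2 * \<gamma>)) * exp (R * \<gamma>)" using 1 2 by (intro mult_mono) auto
    also have "\<dots> = exp (R * (3 * \<gamma>))" by (simp flip: exp_add add: algebra_simps)
    finally show ?thesis .
  qed
  obtain \<sigma> where \<sigma>: "real (card T) \<le> real (card Sig) * real (card {x \<in> T. sig x = \<sigma>})"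
    using large_fibre[OF T(1) Tne finSig sigSig] by blast
  define T' where "T' = {x \<in> T. sig x = \<sigma>}"
  have cardT': "exp (R * (h + 2 * \<gamma>)) \<le> real (card T')"
  proof -
    have "exp (R * (3 * \<gamma>)) * exp (R * (h + 2 * \<gamma>)) = exp (R * (h0 - 3 * \<gamma>))"
      by (simp flip: exp_add add: \<gamma>(2) algebra_simps)
    also have "\<dots> \<le> real (card Sig) * real (card T')" using cardT \<sigma> by (simp add: T'_def)
    also have "\<dots> \<le> exp (R * (3 * \<gamma>)) * real (card T')" using cardSig by (intro mult_right_mono) auto
    finally show ?thesis by simp
  qed
  have T'T: "x \<in> T" if "x \<in> T'" for x using that by (simp add: T'_def)
  have finT': "finite T'" using T(1) by (simp add: T'_def)
  have T'ne: "T' \<noteq> {}" using cardT' by (auto simp: not_le)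
  then obtain x0 where x0: "x0 \<in> T'" by blast
  have sig_eq: "names x = names x'" "\<And>j. j < N \<Longrightarrow> cell (x j) = cell (x' j)"
    "\<And>j. j < N \<Longrightarrow> cell ((f ^^ L) (x j)) = cell ((f ^^ L) (x' j))" if "x \<in> T'" "x' \<in> T'" for x x'
  proof -
    have "sig x = sig x'" using that by (simp add: T'_def)
    hence *: "names x = names x'" "restrict (\<lambda>j. cell (x j)) {..<N} = restrict (\<lambda>j. cell (x' j)) {..<N}"
      "restrict (\<lambda>j. cell ((f ^^ L) (x j))) {..<N} = restrict (\<lambda>j. cell ((f ^^ L) (x' j))) {..<N}" by (auto simp: sig_def)
    show "names x = names x'" by (rule *)
    fix j assume "j < N"
    thus "cell (x j) = cell (x' j)" "cell ((f ^^ L) (x j)) = cell ((f ^^ L) (x' j))"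
      using fun_cong[OF *(2), of j] fun_cong[OF *(3), of j] by simp_all
  qed
  \<comment> \<open>The connectors are read off from one reference sequence \<open>x0\<close>; equal
    signatures make them fit every sequence of \<open>T'\<close>. The index modulo \<open>N\<close>
    closes the word up.\<close>
  define y where "y j = Y (cell ((f ^^ L) (x0 j))) (cell (x0 (Suc j mod N)))" for j
  define n where "n j = con (cell ((f ^^ L) (x0 j))) (cell (x0 (Suc j mod N)))" for j
  have connect: "y j \<in> X \<and> 1 \<le> n j \<and> n j \<le> M \<and> dist ((f ^^ L) (x j)) (y j) \<le> \<delta> \<and> dist ((f ^^ n j) (y j)) (x (Suc j mod N)) \<le> \<delta>"
    if x: "x \<in> T'" and j: "j < N" for x j
  proof -
    have j': "Suc j mod N < N" using N(1) by simp
    have "(f ^^ L) (x j) \<in> X" "x (Suc j mod N) \<in> X" using T(2)[OF T'T[OF x]] j j' funpow_in by blast+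
    from con[OF this] show ?thesis
      unfolding y_def n_def sig_eq(2)[OF x0 x j'] sig_eq(3)[OF x0 x j] .
  qed
  define P where "P = (\<Sum>j<N. L + n j)"
  let ?w = "orbit_word N L n y"
  define W where "W = ?w ` T'"
  have PR: "R \<le> real P" "real P \<le> real N * (real L + real M)"
  proof -
    have "(\<Sum>j<N. L) \<le> P" unfolding P_def by (intro sum_mono) simp
    thus "R \<le> real P" unfolding R_def of_nat_mult[symmetric] of_nat_le_iff by simp
    have "P \<le> (\<Sum>j<N. L + M)" unfolding P_def using connect[OF x0] by (intro sum_mono) simp
    hence "real P \<le> real (N * (L + M))" unfolding of_nat_le_iff by simp
    thus "real P \<le> real N * (real L + real M)" by simp
  qed
  have P0: "P > 0" using PR(1) R(1) by (cases P) auto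
  have sep: "\<exists>i<P. 4 * \<epsilon> \<le> dist (?w u ! i) (?w v ! i)" if u: "u \<in> T'" and v: "v \<in> T'" and uv: "u \<noteq> v" for u v
  proof -
    obtain j where j: "j < N" "?J L (u j) \<noteq> ?J L (v j)" using T(4)[OF T'T[OF u] T'T[OF v]] uv by blast
    then obtain i where i: "i < L" "\<xi> ((f ^^ i) (u j)) \<noteq> \<xi> ((f ^^ i) (v j))" by (auto simp: join_part_eq_iff)
    define r where "r = j * L + i"
    have "Suc j * L \<le> N * L" using j(1) by (intro mult_le_mono1) simp
    hence r: "r < N * L" "r mod L = i" "r div L = j" using i(1) by (simp_all add: r_def)
    have "names u r = names v r" using sig_eq(1)[OF u v] by simp
    \<comment> \<open>Equal entries are both \<open>None\<close> or carry equal labels; the labels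
      differ at this time, so both points lie in \<open>D\<close>.\<close>
    hence "(f ^^ i) (u j) \<in> D \<and> (f ^^ i) (v j) \<in> D" using r i(2) by (auto simp: names_def split: if_splits)
    hence "4 * \<epsilon> \<le> dist ((f ^^ i) (u j)) ((f ^^ i) (v j))" using Dsep[OF _ _ i(2)] \<epsilon>(2) by (meson order_trans)
    thus ?thesis using orbit_word_nth[OF j(1) i(1), of n] unfolding P_def by metis
  qed
  have inj: "inj_on ?w T'"
  proof (rule inj_onI, rule ccontr)
    fix u v assume "u \<in> T'" "v \<in> T'" "?w u = ?w v" "u \<noteq> v"
    thus False using sep[of u v] \<epsilon>(1) by auto
  qed
  have cardW: "card W = card T'" unfolding W_def by (rule card_image[OF inj])
  have "ereal (ln (real (card W)) / real P) \<le> bowen_entropy X f (Delta_sub X f U)"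
  proof (rule free_words_entropy_le[where G = G and \<eta> = \<eta> and \<delta> = \<delta> and \<epsilon> = \<epsilon> and c = "\<lambda>g. integral\<^sup>L \<nu> g"])
    show "finite W" "W \<noteq> {}" using finT' T'ne by (simp_all add: W_def)
    show "free_words \<delta> P W" unfolding W_def P_def
      by (rule free_orbit_words) (use N(1) L(1) \<delta>(1) connect x0 T(2) T'T in \<open>auto simp: Suc_le_eq\<close>)
    show "P > 0" by (rule P0)
    show "\<exists>i<P. 4 * \<epsilon> \<le> dist (v ! i) (w ! i)" if "v \<in> W" "w \<in> W" "v \<noteq> w" for v w
      using that sep unfolding W_def by blast
    show "\<exists>x\<in>X. \<forall>i. dist ((f ^^ i) x) (xs i) < \<epsilon>" if "pseudo_orbit X f \<delta> xs" for xs by (rule \<delta>(2)[OF that])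
    show "\<epsilon> > 0" "\<eta> > 0" by (rule \<epsilon>(1), rule \<eta>)
    show "continuous_on X g" if "g \<in> G" for g by (rule G(2)[OF that])
    show "\<bar>g x - g y\<bar> \<le> \<eta>" if "g \<in> G" "x \<in> X" "y \<in> X" "dist x y < \<epsilon>" for g x y
      using e1(2) that \<epsilon>(3) by (meson order_less_le_trans)
    show "\<bar>(\<Sum>i<P. g (w ! i)) - real P * integral\<^sup>L \<nu> g\<bar> \<le> real P * \<eta>" if g: "g \<in> G" and w: "w \<in> W" for g w
    proof -
      let ?I = "integral\<^sup>L \<nu> g"
      obtain x where x: "x \<in> T'" "w = ?w x" using w unfolding W_def by blast
      have "(\<Sum>i<P. g (w ! i)) - real P * ?I = (\<Sum>j<N. S g (x j) + (\<Sum>i<n j. g ((f ^^ i) (y j)))) - (\<Sum>j<N. real L * ?I + real (n j) * ?I)"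
        unfolding x(2) P_def orbit_word_sum S_def by (simp add: sum_distrib_right distrib_right)
      also have "\<dots> = ((\<Sum>j<N. S g (x j)) - real N * (real L * ?I)) + (\<Sum>j<N. \<Sum>i<n j. g ((f ^^ i) (y j)) - ?I)"
        by (simp add: sum.distrib sum_subtractf)
      finally have eq: "(\<Sum>i<P. g (w ! i)) - real P * ?I = \<dots>" .
      have "\<bar>(\<Sum>j<N. S g (x j)) - real N * (real L * ?I)\<bar> \<le> real N * \<gamma>1"
        using T(3)[OF T'T[OF x(1)], of "S g"] g intS[OF g] by auto
      also have "\<dots> \<le> R * (\<eta> / 2)" using R \<gamma>1 by (intro mult_mono) auto
      finally have 1: "\<bar>(\<Sum>j<N. S g (x j)) - real N * (real L * ?I)\<bar> \<le> R * (\<eta> / 2)" .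
      \<comment> \<open>Each connector has at most \<open>M\<close> points, each contributing at
        most \<open>2 * B\<close>; the choice of \<open>L\<close> turns the total into half of the
        allowed error.\<close>
      have "\<bar>\<Sum>j<N. \<Sum>i<n j. g ((f ^^ i) (y j)) - ?I\<bar> \<le> (\<Sum>j<N. real M * (2 * B))"
      proof (rule order_trans[OF sum_abs sum_mono])
        fix j assume "j \<in> {..<N}"
        hence j: "j < N" by simp
        have "\<bar>\<Sum>i<n j. g ((f ^^ i) (y j)) - ?I\<bar> \<le> (\<Sum>i<n j. 2 * B)"
        proof (rule order_trans[OF sum_abs sum_mono])
          fix i
          have "\<bar>g ((f ^^ i) (y j))\<bar> \<le> B" using connect[OF x0 j] by (intro B(2)[OF g] funpow_in) simp
          thus "\<bar>g ((f ^^ i) (y j)) - ?I\<bar> \<le> 2 * B" using intB[OF g] by linarith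
        qed
        also have "\<dots> = real (n j) * (2 * B)" by simp
        also have "\<dots> \<le> real M * (2 * B)" using connect[OF x0 j] B(1) by (intro mult_right_mono) auto
        finally show "\<bar>\<Sum>i<n j. g ((f ^^ i) (y j)) - ?I\<bar> \<le> real M * (2 * B)" .
      qed
      also have "\<dots> = real N * (4 * B * real M) / 2" by simp
      also have "\<dots> \<le> real N * (real L * \<eta>) / 2" using L(5) by (intro divide_right_mono mult_left_mono) auto
      also have "\<dots> = R * (\<eta> / 2)" by (simp add: R_def)
      finally have 2: "\<bar>\<Sum>j<N. \<Sum>i<n j. g ((f ^^ i) (y j)) - ?I\<bar> \<le> R * (\<eta> / 2)" .
      have "\<bar>(\<Sum>i<P. g (w ! i)) - real P * ?I\<bar> \<le> R * (\<eta> / 2) + R * (\<eta> / 2)"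
        unfolding eq using 1 2 by (intro order_trans[OF abs_triangle_ineq] add_mono)
      also have "\<dots> = R * \<eta>" by simp
      also have "\<dots> \<le> real P * \<eta>" using PR(1) \<eta> by (intro mult_right_mono) auto
      finally show ?thesis .
    qed
    show "\<mu> \<in> U" if "\<mu> \<in> Minv X f" "\<And>g. g \<in> G \<Longrightarrow> \<bar>integral\<^sup>L \<mu> g - integral\<^sup>L \<nu> g\<bar> \<le> 3 * \<eta>" for \<mu>
      by (rule U[OF that])
  qed
  moreover have "h \<le> ln (real (card W)) / real P"
  proof -
    have W1: "1 \<le> real (card W)" unfolding cardW using finT' T'ne by (simp add: Suc_le_eq card_gt_0_iff)
    \<comment> \<open>A nonpositive \<open>h\<close> lies below the quotient anyway; only for
      positive \<open>h\<close> does the upper bound on \<open>P\<close> point in the right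
      direction.\<close>
    have "h * real P \<le> ln (real (card W))"
    proof (cases "h \<le> 0")
      case True
      hence "h * real P \<le> 0" by (simp add: mult_nonpos_nonneg)
      also have "0 \<le> ln (real (card W))" using W1 by simp
      finally show ?thesis .
    next
      case False
      have "h * real P \<le> h * (real N * (real L + real M))" using PR(2) False by (intro mult_left_mono) auto
      also have "\<dots> = R * h + real N * (h * real M)" by (simp add: R_def algebra_simps)
      also have "\<dots> \<le> R * h + real N * (real L * (2 * \<gamma>))" using L(4) by (intro add_left_mono mult_left_mono) auto
      also have "\<dots> = ln (exp (R * (h + 2 * \<gamma>)))" by (simp add: R_def algebra_simps)
      also have "\<dots> \<le> ln (real (card W))" using cardT' W1 unfolding cardW by (subst ln_le_cancel_iff) auto
      finally show ?thesis .
    qed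
    thus ?thesis using P0 by (simp add: field_simps)
  qed
  ultimately show ?thesis by (meson ereal_less_eq(3) order_trans)
qed

lemma ms_entropy_le_bowen_entropy_Delta_sub:
  assumes trans: "top_transitive X f" and shad: "shadowing X f"
    and U: "openin (weak_star_inv X f) U" and \<nu>: "\<nu> \<in> U"
  shows "ms_entropy X f \<nu> \<le> bowen_entropy X f (Delta_sub X f U)"
proof -
  obtain S where S: "openin (weak_star X) S" "U = S \<inter> Minv X f"
    using U unfolding weak_star_inv_def openin_subtopology by blast
  have \<nu>M: "\<nu> \<in> Minv X f" "\<nu> \<in> S" using \<nu> S by auto
  obtain G \<eta> where G: "finite G" "\<And>g. g \<in> G \<Longrightarrow> continuous_on X g" "\<eta> > (0::real)"
    "\<And>\<mu>. \<mu> \<in> probs X \<Longrightarrow> (\<And>g. g \<in> G \<Longrightarrow> \<bar>integral\<^sup>L \<mu> g - integral\<^sup>L \<nu> g\<bar> < \<eta>) \<Longrightarrow> \<mu> \<in> S"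
    using weak_star_nbhd[OF S(1) \<nu>M(2)] by blast
  show ?thesis
    unfolding ms_entropy_def
  proof (rule SUP_least, rule ereal_le_epsilon2)
    fix \<xi> and e :: real assume \<xi>: "\<xi> \<in> finite_partitions X" and e: "0 < e"
    \<comment> \<open>With \<open>\<eta> / 4\<close> as tolerance, the closed condition
      \<open>\<le> 3 * (\<eta> / 4)\<close> implies the open condition \<open>< \<eta>\<close> that
      describes the neighbourhood.\<close>
    have "ereal (ent_part \<nu> X f \<xi> - e) \<le> bowen_entropy X f (Delta_sub X f U)"
    proof (rule less_ent_part_le_bowen_entropy_Delta_sub[OF trans shad \<nu>M(1) \<xi> _ G(1,2), of "ent_part \<nu> X f \<xi> - e" "\<eta> / 4"])
      show "ent_part \<nu> X f \<xi> - e < ent_part \<nu> X f \<xi>" "\<eta> / 4 > 0" using e G(3) by simp_all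
      fix \<mu> assume \<mu>: "\<mu> \<in> Minv X f" "\<And>g. g \<in> G \<Longrightarrow> \<bar>integral\<^sup>L \<mu> g - integral\<^sup>L \<nu> g\<bar> \<le> 3 * (\<eta> / 4)"
      have "\<mu> \<in> S"
      proof (rule G(4))
        show "\<mu> \<in> probs X" using \<mu>(1) by (simp add: Minv_def)
        show "\<bar>integral\<^sup>L \<mu> g - integral\<^sup>L \<nu> g\<bar> < \<eta>" if "g \<in> G" for g using \<mu>(2)[OF that] G(3) by simp
      qed
      thus "\<mu> \<in> U" using \<mu>(1) S(2) by simp
    qed
    thus "ereal (ent_part \<nu> X f \<xi>) \<le> bowen_entropy X f (Delta_sub X f U) + ereal e"
      by (cases "bowen_entropy X f (Delta_sub X f U)") auto
  qed
qed

end

theorem theorem2p1: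
  fixes X :: "'a::metric_space set" and f :: "'a \<Rightarrow> 'a" and U :: "'a measure set"
  assumes "tds X f"
    and "top_transitive X f"
    and "shadowing X f"
    and "openin (weak_star_inv X f) U" and "U \<noteq> {}"
  shows "bowen_entropy X f (Delta_sub X f U) = bowen_entropy X f (Delta_cap X f U)
       \<and> bowen_entropy X f (Delta_cap X f U) = (SUP \<nu> \<in> U. ms_entropy X f \<nu>)"
proof -
  interpret compact_system X f
    using assms(1) by unfold_locales (auto simp: tds_def)
  have "U \<subseteq> Minv X f"
    using openin_subset[OF assms(4)] by (auto simp: weak_star_inv_def)
  hence "bowen_entropy X f (Delta_cap X f U) \<le> (SUP \<nu> \<in> U. ms_entropy X f \<nu>)"
    using assms(5) by (rule bowen_entropy_Delta_cap_le)
  moreover have "(SUP \<nu> \<in> U. ms_entropy X f \<nu>) \<le> bowen_entropy X f (Delta_sub X f U)"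
    by (intro SUP_least ms_entropy_le_bowen_entropy_Delta_sub assms)
  moreover have "bowen_entropy X f (Delta_sub X f U) \<le> bowen_entropy X f (Delta_cap X f U)"
    by (intro bowen_entropy_mono Delta_sub_subset_Delta_cap)
  ultimately show ?thesis by (intro conjI) (auto intro: antisym order_trans)
qed

end
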